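(* There exists no probability measure $\mu'$ on $\{0,1\}^{\mathbb{Z}^2}$ which possesses all of the following properties: (i) $\mu'$ is positively associated; (ii) $\mu'$-almost surely there exists a single (i.e. exactly one) infinite $0$cluster; (iii) $\mu'$-almost surely there exists at most one infinite $1*$cluster; (iv') the distribution of the infinite boundary, conditioned on its existence, is translation-invariant; (v') with positive probability there exists an infinite $1*$cluster.
   Context: $\{0,1\}^{\mathbb{Z}^2}$ carries the $\sigma$-algebra generated by the cylinder sets. Two nodes of $\mathbb{Z}^2$ are adjacent if their Euclidean distance is $1$, and $*$adjacent if it is $1$ or $\sqrt2$. For a configuration $\sigma\in\{0,1\}^{\mathbb{Z}^2}$, a $0$cluster is a maximal subset of $\sigma^{-1}(0)$ that is connected with respect to adjacency; a $1*$cluster is a maximal subset of $\sigma^{-1}(1)$ that is connected with respect to $*$adjacency. An event $A\subset\{0,1\}^{\mathbb{Z}^2}$ is increasing if $\xi\in A$ and $\eta\ge\xi$ (pointwise) imply $\eta\in A$. A probability measure $\mu'$ on $\{0,1\}^{\mathbb{Z}^2}$ is positively associated if $\mu'(A\cap B)\ge\mu'(A)\mu'(B)$ for all increasing events $A,B$. Infinite boundary: consider the event that a single infinite $0$cluster and a single infinite $1*$cluster exist (the infinite boundary is said to exist exactly on this event). On this event, fill the finite holes of the infinite $1*$cluster, i.e. flip the spin of all $0$clusters that are $*$encircled by the infinite $1*$cluster. Let each node of this filled infinite $1*$cluster be the center of an (axis-parallel) square in $\mathbb{R}^2$ with sidelength $3/2$. The infinite boundary is the topological boundary in $\mathbb{R}^2$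 of the union of these squares. Translation-invariance refers to translations by vectors of $\mathbb{Z}^2$. *)

theory Defs
  imports "HOL-Probability.Probability"
begin

type_synonym node = "int \<times> int"

(* True is spin 1 and False is spin 0, so the pointwise order of spins is the order on functions. *)
type_synonym config = "node \<Rightarrow> bool"

(* The product sigma-algebra; the measure carried by this term plays no role. *)
definition config_space :: "config measure" where
  "config_space = PiM UNIV (\<lambda>_. count_space UNIV)"

definition embed :: "node \<Rightarrow> real \<times> real" where
  "embed v = (real_of_int (fst v), real_of_int (snd v))"

definition adjacent :: "node \<Rightarrow> node \<Rightarrow> bool" where
  "adjacent u v \<longleftrightarrow> dist (embed u) (embed v) = 1"

definition star_adjacent :: "node \<Rightarrow> node \<Rightarrow> bool" where
  "star_adjacent u v \<longleftrightarrow> dist (embed u) (embed v) = 1 \<or> dist (embed u) (embed v) = sqrt 2"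

definition connected_wrt :: "(node \<Rightarrow> node \<Rightarrow> bool) \<Rightarrow> node set \<Rightarrow> bool" where
  "connected_wrt r S \<longleftrightarrow> (\<forall>x\<in>S. \<forall>y\<in>S. (\<lambda>u v. u \<in> S \<and> v \<in> S \<and> r u v)\<^sup>*\<^sup>* x y)"

definition component_wrt :: "(node \<Rightarrow> node \<Rightarrow> bool) \<Rightarrow> node set \<Rightarrow> node set \<Rightarrow> bool" where
  "component_wrt r A C \<longleftrightarrow> C \<subseteq> A \<and> connected_wrt r C \<and>
     (\<forall>D. C \<subseteq> D \<and> D \<subseteq> A \<and> connected_wrt r D \<longrightarrow> D = C)"

definition zero_cluster :: "config \<Rightarrow> node set \<Rightarrow> bool" where
  "zero_cluster \<sigma> = component_wrt adjacent {v. \<not> \<sigma> v}"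

definition one_star_cluster :: "config \<Rightarrow> node set \<Rightarrow> bool" where
  "one_star_cluster \<sigma> = component_wrt star_adjacent {v. \<sigma> v}"

definition increasing_event :: "config set \<Rightarrow> bool" where
  "increasing_event A \<longleftrightarrow> (\<forall>\<xi> \<eta>. \<xi> \<in> A \<and> \<xi> \<le> \<eta> \<longrightarrow> \<eta> \<in> A)"

definition positively_associated :: "config measure \<Rightarrow> bool" where
  "positively_associated M \<longleftrightarrow>
     (\<forall>A\<in>sets M. \<forall>B\<in>sets M. increasing_event A \<and> increasing_event B \<longrightarrow>
        measure M (A \<inter> B) \<ge> measure M A * measure M B)"

definition star_circuit :: "node list \<Rightarrow> bool" where
  "star_circuit p \<longleftrightarrow> p \<noteq> [] \<and> successively star_adjacent (p @ [hd p])"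

(* D lies inside a *circuit of nodes of I: the interior of a *circuit consists of the finite
   adjacency components of its complement.  Circuits may revisit nodes, which does not affect
   which sets D are encircled. *)
definition star_encircled :: "node set \<Rightarrow> node set \<Rightarrow> bool" where
  "star_encircled I D \<longleftrightarrow>
     (\<exists>p H. star_circuit p \<and> set p \<subseteq> I \<and>
            component_wrt adjacent (- set p) H \<and> finite H \<and> D \<subseteq> H)"

definition infinite_zero_cluster :: "config \<Rightarrow> node set \<Rightarrow> bool" where
  "infinite_zero_cluster \<sigma> C \<longleftrightarrow> zero_cluster \<sigma> C \<and> infinite C"

definition infinite_one_star_cluster :: "config \<Rightarrow> node set \<Rightarrow> bool" where
  "infinite_one_star_cluster \<sigma> C \<longleftrightarrow> one_star_cluster \<sigma> C \<and> infinite C"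

definition boundary_exists :: "config \<Rightarrow> bool" where
  "boundary_exists \<sigma> \<longleftrightarrow>
     (\<exists>!C. infinite_zero_cluster \<sigma> C) \<and> (\<exists>!C. infinite_one_star_cluster \<sigma> C)"

definition fill_holes :: "config \<Rightarrow> node set \<Rightarrow> config" where
  "fill_holes \<sigma> I = (\<lambda>v. \<sigma> v \<or> (\<exists>D. zero_cluster \<sigma> D \<and> star_encircled I D \<and> v \<in> D))"

(* The *cluster containing the infinite 1*cluster after the flips; it thereby also absorbs finite
   1*clusters that lay inside the filled holes. *)
definition filled_infinite_one_star_cluster :: "config \<Rightarrow> node set" where
  "filled_infinite_one_star_cluster \<sigma> =
     (let I = (THE I. infinite_one_star_cluster \<sigma> I)
      in THE F. one_star_cluster (fill_holes \<sigma> I) F \<and> I \<subseteq> F)"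

definition node_square :: "node \<Rightarrow> (real \<times> real) set" where
  "node_square v = cbox (embed v - (3/4, 3/4)) (embed v + (3/4, 3/4))"

(* The value {} where no infinite boundary exists is a dummy, never seen after conditioning. *)
definition infinite_boundary :: "config \<Rightarrow> (real \<times> real) set" where
  "infinite_boundary \<sigma> =
     (if boundary_exists \<sigma>
      then frontier (\<Union>v\<in>filled_infinite_one_star_cluster \<sigma>. node_square v)
      else {})"

(* Closed subsets of the plane with the sigma-algebra generated by the hitting events of compact
   sets (the Borel sigma-algebra of the Fell topology), the standard one for random closed sets. *)
definition closed_set_space :: "(real \<times> real) set measure" where
  "closed_set_space =
     sigma {F. closed F} {{F. closed F \<and> F \<inter> K \<noteq> {}} | K. compact K}"

definition boundary_distribution :: "config measure \<Rightarrow> (real \<times> real) set measure" where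
  "boundary_distribution M =
     distr (uniform_measure M {\<sigma> \<in> space M. boundary_exists \<sigma>}) closed_set_space infinite_boundary"

definition translation_invariant :: "(real \<times> real) set measure \<Rightarrow> bool" where
  "translation_invariant P \<longleftrightarrow>
     (\<forall>z. distr P closed_set_space (\<lambda>F. (\<lambda>x. x + embed z) ` F) = P)"

end

theory Submission
  imports Defs
begin

text \<open>Fill the holes of the infinite 1*cluster to obtain a random set \<open>F\<close>, empty when there is no such cluster. As an
  increasing function of the configuration, \<open>F\<close> is positively associated, and as it can be read off from the infinite
  boundary, its law is translation-invariant. Moreover \<open>F\<close> is *connected and the complement of \<open>F\<close> has a unique
  infinite component: the inner boundary of any infinite component is connected and consists of zeros.

  Divide the boundary of a large box into three sides. A ball that meets the infinite cluster is connected to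
  one of the sides, to some side with high probability by the square root trick. By Sperner's lemma there are three
  neighbouring balls that are likely to be connected to the three sides respectively, and by uniqueness
  the three connections are joined to a tripod. So in large boxes the complement of \<open>F\<close> contains a tripod with
  probability close to 1, and \<open>F\<close> contains one with probability bounded away from 0. By planarity the two exclude each
  other.\<close>

section \<open>Lattice paths\<close>

text \<open>Translation invariance comes without reflection symmetry and without ergodicity. So it
  cannot be prescribed from where the sides of a box are reached, and the two colours may prefer
  different places. Three sides cope with this: one tripod of each colour is contradictory wherever
  their centres lie, and Sperner's lemma finds a suitable place for each colour separately.
  Conditioning on the existence of the boundary may destroy positive association, so the
  unconditional law of \<open>F\<close> is used. Off that event \<open>F\<close> is almost surely
  empty, which every translation preserves. The price is that \<open>F\<close> percolates only with
  some probability \<open>p > 0\<close>: its arms get a probability \<open>c\<close> with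
  \<open>(1 - c)^3 > 1 - p\<close>, nothing near 1. That is enough because the complement of
  \<open>F\<close> percolates almost surely. The passage to \<open>F\<close> is forced by the
  hypothesis: only the boundary has an invariant law, and it shows neither the contents of the holes
  nor the finite 1*clusters elsewhere. Its cost is that uniqueness of the infinite cluster has to be
  proved anew for the complement of \<open>F\<close>.\<close>

lemma dist_embed_sq:
  "(dist (embed u) (embed v))\<^sup>2 = of_int ((fst u - fst v)\<^sup>2 + (snd u - snd v)\<^sup>2)"
  by (simp add: embed_def dist_Pair_Pair dist_real_def)

lemma dist_embed_eq_sqrt_iff:
  assumes "n \<ge> (0::int)"
  shows "dist (embed u) (embed v) = sqrt (of_int n) \<longleftrightarrow> (fst u - fst v)\<^sup>2 + (snd u - snd v)\<^sup>2 = n"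
proof -
  have "dist (embed u) (embed v) = sqrt (of_int n) \<longleftrightarrow> (dist (embed u) (embed v))\<^sup>2 = of_int n"
    using assms by (metis of_int_0_le_iff real_sqrt_pow2 real_sqrt_unique zero_le_dist)
  then show ?thesis
    unfolding dist_embed_sq of_int_eq_iff .
qed

lemma int_sum_squares_le_2:
  assumes "(x::int)\<^sup>2 + y\<^sup>2 \<le> 2"
  shows "x \<in> {-1,0,1}"
proof -
  have "\<bar>x\<bar> < 2"
  proof (rule ccontr)
    assume "\<not> \<bar>x\<bar> < 2"
    then have "2\<^sup>2 \<le> \<bar>x\<bar>\<^sup>2" by (intro power_mono) auto
    then have "4 \<le> x\<^sup>2" by simp
    moreover have "0 \<le> y\<^sup>2" by simp
    ultimately show False using assms by linarith
  qed
  then show ?thesis by auto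
qed

lemma int_sum_squares_eq_1_iff: "(x::int)\<^sup>2 + y\<^sup>2 = 1 \<longleftrightarrow> \<bar>x\<bar> + \<bar>y\<bar> = 1"
proof
  assume *: "x\<^sup>2 + y\<^sup>2 = 1"
  then have "x \<in> {-1,0,1}" "y \<in> {-1,0,1}" 
    using int_sum_squares_le_2[of x y] int_sum_squares_le_2[of y x] by auto
  with * show "\<bar>x\<bar> + \<bar>y\<bar> = 1" by auto
next
  assume "\<bar>x\<bar> + \<bar>y\<bar> = 1"
  then have "x = 0 \<and> \<bar>y\<bar> = 1 \<or> \<bar>x\<bar> = 1 \<and> y = 0" by arith
  then show "x\<^sup>2 + y\<^sup>2 = 1" by (auto simp: abs_if split: if_splits)
qed

lemma int_sum_squares_eq_2_iff: "(x::int)\<^sup>2 + y\<^sup>2 = 2 \<longleftrightarrow> \<bar>x\<bar> = 1 \<and> \<bar>y\<bar> = 1"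
proof
  assume *: "x\<^sup>2 + y\<^sup>2 = 2"
  then have "x \<in> {-1,0,1}" "y \<in> {-1,0,1}" 
    using int_sum_squares_le_2[of x y] int_sum_squares_le_2[of y x] by auto
  with * show "\<bar>x\<bar> = 1 \<and> \<bar>y\<bar> = 1" by auto
next
  assume "\<bar>x\<bar> = 1 \<and> \<bar>y\<bar> = 1"
  then show "x\<^sup>2 + y\<^sup>2 = 2" by (auto simp: abs_if split: if_splits)
qed

lemma adjacent_iff: "adjacent u v \<longleftrightarrow> \<bar>fst u - fst v\<bar> + \<bar>snd u - snd v\<bar> = 1"
  using dist_embed_eq_sqrt_iff[of 1 u v] by (simp add: adjacent_def int_sum_squares_eq_1_iff)

lemma star_adjacent_iff: "star_adjacent u v \<longleftrightarrow> u \<noteq> v \<and> \<bar>fst u - fst v\<bar> \<le> 1 \<and> \<bar>snd u - snd v\<bar> \<le> 1"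
proof -
  have "star_adjacent u v \<longleftrightarrow> \<bar>fst u - fst v\<bar> + \<bar>snd u - snd v\<bar> = 1 \<or> \<bar>fst u - fst v\<bar> = 1 \<and> \<bar>snd u - snd v\<bar> = 1"
    using dist_embed_eq_sqrt_iff[of 1 u v] dist_embed_eq_sqrt_iff[of 2 u v]
    by (simp add: star_adjacent_def int_sum_squares_eq_1_iff int_sum_squares_eq_2_iff)
  also have "\<dots> \<longleftrightarrow> u \<noteq> v \<and> \<bar>fst u - fst v\<bar> \<le> 1 \<and> \<bar>snd u - snd v\<bar> \<le> 1"
    by (auto simp: prod_eq_iff)
  finally show ?thesis .
qed

lemma adjacent_imp_star_adjacent: "adjacent u v \<Longrightarrow> star_adjacent u v"
  by (simp add: adjacent_def star_adjacent_def)

lemma symp_adjacent: "symp adjacent" and symp_star_adjacent: "symp star_adjacent"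
  by (auto simp: symp_def adjacent_def star_adjacent_def dist_commute)

text \<open>Reflexive at every node, also outside \<open>S\<close>, so membership of an endpoint in
  \<open>S\<close> is asked for separately wherever it matters.\<close>

definition conn :: "('a \<Rightarrow> 'a \<Rightarrow> bool) \<Rightarrow> 'a set \<Rightarrow> 'a \<Rightarrow> 'a \<Rightarrow> bool" where
  "conn r S = (\<lambda>u v. u \<in> S \<and> v \<in> S \<and> r u v)\<^sup>*\<^sup>*"

lemma conn_refl [simp, intro]: "conn r S u u"
  by (simp add: conn_def)

lemma conn_trans [trans]: "conn r S u v \<Longrightarrow> conn r S v w \<Longrightarrow> conn r S u w"
  by (simp add: conn_def)

lemma conn_edge: "u \<in> S \<Longrightarrow> v \<in> S \<Longrightarrow> r u v \<Longrightarrow> conn r S u v"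
  by (auto simp: conn_def)

lemma conn_mono: "conn r S u v \<Longrightarrow> S \<subseteq> T \<Longrightarrow> conn r T u v"
  unfolding conn_def by (erule rtranclp_mono[THEN predicate2D, rotated]) auto

lemma conn_mono_rel: "conn r S u v \<Longrightarrow> (\<And>x y. r x y \<Longrightarrow> r' x y) \<Longrightarrow> conn r' S u v"
  unfolding conn_def by (erule rtranclp_mono[THEN predicate2D, rotated]) auto

lemma conn_sym: "symp r \<Longrightarrow> conn r S u v \<Longrightarrow> conn r S v u"
  unfolding conn_def by (rule sympD[OF symp_rtranclp]) (auto simp: symp_def)

lemma conn_in2: "conn r S u v \<Longrightarrow> u \<in> S \<Longrightarrow> v \<in> S"
  unfolding conn_def by (induction rule: rtranclp_induct) auto

lemma conn_induct [consumes 1, case_names base step]: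
  assumes "conn r S u v" "P u" "\<And>x y. conn r S u x \<Longrightarrow> x \<in> S \<Longrightarrow> y \<in> S \<Longrightarrow> r x y \<Longrightarrow> P x \<Longrightarrow> P y"
  shows "P v"
  using assms(1) unfolding conn_def
  by (induction rule: rtranclp_induct) (use assms(2,3) in \<open>auto simp: conn_def\<close>)

lemma conn_image:
  assumes "conn r S u v" "\<And>x y. r x y \<Longrightarrow> r (f x) (f y)"
  shows "conn r (f ` S) (f u) (f v)"
  using assms(1)
proof (induction rule: conn_induct)
  case (step x y)
  then show ?case by (meson assms(2) conn_edge conn_trans imageI)
qed auto

lemma conn_exit:
  assumes "conn r S u v" "u \<in> T" "v \<notin> T"
  obtains x y where "conn r (S \<inter> T) u x" "x \<in> S \<inter> T" "y \<in> S - T" "r x y"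
proof -
  have "(v \<in> T \<and> conn r (S \<inter> T) u v) \<or> (\<exists>x y. conn r (S \<inter> T) u x \<and> x \<in> S \<inter> T \<and> y \<in> S - T \<and> r x y)"
    using assms(1)
  proof (induction rule: conn_induct)
    case base
    then show ?case using assms by simp
  next
    case (step x y)
    then show ?case
      by (cases "y \<in> T") (auto intro: conn_trans conn_edge)
  qed
  with assms(3) that show thesis by blast
qed

lemma conn_path:
  assumes "conn r S u v" "u \<in> S"
  obtains p where "p \<noteq> []" "hd p = u" "last p = v" "set p \<subseteq> S" "successively r p"
proof -
  have "\<exists>p. p \<noteq> [] \<and> hd p = u \<and> last p = v \<and> set p \<subseteq> S \<and> successively r p"
    using assms(1)
  proof (induction rule: conn_induct)
    case base
    then show ?case using assms by (intro exI[of _ "[u]"]) auto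
  next
    case (step x y)
    then obtain p where "p \<noteq> []" "hd p = u" "last p = x" "set p \<subseteq> S" "successively r p" by auto
    with step show ?case by (intro exI[of _ "p @ [y]"]) (auto simp: successively_append_iff)
  qed
  with that show thesis by blast
qed

lemma path_conn:
  assumes "successively r p" "p \<noteq> []" "set p \<subseteq> S"
  shows "conn r S (hd p) (last p)"
  using assms
proof (induction p rule: induct_list012)
  case (3 x y zs)
  then have "conn r S x y" by (intro conn_edge) auto
  also have "conn r S y (last (y # zs))" using 3 by auto
  finally show ?case by simp
qed auto

lemma connected_wrt_iff: "connected_wrt r S \<longleftrightarrow> (\<forall>x\<in>S. \<forall>y\<in>S. conn r S x y)"
  by (simp add: connected_wrt_def conn_def)

definition centered_box :: "int \<Rightarrow> node set" where
  "centered_box n = {v. \<bar>fst v\<bar> \<le> n \<and> \<bar>snd v\<bar> \<le> n}"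

lemma box_mono: "m \<le> n \<Longrightarrow> centered_box m \<subseteq> centered_box n"
  by (auto simp: centered_box_def)

lemma finite_box: "finite (centered_box n)"
proof -
  have "centered_box n \<subseteq> {-n..n} \<times> {-n..n}" by (auto simp: centered_box_def)
  then show ?thesis by (rule finite_subset) auto
qed

section \<open>Planarity\<close>

text \<open>The ray to the right at height j + 1/2 crosses this edge, in whichever direction it is
  traversed. Half-integer heights avoid the nodes; in effect (i, j) stands for the unit face with
  lower left corner (i, j).\<close>

definition upward_edge :: "node \<Rightarrow> node \<Rightarrow> int \<Rightarrow> int \<Rightarrow> bool" where
  "upward_edge u v i j \<longleftrightarrow> fst u = fst v \<and> i < fst u \<and> (snd u = j \<and> snd v = j + 1 \<or> snd v = j \<and> snd u = j + 1)"

fun ray_parity :: "node list \<Rightarrow> int \<Rightarrow> int \<Rightarrow> bool" where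
  "ray_parity (u # v # p) i j \<longleftrightarrow> upward_edge u v i j \<noteq> ray_parity (v # p) i j"
| "ray_parity _ i j \<longleftrightarrow> False"

lemma ray_parity_append:
  assumes "p \<noteq> []" "q \<noteq> []"
  shows "ray_parity (p @ q) i j \<longleftrightarrow> (ray_parity p i j \<noteq> ray_parity q i j) \<noteq> upward_edge (last p) (hd q) i j"
  using assms
  by (induction p i j rule: ray_parity.induct) (auto simp: neq_Nil_conv)

text \<open>An edge crosses exactly one of the two rays iff exactly one of its ends lies in row j to
  the right of column i; a horizontal edge could change this only at (i, j), which the path avoids.
  Telescoping along the path leaves its two ends, which are assumed not to lie there.\<close>

lemma ray_parity_row:
  assumes "successively adjacent p" "p \<noteq> []" "(i, j) \<notin> set p"
    "\<not> (snd (hd p) = j \<and> i < fst (hd p))" "\<not> (snd (last p) = j \<and> i < fst (last p))"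
  shows "ray_parity p i j \<longleftrightarrow> ray_parity p i (j - 1)"
proof -
  have "(ray_parity p i j \<noteq> ray_parity p i (j - 1)) \<longleftrightarrow>
    ((snd (hd p) = j \<and> i < fst (hd p)) \<noteq> (snd (last p) = j \<and> i < fst (last p)))"
    using assms(1-3)
  proof (induction p rule: induct_list012)
    case (3 u v p)
    have "(i, j) \<noteq> u" "(i, j) \<noteq> v" "adjacent u v" using 3(3,5) by auto
    then have *: "(upward_edge u v i j \<noteq> upward_edge u v i (j-1)) \<longleftrightarrow>
      ((snd u = j \<and> i < fst u) \<noteq> (snd v = j \<and> i < fst v))"
      unfolding upward_edge_def adjacent_iff prod_eq_iff fst_conv snd_conv by smt
    have "(ray_parity (v # p) i j \<noteq> ray_parity (v # p) i (j - 1)) \<longleftrightarrow>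
    ((snd (hd (v # p)) = j \<and> i < fst (hd (v # p))) \<noteq> (snd (last (v # p)) = j \<and> i < fst (last (v # p))))"
      by (rule 3(2)) (use 3(3-5) in auto)
    moreover have "last (u # v # p) = last (v # p)" by simp
    ultimately show ?case
      using * unfolding ray_parity.simps(1) list.sel by (smt (verit))
  qed auto
  then show ?thesis using assms by blast
qed

text \<open>The two rays compared differ in a single edge of column i, and in both cases that edge
  ends at (i, j).\<close>

lemma ray_parity_col:
  assumes "(i, j) \<notin> set p"
  shows "ray_parity p (i - 1) j \<longleftrightarrow> ray_parity p i j" "ray_parity p (i - 1) (j - 1) \<longleftrightarrow> ray_parity p i (j - 1)"
proof -
  have *: "upward_edge u v (i - 1) k \<longleftrightarrow> upward_edge u v i k" if "(i, j) \<noteq> u" "(i, j) \<noteq> v" "k \<in> {j, j - 1}" for u v k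
    using that unfolding upward_edge_def prod_eq_iff by auto
  show "ray_parity p (i - 1) j \<longleftrightarrow> ray_parity p i j" "ray_parity p (i - 1) (j - 1) \<longleftrightarrow> ray_parity p i (j - 1)"
    using assms by (induction p rule: induct_list012) (simp_all add: *)
qed

text \<open>By the row and column lemmas, avoiding a node makes the parities agree on the four faces
  around it, and *adjacent nodes have a face in common. The condition on the ends of the path enters
  through \<open>ray_parity_row\<close>.\<close>

lemma ray_parity_star_adjacent:
  assumes p: "successively adjacent p" "p \<noteq> []" and uv: "star_adjacent u v" "u \<notin> set p" "v \<notin> set p"
    and ends: "snd (hd p) \<notin> {snd u, snd v}" "snd (last p) \<notin> {snd u, snd v}"
  shows "ray_parity p (fst u) (snd u) \<longleftrightarrow> ray_parity p (fst v) (snd v)"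
proof -
  obtain i j where u: "u = (i, j)" by fastforce
  obtain k l where v: "v = (k, l)" by fastforce
  note * = ray_parity_row[OF p, of i j] ray_parity_row[OF p, of k l]
    ray_parity_col[of i j p] ray_parity_col[of k l p]
  have "k \<in> {i-1, i, i+1}" "l \<in> {j-1,j,j+1}" using uv(1) u v by (auto simp: star_adjacent_iff)
  then show ?thesis using * uv(2,3) ends u v by auto
qed

lemma ray_parity_conn:
  assumes p: "successively adjacent p" "p \<noteq> []" and uv: "conn star_adjacent S u v" 
    and S: "S \<inter> set p = {}" "\<And>x. x \<in> S \<Longrightarrow> snd x \<noteq> snd (hd p) \<and> snd x \<noteq> snd (last p)"
  shows "ray_parity p (fst u) (snd u) \<longleftrightarrow> ray_parity p (fst v) (snd v)"
  using uv
proof (induction rule: conn_induct)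
  case (step x y)
  have "x \<notin> set p" "y \<notin> set p" using step(2,3) S(1) by blast+
  moreover have "snd (hd p) \<notin> {snd x, snd y}" "snd (last p) \<notin> {snd x, snd y}"
    using S(2)[OF step(2)] S(2)[OF step(3)] by auto
  ultimately have "ray_parity p (fst x) (snd x) \<longleftrightarrow> ray_parity p (fst y) (snd y)"
    using step(4) by (intro ray_parity_star_adjacent[OF p])
  with step show ?case by simp
qed auto

lemma ray_parity_right_False:
  assumes "\<And>u. u \<in> set p \<Longrightarrow> fst u \<le> i"
  shows "\<not> ray_parity p i j"
  using assms
proof (induction p rule: induct_list012)
  case (3 x y zs)
  then have "fst x \<le> i" "\<not> ray_parity (y # zs) i j" by simp_all
  then show ?case by (simp add: upward_edge_def)
qed auto

lemma ray_parity_above_False: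
  assumes "\<And>u. u \<in> set p \<Longrightarrow> j < snd u"
  shows "\<not> ray_parity p i j"
  using assms
proof (induction p rule: induct_list012)
  case (3 x y zs)
  then have "j < snd x" "j < snd y" "\<not> ray_parity (y # zs) i j" by simp_all
  then show ?case by (simp add: upward_edge_def)
qed auto

definition column :: "int \<Rightarrow> int \<Rightarrow> nat \<Rightarrow> node list" where
  "column x y n = map (\<lambda>k. (x, y + int k)) [0..<Suc n]"

lemma column_ne [simp]: "column x y n \<noteq> []" and hd_column [simp]: "hd (column x y n) = (x, y)"
  and last_column [simp]: "last (column x y n) = (x, y + int n)"
  by (simp_all add: column_def hd_map last_map del: upt_Suc)

lemma column_Suc: "column x y (Suc n) = column x y n @ [(x, y + int (Suc n))]"
  by (simp add: column_def)

lemma set_column: "set (column x y n) = {x} \<times> {y..y + int n}"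
proof -
  have "v \<in> set (column x y n)" if "v \<in> {x} \<times> {y..y + int n}" for v
  proof -
    have "v = (x, y + int (nat (snd v - y)))" "nat (snd v - y) < Suc n" using that by auto
    then show ?thesis unfolding column_def by (auto simp del: upt_Suc intro!: image_eqI[of _ _ "nat (snd v - y)"])
  qed
  then show ?thesis by (auto simp: column_def)
qed

lemma column_successively: "successively adjacent (column x y n)"
  by (induction n) (auto simp: column_Suc successively_append_iff adjacent_iff, simp add: column_def)

lemma ray_parity_column:
  assumes "i < x" "y \<le> j" "j < y + int n"
  shows "ray_parity (column x y n) i j"
proof -
  have "ray_parity (column x y n) i j \<longleftrightarrow> j < y + int n"
    using assms(1,2)
  proof (induction n)
    case (Suc n)
    then show ?case by (auto simp: column_Suc ray_parity_append upward_edge_def)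
  qed (simp add: column_def)
  with assms show ?thesis by simp
qed

lemma star_adjacent_exit_box:
  assumes "u \<in> centered_box M" "v \<notin> centered_box M" "star_adjacent u v"
  shows "\<bar>fst v\<bar> \<le> M + 1 \<and> \<bar>snd v\<bar> \<le> M + 1 \<and>
    (fst v = M + 1 \<or> fst v = - (M + 1) \<or> snd v = M + 1 \<or> snd v = - (M + 1))"
  using assms unfolding centered_box_def star_adjacent_iff mem_Collect_eq by (smt (verit))

lemma adjacent_exit_box:
  assumes "u \<in> centered_box M" "v \<notin> centered_box M" "adjacent u v"
  shows "(fst v = M + 1 \<or> fst v = - (M + 1)) \<and> \<bar>snd v\<bar> \<le> M \<or>
    (snd v = M + 1 \<or> snd v = - (M + 1)) \<and> \<bar>fst v\<bar> \<le> M"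
  using assms unfolding centered_box_def adjacent_iff mem_Collect_eq by (smt (verit))

text \<open>The path from \<open>a\<close> to \<open>b\<close> is prolonged vertically above \<open>a\<close>, and from \<open>b\<close> one step to the right and then
  upwards. Horizontal rays to the right cross it once when they start at \<open>b'\<close>, but not at all when they start
  far below \<open>c\<close>.\<close>

lemma crossing:
  assumes PQ: "P \<inter> Q = {}" and M: "M \<ge> 0"
    and ab: "conn adjacent (P \<inter> centered_box M) u v" "u \<in> P \<inter> centered_box M" "adjacent u a" "adjacent v b" "a \<in> P - centered_box M" "b \<in> P - centered_box M"
    and bc: "conn star_adjacent (Q \<inter> centered_box M) z w" "z \<in> Q \<inter> centered_box M" "star_adjacent z b'" "star_adjacent w c"
      "b' \<in> Q - centered_box M" "c \<in> Q - centered_box M"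
    and b: "fst b = M + 1" "fst b' = M + 1" "snd b < snd b'" "snd b' \<le> M"
    and a: "snd a \<noteq> - (M + 1)" "fst a = M + 1 \<Longrightarrow> snd b' < snd a"
    and c: "snd c \<noteq> M + 1" "fst c = M + 1 \<Longrightarrow> snd c < snd b"
    and ac: "fst a = - (M + 1) \<Longrightarrow> fst c = - (M + 1) \<Longrightarrow> snd c < snd a"
  shows False
proof -
  \<comment> \<open>The assumptions on rows and columns place the exits counterclockwise in the
    order \<open>b\<close>, \<open>b'\<close>, \<open>a\<close>, \<open>c\<close>, so the two pairs
    interleave on the boundary of the box.\<close>
  have v: "v \<in> P \<inter> centered_box M" using ab conn_in2 by fast
  have w: "w \<in> Q \<inter> centered_box M" using bc conn_in2 by fast
  note xa = adjacent_exit_box[of u M a] and xb = adjacent_exit_box[of v M b] and xc = star_adjacent_exit_box[of w M c]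
  have sb: "- M \<le> snd b" "snd b \<le> M"
    using xb v ab(4,6) b by auto
  have sa: "snd a \<ge> - M" "snd a \<le> M + 1" "\<bar>fst a\<bar> \<le> M + 1"
    using xa ab(2,3,5) a by auto
  have sc: "snd c \<ge> - (M + 1)" "snd c \<le> M" "\<bar>fst c\<bar> \<le> M + 1"
    using xc w bc(4,6) c by auto
  have aout: "fst a = M + 1 \<or> fst a = - (M + 1) \<or> snd a = M + 1"
    using xa ab(2,3,5) a by auto
  have cout: "fst c = M + 1 \<or> fst c = - (M + 1) \<or> snd c = - (M + 1)"
    using xc w bc(4,6) c by auto
  obtain p where p: "p \<noteq> []" "hd p = u" "last p = v" "set p \<subseteq> P \<inter> centered_box M" "successively adjacent p"
    using conn_path[OF ab(1,2)] by blast
  \<comment> \<open>Both vertical pieces end in row M + 2, above all of the set \<open>S\<close>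
    below, as \<open>ray_parity_conn\<close> requires of the ends of \<open>R\<close>.\<close>
  define A where "A = column (fst a) (snd a) (nat (M + 2 - snd a))"
  define B where "B = column (M + 2) (snd b) (nat (M + 2 - snd b))"
  have setA: "set A = {fst a} \<times> {snd a..M + 2}" unfolding A_def set_column using sa by simp
  have setB: "set B = {M + 2} \<times> {snd b..M + 2}" unfolding B_def set_column using sb by simp
  have hA: "A \<noteq> []" "hd A = a" "last A = (fst a, M + 2)" "successively adjacent A"
    unfolding A_def using sa by (auto simp: column_successively)
  have hB: "B \<noteq> []" "hd B = (M + 2, snd b)" "last B = (M + 2, M + 2)" "successively adjacent B"
    unfolding B_def using sb by (auto simp: column_successively)
  define L where "L = (rev A @ p) @ [b]"
  define R where "R = L @ B"
  have L_ne: "L \<noteq> []" "last L = b" by (auto simp: L_def)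
  have "successively adjacent (rev A)"
    unfolding successively_rev by (rule successively_mono[OF hA(4)]) (use symp_adjacent in \<open>auto simp: symp_def\<close>)
  moreover have "adjacent a u" "adjacent b (M + 2, snd b)"
    using ab(3) symp_adjacent b by (auto simp: symp_def adjacent_iff)
  ultimately have R: "successively adjacent R" "R \<noteq> []"
    using p hA hB ab(4) by (simp_all add: R_def L_def successively_append_iff successively_Cons last_rev)
  have hdR: "hd R = (fst a, M + 2)" "last R = (M + 2, M + 2)"
    using hA hB by (auto simp: R_def L_def hd_rev)
  \<comment> \<open>Row -(M + 2) lies below all of \<open>R\<close>, so no ray in it meets
    \<open>R\<close>.\<close>
  define C where "C = {fst c} \<times> {-(M + 2)..snd c}"
  define S where "S = (Q \<inter> centered_box M) \<union> {b', c} \<union> C"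
  have S_snd: "snd x < M + 2" if "x \<in> S" for x
    using that sc b by (auto simp: S_def C_def centered_box_def)
  have disj: "S \<inter> set R = {}"
  proof -
    have setR: "set R = set A \<union> set p \<union> {b} \<union> set B" by (auto simp: R_def L_def)
    have "t \<notin> set R" if "t \<in> Q \<inter> centered_box M" for t
    proof -
      have t: "\<bar>fst t\<bar> \<le> M" "\<bar>snd t\<bar> \<le> M" using that by (auto simp: centered_box_def)
      have "t \<notin> set A" using t aout M unfolding setA mem_Times_iff by (simp; linarith)
      moreover have "t \<notin> set B" using t unfolding setB mem_Times_iff by auto
      moreover have "t \<notin> set p" "t \<noteq> b" using that PQ p(4) ab(6) by blast+
      ultimately show ?thesis unfolding setR by blast
    qed
    then have "Q \<inter> centered_box M \<inter> set R = {}" by blast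
    moreover have "b' \<notin> set R"
    proof -
      have "b' \<notin> set A" using a(2) b unfolding setA mem_Times_iff by auto
      moreover have "b' \<notin> set B" using b unfolding setB mem_Times_iff by simp
      moreover have "b' \<notin> set p" "b' \<noteq> b" using bc(5) PQ p(4) ab(6) by blast+
      ultimately show ?thesis unfolding setR by blast
    qed
    moreover have "c \<in> C" using sc by (cases c) (auto simp: C_def)
    moreover have "C \<inter> set R = {}"
    proof -
      have cout': "\<not> (\<bar>fst c\<bar> \<le> M) \<or> snd c = - (M + 1)" using cout M by linarith
      have "C \<inter> set A = {}"
      proof (rule ccontr)
        assume "C \<inter> set A \<noteq> {}"
        then have "fst a = fst c" "snd a \<le> snd c" by (auto simp: C_def setA)
        with aout cout sa(1) sc(2) a(2) b c(2) ac M show False by (smt (verit))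
      qed
      moreover have "C \<inter> set B = {}" using sc by (auto simp: C_def setB)
      moreover have "b \<notin> C" using b(1) c(2) by (auto simp: C_def)
      moreover have "C \<inter> set p = {}" using p(4) cout' by (force simp: C_def centered_box_def)
      ultimately show ?thesis unfolding setR by blast
    qed
    ultimately show ?thesis unfolding S_def by blast
  qed
  have "conn star_adjacent S b' z"
    using bc(2) sympD[OF symp_star_adjacent bc(3)] by (intro conn_edge) (auto simp: S_def)
  also have "conn star_adjacent S z w"
    using bc(1) by (rule conn_mono) (auto simp: S_def)
  also have "conn star_adjacent S w c"
    using w bc by (intro conn_edge) (auto simp: S_def)
  also have "conn star_adjacent S c (fst c, - (M + 2))"
  proof -
    have "conn star_adjacent S c (fst c, snd c - int k)" if "int k \<le> snd c + M + 2" for k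
      using that
    proof (induction k)
      case (Suc k)
      have "conn star_adjacent S (fst c, snd c - int k) (fst c, snd c - int (Suc k))"
        using Suc.prems sc by (intro conn_edge) (auto simp: S_def C_def star_adjacent_iff)
      with Suc show ?case by (auto intro: conn_trans)
    qed auto
    from this[of "nat (snd c + M + 2)"] show ?thesis using sc by simp
  qed
  finally have "ray_parity R (fst b') (snd b') \<longleftrightarrow> ray_parity R (fst c) (- (M + 2))"
    using ray_parity_conn[OF R _ disj, of b' "(fst c, - (M + 2))"] S_snd hdR by force
  moreover have "\<not> ray_parity R (fst c) (- (M + 2))"
    using setA setB sa sb p(4) by (intro ray_parity_above_False) (auto simp: R_def L_def centered_box_def)
  moreover have "ray_parity R (fst b') (snd b')"
  proof -
    have "\<not> ray_parity L (fst b') (snd b')"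
      using sa p(4) b by (intro ray_parity_right_False) (auto simp: L_def setA centered_box_def)
    moreover have "ray_parity B (fst b') (snd b')"
      unfolding B_def using b sb by (intro ray_parity_column) auto
    moreover have "\<not> upward_edge (last L) (hd B) (fst b') (snd b')"
      using L_ne b by (simp add: upward_edge_def)
    ultimately show ?thesis
      unfolding R_def using ray_parity_append[OF L_ne(1) hB(1)] by simp
  qed
  ultimately show False by simp
qed

text \<open>The complement of the box of radius \<open>2 * N\<close> is divided into three sides as in the game of Y, in which
  exactly one player connects all three sides.\<close>

definition side :: "int \<Rightarrow> node \<Rightarrow> nat" where
  "side N v = (if 0 < fst v \<and> \<bar>snd v\<bar> \<le> N then 1 else if 0 \<le> snd v then 0 else 2)"

lemma side_eq_0D: "side N v = 0 \<Longrightarrow> 0 \<le> snd v \<and> (0 < fst v \<longrightarrow> N < snd v)"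
  by (cases "0 < fst v \<and> \<bar>snd v\<bar> \<le> N"; cases "0 \<le> snd v") (auto simp: side_def)

lemma side_eq_1D: "side N v = 1 \<Longrightarrow> 0 < fst v \<and> \<bar>snd v\<bar> \<le> N"
proof (rule ccontr)
  assume "side N v = 1" "\<not> (0 < fst v \<and> \<bar>snd v\<bar> \<le> N)"
  then have "(if 0 \<le> snd v then 0 else 2) = (1::nat)" unfolding side_def by metis
  then show False by (simp split: if_splits)
qed

lemma side_eq_2D: "side N v = 2 \<Longrightarrow> snd v < 0 \<and> (0 < fst v \<longrightarrow> snd v < - N)"
  by (cases "0 < fst v \<and> \<bar>snd v\<bar> \<le> N"; cases "0 \<le> snd v") (auto simp: side_def)

definition exits :: "(node \<Rightarrow> node \<Rightarrow> bool) \<Rightarrow> node set \<Rightarrow> int \<Rightarrow> nat \<Rightarrow> node \<Rightarrow> bool" where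
  "exits r X N s u \<longleftrightarrow> (\<exists>v w. conn r (X \<inter> centered_box (2 * N)) u v \<and> v \<in> X \<inter> centered_box (2 * N) \<and>
     w \<in> X - centered_box (2 * N) \<and> r v w \<and> side N w = s)"

definition tripod :: "(node \<Rightarrow> node \<Rightarrow> bool) \<Rightarrow> node set \<Rightarrow> int \<Rightarrow> bool" where
  "tripod r X N \<longleftrightarrow> (\<exists>u\<in>X \<inter> centered_box (2 * N). \<forall>s\<in>{0,1,2}. exits r X N s u)"

definition reflect :: "node \<Rightarrow> node" where "reflect v = (fst v, - snd v)"

lemma flip_mem_iff: "reflect v \<in> reflect ` X \<longleftrightarrow> v \<in> X"
  by (auto simp: reflect_def image_iff prod_eq_iff)

lemma flip_box: "reflect ` (X \<inter> centered_box M) = reflect ` X \<inter> centered_box M" 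
  by (auto simp: reflect_def centered_box_def)

lemma flip_adjacent: "adjacent (reflect u) (reflect v) \<longleftrightarrow> adjacent u v" "star_adjacent (reflect u) (reflect v) \<longleftrightarrow> star_adjacent u v"
  by (auto simp: reflect_def adjacent_iff star_adjacent_iff prod_eq_iff)

text \<open>Both tripods leave through the right face, at different heights. If \<open>X\<close>
  leaves lower, its path from side 1 to side 0 and the *path of \<open>Y\<close> from side 1 to side
  2 have interleaved ends, so \<open>crossing\<close> applies. Otherwise the reflected picture does,
  with sides 0 and 2 exchanged.\<close>

lemma tripod_exclusive:
  assumes N: "N \<ge> 1" and XY: "X \<inter> Y = {}" and X: "tripod adjacent X N" and Y: "tripod star_adjacent Y N"
  shows False
proof -
  obtain u where u: "u \<in> X \<inter> centered_box (2 * N)" "\<And>s. s \<in> {0,1,2} \<Longrightarrow> exits adjacent X N s u" using X by (auto simp: tripod_def)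
  obtain z where z: "z \<in> Y \<inter> centered_box (2 * N)" "\<And>s. s \<in> {0,1,2} \<Longrightarrow> exits star_adjacent Y N s z" using Y by (auto simp: tripod_def)
  let ?B = "centered_box (2 * N)"
  have "\<exists>va a. conn adjacent (X \<inter> ?B) u va \<and> va \<in> X \<inter> ?B \<and> a \<in> X - ?B \<and> adjacent va a \<and> side N a = s" if "s \<in> {0,1,2}" for s
    using u(2)[OF that] by (auto simp: exits_def)
  then obtain vx x where x: "\<And>s. s \<in> {0,1,2} \<Longrightarrow> conn adjacent (X \<inter> ?B) u (vx s) \<and> vx s \<in> X \<inter> ?B \<and> x s \<in> X - ?B \<and> adjacent (vx s) (x s) \<and> side N (x s) = s"
    by metis
  have "\<exists>va a. conn star_adjacent (Y \<inter> ?B) z va \<and> va \<in> Y \<inter> ?B \<and> a \<in> Y - ?B \<and> star_adjacent va a \<and> side N a = s" if "s \<in> {0,1,2}" for s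
    using z(2)[OF that] by (auto simp: exits_def)
  then obtain vy y where y: "\<And>s. s \<in> {0,1,2} \<Longrightarrow> conn star_adjacent (Y \<inter> ?B) z (vy s) \<and> vy s \<in> Y \<inter> ?B \<and> y s \<in> Y - ?B \<and> star_adjacent (vy s) (y s) \<and> side N (y s) = s"
    by metis
  have cx: "conn adjacent (X \<inter> ?B) (vx s) (vx t)" if "s \<in> {0,1,2}" "t \<in> {0,1,2}" for s t
    using x[OF that(1)] x[OF that(2)] conn_sym[OF symp_adjacent] conn_trans by meson
  have cy: "conn star_adjacent (Y \<inter> ?B) (vy s) (vy t)" if "s \<in> {0,1,2}" "t \<in> {0,1,2}" for s t
    using y[OF that(1)] y[OF that(2)] conn_sym[OF symp_star_adjacent] conn_trans by meson
  \<comment> \<open>This is what the radius 2 * N is for: the strip of side 1 has half-width only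
    \<open>N\<close>, so it meets the outer boundary of the box in the right face alone.\<close>
  have geo: "fst (f 1) = 2 * N + 1 \<and> \<bar>snd (f 1)\<bar> \<le> N \<and> snd (f 0) \<ge> 0 \<and> snd (f 2) < 0 \<and>
      (fst (f 0) = 2 * N + 1 \<longrightarrow> snd (f 0) > N) \<and> (fst (f 2) = 2 * N + 1 \<longrightarrow> snd (f 2) < - N)"
    if "\<And>s. s \<in> {0,1,2::nat} \<Longrightarrow> g s \<in> ?B \<and> f s \<notin> ?B \<and> star_adjacent (g s) (f s) \<and> side N (f s) = s" for f g
  proof -
    have "side N (f 0) = 0" "side N (f 1) = 1" "side N (f 2) = 2"
      using that[of 0] that[of 1] that[of 2] by auto
    note side_eq_0D[OF this(1)] side_eq_1D[OF this(2)] side_eq_2D[OF this(3)]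
    moreover have "fst (f 1) = 2 * N + 1 \<or> fst (f 1) = - (2 * N + 1) \<or> snd (f 1) = 2 * N + 1 \<or> snd (f 1) = - (2 * N + 1)"
      using star_adjacent_exit_box[of "g 1" "2 * N" "f 1"] that[of 1] by simp
    ultimately show ?thesis using N by (smt (verit))
  qed
  have gx: "fst (x 1) = 2 * N + 1 \<and> \<bar>snd (x 1)\<bar> \<le> N \<and> snd (x 0) \<ge> 0 \<and> snd (x 2) < 0 \<and>
      (fst (x 0) = 2 * N + 1 \<longrightarrow> snd (x 0) > N) \<and> (fst (x 2) = 2 * N + 1 \<longrightarrow> snd (x 2) < - N)"
    using x adjacent_imp_star_adjacent by (intro geo[of vx]) auto
  have gy: "fst (y 1) = 2 * N + 1 \<and> \<bar>snd (y 1)\<bar> \<le> N \<and> snd (y 0) \<ge> 0 \<and> snd (y 2) < 0 \<and>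
      (fst (y 0) = 2 * N + 1 \<longrightarrow> snd (y 0) > N) \<and> (fst (y 2) = 2 * N + 1 \<longrightarrow> snd (y 2) < - N)"
    using y by (intro geo[of vy]) auto
  have "x 1 \<noteq> y 1" using XY x[of 1] y[of 1] by auto
  then consider "snd (x 1) < snd (y 1)" | "snd (y 1) < snd (x 1)"
    using gx gy by (metis linorder_neq_iff prod_eq_iff)
  then show False
  proof cases
    case 1
    show False
      by (rule crossing[OF XY _ cx[of 0 1] conjunct1[OF conjunct2[OF x[of 0]]] _ _ _ _ cy[of 1 2] conjunct1[OF conjunct2[OF y[of 1]]],
            where a = "x 0" and b = "x 1" and b' = "y 1" and c = "y 2"])
         ((use x[of 0] x[of 1] y[of 1] y[of 2] in simp; fail) | (use N gx gy 1 in linarith))+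
  next
    case 2
    have c1: "conn adjacent (reflect ` X \<inter> ?B) (reflect (vx 2)) (reflect (vx 1))"
      unfolding flip_box[symmetric] by (rule conn_image[OF cx]) (simp_all add: flip_adjacent)
    have c2: "conn star_adjacent (reflect ` Y \<inter> ?B) (reflect (vy 1)) (reflect (vy 0))"
      unfolding flip_box[symmetric] by (rule conn_image[OF cy]) (simp_all add: flip_adjacent)
    have d: "reflect ` X \<inter> reflect ` Y = {}" using XY by (auto simp: reflect_def prod_eq_iff)
    have fB: "reflect t \<in> ?B \<longleftrightarrow> t \<in> ?B" for t by (simp add: reflect_def centered_box_def)
    have fs: "fst (reflect t) = fst t" "snd (reflect t) = - snd t" for t by (simp_all add: reflect_def)
    have xm: "vx s \<in> X" "vx s \<in> ?B" "x s \<in> X" "x s \<notin> ?B" "adjacent (vx s) (x s)" if "s \<in> {0,1,2}" for s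
      using x[OF that] by auto
    have ym: "vy s \<in> Y" "vy s \<in> ?B" "y s \<in> Y" "y s \<notin> ?B" "star_adjacent (vy s) (y s)" if "s \<in> {0,1,2}" for s
      using y[OF that] by auto
    show False
    proof (rule crossing[OF d _ c1 _ _ _ _ _ c2,
            where a = "reflect (x 2)" and b = "reflect (x 1)" and b' = "reflect (y 1)" and c = "reflect (y 0)"])
      show "fst (reflect (x 2)) = 2 * N + 1 \<Longrightarrow> snd (reflect (y 1)) < snd (reflect (x 2))"
        unfolding fs using gx gy by linarith
      show "fst (reflect (y 0)) = 2 * N + 1 \<Longrightarrow> snd (reflect (y 0)) < snd (reflect (x 1))"
        unfolding fs using gx gy by linarith
      show "snd (reflect (x 2)) \<noteq> - (2 * N + 1)" "snd (reflect (y 0)) \<noteq> 2 * N + 1" "snd (reflect (y 0)) < snd (reflect (x 2))"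
        "snd (reflect (x 1)) < snd (reflect (y 1))" "snd (reflect (y 1)) \<le> 2 * N" "0 \<le> 2 * N"
        "fst (reflect (x 1)) = 2 * N + 1" "fst (reflect (y 1)) = 2 * N + 1"
        unfolding fs using gx gy 2 N by linarith+
    qed (simp_all add: flip_adjacent flip_mem_iff fB xm ym)
  qed
qed

section \<open>Sperner's lemma for unit squares\<close>

lemma two_labels_parity:
  fixes a b c d :: nat
  assumes "a \<in> {0,1,2}" "b \<in> {0,1,2}" "c \<in> {0,1,2}" "d \<in> {0,1,2}" "\<not> {0,1,2} \<subseteq> {a, b, c, d}"
  shows "((a = 0 \<and> b = 1 \<or> a = 1 \<and> b = 0) \<noteq> (c = 0 \<and> d = 1 \<or> c = 1 \<and> d = 0)) =
    ((a = 0 \<and> c = 1 \<or> a = 1 \<and> c = 0) \<noteq> (b = 0 \<and> d = 1 \<or> b = 1 \<and> d = 0))"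
  \<comment> \<open>If 0 or 1 is absent there is no edge with labels 0 and 1; if 2 is absent, the
    labels change an even number of times around the square.\<close>
  using assms by (elim insertE emptyE; simp)

text \<open>As in Sperner's lemma: if no unit square carried all three labels, the edges with labels 0 and 1 would form
  an even set on the boundary of the box, but there is exactly one of them.\<close>

lemma sperner_square:
  fixes l :: "node \<Rightarrow> nat"
  assumes NM: "0 \<le> N" "N < M" and l: "\<And>v. l v \<in> {0,1,2}"
    and bd: "\<And>v. v \<in> centered_box M \<Longrightarrow> v \<notin> centered_box (M - 1) \<Longrightarrow> l v = side N v"
  obtains x y where "{0,1,2} \<subseteq> l ` {(x,y), (x+1,y), (x,y+1), (x+1,y+1)}"
proof (rule ccontr)
  assume no: "\<not> thesis"
  define ab where "ab u v \<longleftrightarrow> l u = 0 \<and> l v = 1 \<or> l u = 1 \<and> l v = 0" for u v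
  have sq: "(ab (x,y) (x+1,y) \<noteq> ab (x,y+1) (x+1,y+1)) = (ab (x,y) (x,y+1) \<noteq> ab (x+1,y) (x+1,y+1))" for x y
  proof -
    have "\<not> {0,1,2} \<subseteq> l ` {(x,y), (x+1,y), (x,y+1), (x+1,y+1)}" using no that by blast
    then show ?thesis
      unfolding ab_def image_insert image_empty by (rule two_labels_parity[OF l l l l])
  qed
  \<comment> \<open>Parity of the number of edges with labels 0 and 1 among the first n edges of row
    j.\<close>
  define rp where "rp n j = rec_nat False (\<lambda>n b. b \<noteq> ab (- M + int n, j) (- M + int n + 1, j)) n" for n j
  have rp_0: "rp 0 j = False" and rp_Suc: "rp (Suc n) j = (rp n j \<noteq> ab (- M + int n, j) (- M + int n + 1, j))" for n j
    by (simp_all add: rp_def)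
  have step: "(rp n j \<noteq> rp n (j + 1)) = (ab (- M, j) (- M, j + 1) \<noteq> ab (- M + int n, j) (- M + int n, j + 1))" for n j
  proof (induction n)
    case (Suc n)
    have "- M + int (Suc n) = - M + int n + 1" by simp
    then show ?case using Suc sq[of "- M + int n" j] unfolding rp_Suc by smt
  qed (simp add: rp_0)
  define n where "n = nat (2 * M)"
  have n: "- M + int n = M" using NM by (simp add: n_def)
  have L: "l (- M, j) = (if 0 \<le> j then 0 else 2)" if "\<bar>j\<bar> \<le> M" for j
    using bd[of "(- M, j)"] that NM by (auto simp: centered_box_def side_def)
  have R: "l (M, j) = (if N < j then 0 else if j < - N then 2 else 1)" if "\<bar>j\<bar> \<le> M" for j
    using bd[of "(M, j)"] that NM by (auto simp: centered_box_def side_def)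
  \<comment> \<open>The left column only changes from 2 to 0, which does not count. The right column
    changes between 1 and 0 exactly once, from row N to row N + 1. So the parity becomes odd there,
    but in the constantly labelled top row it is even.\<close>
  have next_row: "rp n (j + 1) = (rp n j \<noteq> (j = N))" if "- M \<le> j" "j < M" for j
    using step[of n j] L[of j] L[of "j+1"] R[of j] R[of "j+1"] that NM unfolding n ab_def by (auto split: if_splits)
  have flat: "\<not> rp k j" if "j = M \<or> j = - M" "k \<le> n" for j k
    using that(2)
  proof (induction k)
    case (Suc k)
    then have "\<bar>- M + int k\<bar> \<le> M" "\<bar>- M + int k + 1\<bar> \<le> M" using n by auto
    then have "l (- M + int k, j) = (if j = M then 0 else 2)" "l (- M + int k + 1, j) = (if j = M then 0 else 2)"
      using bd[of "(- M + int k, j)"] bd[of "(- M + int k + 1, j)"] that(1) NM by (auto simp: centered_box_def side_def)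
    then have "\<not> ab (- M + int k, j) (- M + int k + 1, j)" by (simp add: ab_def)
    with Suc show ?case by (simp add: rp_Suc)
  qed (simp add: rp_0)
  have "rp n (- M + int k) = (N < - M + int k)" if "k \<le> n" for k
    using that
  proof (induction k)
    case 0
    then show ?case using flat[of "- M" n] NM by simp
  next
    case (Suc k)
    have "- M + int (Suc k) = - M + int k + 1" by simp
    moreover have "rp n (- M + int k + 1) = (rp n (- M + int k) \<noteq> (- M + int k = N))"
      using Suc n by (intro next_row) auto
    moreover have "rp n (- M + int k) = (N < - M + int k)" using Suc by simp
    ultimately show ?case by (simp only:) linarith
  qed
  from this[of n] show False using flat[of M n] NM n by simp
qed

section \<open>Mod 2 potentials and connectedness of inner boundaries\<close>

lemma int_potential:
  fixes g :: "int \<Rightarrow> bool"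
  obtains h where "\<And>x. h (x + 1) = (h x \<noteq> g x)"
proof -
  \<comment> \<open>Summation of \<open>g\<close> from 0 to x mod 2; the second set serves negative
    x, and at most one of the two is nonempty.\<close>
  define h where "h x = odd (card {t\<in>{0..<x}. g t} + card {t\<in>{x..<0}. g t})" for x
  have "h (x + 1) = (h x \<noteq> g x)" for x
  proof (cases "0 \<le> x")
    case True
    then have "{t\<in>{0..<x+1}. g t} = (if g x then insert x {t\<in>{0..<x}. g t} else {t\<in>{0..<x}. g t})"
      by (auto simp: le_less)
    moreover have "finite {t\<in>{0..<x}. g t}" by (rule finite_subset[of _ "{0..<x}"]) auto
    ultimately show ?thesis using True by (auto simp: h_def)
  next
    case False
    then have "{t\<in>{x..<0}. g t} = (if g x then insert x {t\<in>{x+1..<0}. g t} else {t\<in>{x+1..<0}. g t})"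
      by (auto simp: le_less)
    moreover have "finite {t\<in>{x+1..<0}. g t}" by (rule finite_subset[of _ "{x+1..<0}"]) auto
    ultimately show ?thesis using False by (auto simp: h_def)
  qed
  then show thesis using that by blast
qed

text \<open>Discrete Poincare lemma mod 2: integrate along row 0 and then along the columns. The
  condition on squares carries the horizontal increments from row 0 to all rows, upwards and
  downwards.\<close>

lemma grid_potential:
  fixes gh gv :: "int \<Rightarrow> int \<Rightarrow> bool"
  assumes sq: "\<And>x y. (gh x y \<noteq> gh x (y + 1)) = (gv x y \<noteq> gv (x + 1) y)"
  obtains h where "\<And>x y. h (x + 1, y) = (h (x, y) \<noteq> gh x y)" "\<And>x y. h (x, y + 1) = (h (x, y) \<noteq> gv x y)"
proof -
  have "\<exists>k. \<forall>x. k (x + 1) = (k x \<noteq> gh x 0)" by (rule int_potential[of "\<lambda>x. gh x 0"]) blast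
  then obtain k where k: "\<And>x. k (x + 1) = (k x \<noteq> gh x 0)" by blast
  have "\<forall>x. \<exists>c. \<forall>y. c (y + 1) = (c y \<noteq> gv x y)"
  proof
    fix x
    show "\<exists>c. \<forall>y. c (y + 1) = (c y \<noteq> gv x y)" by (rule int_potential[of "gv x"]) blast
  qed
  then obtain c where c: "\<And>x y. c x (y + 1) = (c x y \<noteq> gv x y)" by metis
  define h where "h v = ((c (fst v) (snd v) \<noteq> c (fst v) 0) \<noteq> k (fst v))" for v
  have v: "h (x, y + 1) = (h (x, y) \<noteq> gv x y)" for x y
    using c[of x y] unfolding h_def fst_conv snd_conv by (smt (verit))
  have "h (x + 1, y) = (h (x, y) \<noteq> gh x y)" for x y
  proof (induction y rule: int_induct[where k = 0])
    case base
    then show ?case using k by (simp add: h_def)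
  next
    case (step1 y)
    then show ?case using v[of x y] v[of "x+1" y] sq[of x y] by (smt (verit))
  next
    case (step2 y)
    have y: "y - 1 + 1 = y" by simp
    show ?case using step2 v[of x "y-1"] v[of "x+1" "y-1"] sq[of x "y-1"] unfolding y by (smt (verit))
  qed
  with v that show thesis by blast
qed

lemma star_adjacent_cases:
  assumes "star_adjacent u v"
  obtains "adjacent u v" | b where "adjacent u b" "adjacent b v"
proof (cases "adjacent u v")
  case False
  then have "adjacent u (fst u, snd v)" "adjacent (fst u, snd v) v"
    using assms unfolding adjacent_iff star_adjacent_iff prod_eq_iff fst_conv snd_conv by (smt (verit))+
  then show thesis using that by blast
qed (use that in blast)

lemma adjacent_cases:
  assumes "adjacent u v"
  obtains x y where "u = (x, y)" "v = (x + 1, y)" | x y where "u = (x + 1, y)" "v = (x, y)"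
    | x y where "u = (x, y)" "v = (x, y + 1)" | x y where "u = (x, y + 1)" "v = (x, y)"
proof -
  obtain a b c d where *: "u = (a, b)" "v = (c, d)" by (metis surj_pair)
  then have "\<bar>a - c\<bar> + \<bar>b - d\<bar> = 1" using assms by (simp add: adjacent_iff)
  then consider "c = a + 1" "d = b" | "a = c + 1" "d = b" | "c = a" "d = b + 1" | "c = a" "b = d + 1" by (smt (verit))
  then show thesis using * that by cases auto
qed

text \<open>Unless all four corners belong to the set, those that do form arcs of the square. Each
  arc has exactly two boundary edges, and both carry the common class of the arc.\<close>

lemma square_parity:
  assumes "\<not> (a \<and> b \<and> c \<and> d)" "a \<Longrightarrow> b \<Longrightarrow> a' = b'" "a \<Longrightarrow> c \<Longrightarrow> a' = c'" "b \<Longrightarrow> d \<Longrightarrow> b' = d'" "c \<Longrightarrow> d \<Longrightarrow> c' = d'"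
  shows "((a \<and> \<not> b \<and> a' \<or> b \<and> \<not> a \<and> b') \<noteq> (c \<and> \<not> d \<and> c' \<or> d \<and> \<not> c \<and> d')) =
    ((a \<and> \<not> c \<and> a' \<or> c \<and> \<not> a \<and> c') \<noteq> (b \<and> \<not> d \<and> b' \<or> d \<and> \<not> b \<and> d'))"
  using assms by (cases a; cases b; cases c; cases d; simp; blast?)

text \<open>The diagonal neighbours matter for connectedness: if \<open>D\<close> omits a single
  node, the four nodes adjacent to it are not connected among themselves, while the ring of eight
  is.\<close>

definition inner_boundary :: "node set \<Rightarrow> node set" where
  "inner_boundary D = {u\<in>D. \<exists>w. w \<notin> D \<and> star_adjacent u w}"

text \<open>The mod 2 edge boundary belonging to one component of the inner boundary meets every unit square
  in an even number of edges, so it is the coboundary of a two-colouring, and this colouring is constant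
  on \<open>D\<close> and on its complement.\<close>

lemma conn_inner_boundary:
  assumes D: "\<And>u v. u \<in> D \<Longrightarrow> v \<in> D \<Longrightarrow> conn adjacent D u v"
    and U: "\<And>u v. u \<notin> D \<Longrightarrow> v \<notin> D \<Longrightarrow> conn star_adjacent (- D) u v"
    and x: "x1 \<in> inner_boundary D" "x2 \<in> inner_boundary D"
  shows "conn adjacent (inner_boundary D) x1 x2"
proof -
  define X where "X = inner_boundary D"
  have XI: "u \<in> X" if "u \<in> D" "w \<notin> D" "star_adjacent u w" for u w
    using that unfolding X_def inner_boundary_def by blast
  have XD: "u \<in> D" if "u \<in> X" for u using that by (simp add: X_def inner_boundary_def)
  define cls where "cls u \<longleftrightarrow> conn adjacent X x1 u" for u
  have cls: "cls u = cls v" if "u \<in> X" "v \<in> X" "adjacent u v" for u v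
    using that conn_edge[of u X v adjacent] conn_sym[OF symp_adjacent, of X] unfolding cls_def by (meson conn_trans)
  define bd where "bd u v \<longleftrightarrow> u \<in> D \<and> v \<notin> D \<and> cls u \<or> v \<in> D \<and> u \<notin> D \<and> cls v" for u v
  have sq: "(bd (x,y) (x+1,y) \<noteq> bd (x,y+1) (x+1,y+1)) = (bd (x,y) (x,y+1) \<noteq> bd (x+1,y) (x+1,y+1))" for x y
  proof -
    let ?S = "{(x,y), (x+1,y), (x,y+1), (x+1,y+1)}"
    show ?thesis
    proof (cases "?S \<subseteq> D")
      case True
      then show ?thesis by (auto simp: bd_def)
    next
      case False
      have star: "star_adjacent u v" if "u \<in> ?S" "v \<in> ?S" "u \<noteq> v" for u v
        using that by (auto simp: star_adjacent_iff)
      have "u \<in> X" if "u \<in> ?S" "u \<in> D" for u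
      proof -
        obtain w where w: "w \<in> ?S" "w \<notin> D" using False by blast
        with that(2) have "u \<noteq> w" by blast
        then show ?thesis by (rule XI[OF that(2) w(2) star[OF that(1) w(1)]])
      qed
      then have e: "cls u = cls v" if "u \<in> ?S" "u \<in> D" "v \<in> ?S" "v \<in> D" "adjacent u v" for u v
        using cls that by blast
      have "(x,y) \<in> D \<Longrightarrow> (x+1,y) \<in> D \<Longrightarrow> cls (x,y) = cls (x+1,y)"
        "(x,y) \<in> D \<Longrightarrow> (x,y+1) \<in> D \<Longrightarrow> cls (x,y) = cls (x,y+1)"
        "(x+1,y) \<in> D \<Longrightarrow> (x+1,y+1) \<in> D \<Longrightarrow> cls (x+1,y) = cls (x+1,y+1)"
        "(x,y+1) \<in> D \<Longrightarrow> (x+1,y+1) \<in> D \<Longrightarrow> cls (x,y+1) = cls (x+1,y+1)"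
        by (rule e; (simp add: adjacent_iff; fail)?; assumption?)+
      moreover have "\<not> ((x,y) \<in> D \<and> (x+1,y) \<in> D \<and> (x,y+1) \<in> D \<and> (x+1,y+1) \<in> D)" using False by simp
      ultimately show ?thesis
        unfolding bd_def by (intro square_parity) blast+
    qed
  qed
  have "\<exists>h. (\<forall>x y. h (x + 1, y) = (h (x, y) \<noteq> bd (x,y) (x+1,y))) \<and> (\<forall>x y. h (x, y + 1) = (h (x, y) \<noteq> bd (x,y) (x,y+1)))"
    by (rule grid_potential[of "\<lambda>x y. bd (x,y) (x+1,y)" "\<lambda>x y. bd (x,y) (x,y+1)"]) (rule sq, blast)
  then obtain h where h: "\<And>x y. h (x + 1, y) = (h (x, y) \<noteq> bd (x,y) (x+1,y))" "\<And>x y. h (x, y + 1) = (h (x, y) \<noteq> bd (x,y) (x,y+1))"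
    by blast
  have bd_sym: "bd u v = bd v u" for u v by (auto simp: bd_def)
  have hbd: "(h u \<noteq> h v) = bd u v" if "adjacent u v" for u v
    using that
  proof (cases rule: adjacent_cases)
    case (1 x y)
    then show ?thesis using h(1)[of x y] by auto
  next
    case (2 x y)
    then show ?thesis using h(1)[of x y] bd_sym[of u v] by auto
  next
    case (3 x y)
    then show ?thesis using h(2)[of x y] by auto
  next
    case (4 x y)
    then show ?thesis using h(2)[of x y] bd_sym[of u v] by auto
  qed
  have hD: "h u = h v" if "u \<in> D" "v \<in> D" for u v
    using D[OF that]
  proof (induction rule: conn_induct)
    case (step a b)
    then show ?case using hbd[of a b] by (auto simp: bd_def)
  qed auto
  have hU: "h u = h v" if "u \<notin> D" "v \<notin> D" for u v
    using U[OF that]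
  proof (induction rule: conn_induct)
    case (step a b)
    from step(4) have "h a = h b"
    proof (cases rule: star_adjacent_cases)
      case 1
      then show ?thesis using hbd[of a b] step by (auto simp: bd_def)
    next
      \<comment> \<open>If \<open>c\<close> lies in \<open>D\<close>, both edges at \<open>c\<close>
        carry the class of \<open>c\<close>, so the two changes of colour cancel.\<close>
      case (2 c)
      then show ?thesis using hbd[of a c] hbd[of c b] step by (auto simp: bd_def)
    qed
    with step show ?case by simp
  qed auto
  \<comment> \<open>The colouring only sees edges of the grid, so a node touching the outside
    diagonally is first moved, within \<open>X\<close>, to one with an adjacent node
    outside.\<close>
  have near: "\<exists>x' w. conn adjacent X z x' \<and> x' \<in> D \<and> w \<notin> D \<and> adjacent x' w" if z: "z \<in> X" for z
  proof -
    obtain w where w: "z \<in> D" "w \<notin> D" "star_adjacent z w" using z by (auto simp: X_def inner_boundary_def)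
    from w(3) show ?thesis
    proof (cases rule: star_adjacent_cases)
      case 1
      then show ?thesis using w by blast
    next
      case (2 b)
      show ?thesis
      proof (cases "b \<in> D")
        case True
        then have "b \<in> X" using 2 w XI adjacent_imp_star_adjacent by blast
        then show ?thesis using 2 True w z conn_edge[of z X b adjacent] by blast
      qed (use 2 w in blast)
    qed
  qed
  obtain a v where a: "conn adjacent X x1 a" "a \<in> D" "v \<notin> D" "adjacent a v" using near x X_def by metis
  obtain b w where b: "conn adjacent X x2 b" "b \<in> D" "w \<notin> D" "adjacent b w" using near x X_def by metis
  \<comment> \<open>One edge of the class of \<open>x1\<close> separates the colour of
    \<open>D\<close> from that of its complement; hence every edge between the two is counted, and
    every class is that of \<open>x1\<close>.\<close>
  have "bd a v" using a by (auto simp: bd_def cls_def)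
  then have "bd b w" using hbd[OF a(4)] hbd[OF b(4)] hD[OF a(2) b(2)] hU[OF a(3) b(3)] by simp
  then have "conn adjacent X x1 b" using b by (auto simp: bd_def cls_def)
  then show ?thesis using b(1) conn_sym[OF symp_adjacent] conn_trans unfolding X_def by metis
qed

section \<open>Rows, columns and complements of boxes\<close>

lemma conn_row:
  assumes "\<And>t. t \<in> {min a b..max a b} \<Longrightarrow> (t, y) \<in> S"
  shows "conn adjacent S (a, y) (b, y)"
proof -
  have *: "conn adjacent S (a, y) (b, y)" if "a \<le> b" "\<And>t. a \<le> t \<Longrightarrow> t \<le> b \<Longrightarrow> (t, y) \<in> S" for a b
    using that
  proof (induction b rule: int_ge_induct)
    case (step i)
    then have "conn adjacent S (a, y) (i, y)" by simp
    also have "conn adjacent S (i, y) (i + 1, y)" using step by (intro conn_edge) (auto simp: adjacent_iff)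
    finally show ?case .
  qed simp
  show ?thesis
    using *[of a b] *[of b a] assms conn_sym[OF symp_adjacent, of S "(b, y)" "(a, y)"] by (cases "a \<le> b") auto
qed

lemma conn_col:
  assumes "\<And>t. t \<in> {min a b..max a b} \<Longrightarrow> (x, t) \<in> S"
  shows "conn adjacent S (x, a) (x, b)"
proof -
  have "conn adjacent (prod.swap ` S) (a, x) (b, x)" 
    using assms by (intro conn_row) force
  then have "conn adjacent (prod.swap ` prod.swap ` S) (prod.swap (a, x)) (prod.swap (b, x))"
    by (rule conn_image) (simp add: adjacent_iff)
  then show ?thesis by (simp add: image_image)
qed

lemma conn_UNIV: "conn adjacent UNIV u v"
  using conn_trans[OF conn_row[of "fst u" "fst v" "snd u" UNIV] conn_col[of "snd u" "snd v" "fst v" UNIV]] by simp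

lemma conn_outside_box:
  assumes "u \<notin> centered_box n" "v \<notin> centered_box n"
  shows "conn adjacent (- centered_box n) u v"
proof -
  let ?c = "(\<bar>n\<bar> + 1, \<bar>n\<bar> + 1)"
  have "conn adjacent (- centered_box n) u ?c" if "u \<notin> centered_box n" for u
  proof -
    obtain x y where u: "u = (x, y)" by fastforce
    have "\<not> (\<bar>x\<bar> \<le> n \<and> \<bar>y\<bar> \<le> n)" using that u by (simp add: centered_box_def)
    then consider "\<bar>y\<bar> > n" | "\<bar>x\<bar> > n" by linarith
    then show ?thesis
    proof cases
      case 1
      have "conn adjacent (- centered_box n) (x, y) (\<bar>n\<bar> + 1, y)" using 1 by (intro conn_row) (auto simp: centered_box_def)
      also have "conn adjacent (- centered_box n) (\<bar>n\<bar> + 1, y) ?c" by (intro conn_col) (auto simp: centered_box_def)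
      finally show ?thesis using u by simp
    next
      case 2
      have "conn adjacent (- centered_box n) (x, y) (x, \<bar>n\<bar> + 1)" using 2 by (intro conn_col) (auto simp: centered_box_def)
      also have "conn adjacent (- centered_box n) (x, \<bar>n\<bar> + 1) ?c" by (intro conn_row) (auto simp: centered_box_def)
      finally show ?thesis using u by simp
    qed
  qed
  from this[OF assms(1)] this[OF assms(2)] show ?thesis using conn_sym[OF symp_adjacent] conn_trans by metis
qed

lemma finite_subset_box:
  assumes "finite S" obtains n where "n \<ge> 0" "S \<subseteq> centered_box n"
proof -
  from assms have "\<exists>n\<ge>0. S \<subseteq> centered_box n"
  proof induction
    case (insert v S)
    then obtain n where n: "n \<ge> 0" "S \<subseteq> centered_box n" by blast
    then have "insert v S \<subseteq> centered_box (n + \<bar>fst v\<bar> + \<bar>snd v\<bar>)"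
      using box_mono[of n "n + \<bar>fst v\<bar> + \<bar>snd v\<bar>"] by (auto simp: centered_box_def)
    with n show ?case by (intro exI[of _ "n + \<bar>fst v\<bar> + \<bar>snd v\<bar>"]) auto
  qed (auto intro: exI[of _ 0])
  with that show thesis by blast
qed

text \<open>A form with countable quantifiers only, for the measurability of infinite
  clusters.\<close>

lemma infinite_iff_box: "infinite S \<longleftrightarrow> (\<forall>n::nat. \<exists>v\<in>S. v \<notin> centered_box (int n))"
proof
  assume "infinite S"
  then show "\<forall>n::nat. \<exists>v\<in>S. v \<notin> centered_box (int n)" by (meson finite_box finite_subset subsetI)
next
  assume *: "\<forall>n::nat. \<exists>v\<in>S. v \<notin> centered_box (int n)"
  show "infinite S"
  proof
    assume "finite S"
    then obtain n where "n \<ge> 0" "S \<subseteq> centered_box n" using finite_subset_box by blast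
    then show False using *[rule_format, of "nat n"] by auto
  qed
qed

text \<open>The outside of a box is connected and meets both \<open>D\<close> and its complement, so
  some edge between them lies out there.\<close>

lemma infinite_inner_boundary:
  assumes "infinite D" "infinite (- D)"
  shows "infinite (inner_boundary D)"
proof
  assume "finite (inner_boundary D)"
  then obtain n where n: "inner_boundary D \<subseteq> centered_box n" using finite_subset_box by blast
  have "\<exists>u\<in>D. u \<notin> centered_box n" "\<exists>v\<in>- D. v \<notin> centered_box n" using assms by (meson finite_box finite_subset subsetI)+
  then obtain u v where uv: "u \<in> D" "u \<notin> centered_box n" "v \<notin> D" "v \<notin> centered_box n" by auto
  obtain x y where "x \<in> - centered_box n \<inter> D" "y \<in> - centered_box n - D" "adjacent x y"
    using conn_exit[OF conn_outside_box[OF uv(2,4)] uv(1,3)] by blast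
  then have "x \<in> inner_boundary D" "x \<notin> centered_box n"
    unfolding inner_boundary_def using adjacent_imp_star_adjacent by blast+
  with n show False by blast
qed

section \<open>Tripods under translation invariance and positive association\<close>

lemma measurable_rtranclp [measurable]:
  fixes R :: "'a \<Rightarrow> 'b::countable \<Rightarrow> 'b \<Rightarrow> bool"
  assumes [measurable]: "\<And>u v. Measurable.pred M (\<lambda>\<omega>. R \<omega> u v)"
  shows "Measurable.pred M (\<lambda>\<omega>. (R \<omega>)\<^sup>*\<^sup>* u v)"
proof -
  have [measurable]: "Measurable.pred M (\<lambda>\<omega>. (R \<omega> ^^ n) u v)" for n v
    by (induction n arbitrary: v) (auto simp: relcompp.simps)
  show ?thesis unfolding rtranclp_power by measurable
qed

lemma space_config_space [simp]: "space config_space = UNIV"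
  by (auto simp: config_space_def space_PiM PiE_def extensional_def)

lemma measurable_config_eval [measurable]: "Measurable.pred config_space (\<lambda>\<omega>. \<omega> v)"
proof -
  have "(\<lambda>\<omega>. \<omega> v) \<in> measurable config_space (count_space UNIV)"
    unfolding config_space_def by (rule measurable_component_singleton) simp
  then show ?thesis by simp
qed

lemma measurable_into_config_space:
  assumes [measurable]: "\<And>v. Measurable.pred M (\<lambda>x. f x v)"
  shows "f \<in> measurable M config_space"
  unfolding config_space_def by (rule measurable_PiM_single') (auto simp: PiE_def extensional_def)

lemma measurable_conn [measurable (raw)]:
  fixes u v :: "'b::countable"
  assumes [measurable]: "\<And>v. Measurable.pred M (\<lambda>\<omega>. v \<in> S \<omega>)"
  shows "Measurable.pred M (\<lambda>\<omega>. conn r (S \<omega>) u v)"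
  unfolding conn_def by measurable

definition in_infinite :: "('a \<Rightarrow> 'a \<Rightarrow> bool) \<Rightarrow> 'a set \<Rightarrow> 'a \<Rightarrow> bool" where
  "in_infinite r X u \<longleftrightarrow> u \<in> X \<and> infinite {w. conn r X u w}"

lemma measurable_in_infinite [measurable (raw)]:
  assumes [measurable]: "\<And>v::node. Measurable.pred M (\<lambda>\<omega>. v \<in> S \<omega>)"
  shows "Measurable.pred M (\<lambda>\<omega>. in_infinite r (S \<omega>) u)"
  unfolding in_infinite_def infinite_iff_box by simp

definition ball_at :: "node \<Rightarrow> int \<Rightarrow> node set" where
  "ball_at x n = {v. v - x \<in> centered_box n}"

definition hits_infinite :: "(node \<Rightarrow> node \<Rightarrow> bool) \<Rightarrow> node \<Rightarrow> int \<Rightarrow> node set \<Rightarrow> bool" where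
  "hits_infinite r x k X \<longleftrightarrow> (\<exists>u\<in>ball_at x k. in_infinite r X u)"

text \<open>Leaving the ball stands in for lying in an infinite cluster: an arm is only known to
  reach the boundary of the box and need not belong to the infinite cluster.\<close>

definition escapes :: "(node \<Rightarrow> node \<Rightarrow> bool) \<Rightarrow> node \<Rightarrow> int \<Rightarrow> node set \<Rightarrow> node \<Rightarrow> bool" where
  "escapes r x K X u \<longleftrightarrow> u \<in> X \<and> (\<exists>w. w \<notin> ball_at x K \<and> conn r X u w)"

text \<open>Uniqueness of the infinite cluster in finite volume; at the origin and for given
  \<open>n\<close> it holds for large \<open>K\<close> by \<open>eventually_glued\<close>.\<close>

definition glued :: "(node \<Rightarrow> node \<Rightarrow> bool) \<Rightarrow> node \<Rightarrow> int \<Rightarrow> int \<Rightarrow> node set \<Rightarrow> bool" where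
  "glued r x n K X \<longleftrightarrow> (\<forall>u\<in>ball_at x n. \<forall>v\<in>ball_at x n.
     escapes r x K X u \<and> escapes r x K X v \<longrightarrow> conn r (X \<inter> ball_at x K) u v)"

definition arm :: "(node \<Rightarrow> node \<Rightarrow> bool) \<Rightarrow> node \<Rightarrow> int \<Rightarrow> int \<Rightarrow> nat \<Rightarrow> node set \<Rightarrow> bool" where
  "arm r x k N s X \<longleftrightarrow> (\<exists>u\<in>ball_at x k \<inter> X \<inter> centered_box (2 * N). exits r X N s u)"

context
  fixes M :: "'a measure" and S :: "'a \<Rightarrow> node set"
  assumes S [measurable]: "\<And>v. Measurable.pred M (\<lambda>\<omega>. v \<in> S \<omega>)"
begin

lemma measurable_hits_infinite [measurable]: "Measurable.pred M (\<lambda>\<omega>. hits_infinite r x k (S \<omega>))"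
  unfolding hits_infinite_def by measurable

lemma measurable_escapes [measurable]: "Measurable.pred M (\<lambda>\<omega>. escapes r x K (S \<omega>) u)"
  unfolding escapes_def by measurable

lemma measurable_glued [measurable]: "Measurable.pred M (\<lambda>\<omega>. glued r x n K (S \<omega>))"
  unfolding glued_def by measurable

lemma measurable_exits [measurable]: "Measurable.pred M (\<lambda>\<omega>. exits r (S \<omega>) N s u)"
  unfolding exits_def Int_iff Diff_iff by measurable

lemma measurable_arm [measurable]: "Measurable.pred M (\<lambda>\<omega>. arm r x k N s (S \<omega>))"
  unfolding arm_def Bex_def Int_iff by measurable

lemma measurable_tripod [measurable]: "Measurable.pred M (\<lambda>\<omega>. tripod r (S \<omega>) N)"
  unfolding tripod_def Bex_def Int_iff by measurable

end

definition shift :: "node \<Rightarrow> config \<Rightarrow> config" where "shift z \<omega> = (\<lambda>v. \<omega> (v + z))"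

lemma measurable_shift [measurable]: "shift z \<in> measurable config_space config_space"
  unfolding shift_def by (rule measurable_into_config_space) measurable

lemma Collect_shift: "Collect (shift z \<omega>) = (\<lambda>v. v - z) ` Collect \<omega>"
  by (force simp: shift_def image_iff)

lemma adjacent_shift: "adjacent (u + z) (v + z) = adjacent u v" "adjacent (u - z) (v - z) = adjacent u v"
  and star_adjacent_shift: "star_adjacent (u + z) (v + z) = star_adjacent u v" "star_adjacent (u - z) (v - z) = star_adjacent u v"
  by (auto simp: adjacent_iff star_adjacent_iff)

text \<open>The three sides meet only near the centre of the box.\<close>

lemma tri_geometry:
  assumes "0 \<le> R" "R + N + K \<le> 2 * N" "x \<notin> centered_box (2 * N - K)" "v0 \<in> ball_at x R" "v1 \<in> ball_at x R" "v2 \<in> ball_at x R"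
    and "side N v0 = 0" "side N v1 = 1" "side N v2 = 2" "2 * R < 2 * N" "R + K < 2 * N"
  shows False
proof -
  have b: "\<bar>fst v0 - fst x\<bar> \<le> R" "\<bar>snd v0 - snd x\<bar> \<le> R" "\<bar>fst v1 - fst x\<bar> \<le> R" "\<bar>snd v1 - snd x\<bar> \<le> R"
    "\<bar>fst v2 - fst x\<bar> \<le> R" "\<bar>snd v2 - snd x\<bar> \<le> R"
    using assms(4-6) by (simp_all add: ball_at_def centered_box_def)
  have x: "\<bar>fst x\<bar> > 2 * N - K \<or> \<bar>snd x\<bar> > 2 * N - K" using assms(3) by (simp add: centered_box_def) linarith
  note s = side_eq_0D[OF assms(7)] side_eq_1D[OF assms(8)] side_eq_2D[OF assms(9)]
  \<comment> \<open>The nearby node of side 1 puts \<open>x\<close> close to the strip, hence far to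
    the right, where sides 0 and 2 are more than 2 * N apart.\<close>
  have "\<bar>snd x\<bar> \<le> N + R" using b(4) s(2) by linarith
  then have "\<bar>fst x\<bar> > 2 * N - K" using x assms(2) by linarith
  moreover have "fst x > - R" using b(3) s(2) by linarith
  ultimately have "fst x > 2 * N - K" using assms(11) by linarith
  then have "0 < fst v0" "0 < fst v2" using b(1,5) assms(11) by linarith+
  then have "N < snd v0" "snd v2 < - N" using s by auto
  then show False using b(2,6) assms(10) by linarith
qed

section \<open>Arms and how they are joined\<close>

lemma exits_trans:
  assumes "exits r X N s v" "conn r (X \<inter> centered_box (2 * N)) u v"
  shows "exits r X N s u"
  using assms(1) conn_trans[OF assms(2)] unfolding exits_def by blast

lemma exits_of_conn:
  assumes "conn r X u w" "u \<in> X \<inter> centered_box (2 * N)" "w \<notin> centered_box (2 * N)"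
  shows "\<exists>s\<in>{0,1,2}. exits r X N s u"
proof -
  obtain v y where "conn r (X \<inter> centered_box (2 * N)) u v" "v \<in> X \<inter> centered_box (2 * N)" "y \<in> X - centered_box (2 * N)" "r v y"
    using conn_exit[OF assms(1)] assms(2,3) by (metis IntD2)
  then have "exits r X N (side N y) u" unfolding exits_def by blast
  moreover have "side N y \<in> {0,1,2}" by (simp add: side_def)
  ultimately show ?thesis by blast
qed

lemma ball_at_mono: "m \<le> n \<Longrightarrow> ball_at x m \<subseteq> ball_at x n"
  by (auto simp: ball_at_def centered_box_def)

lemma ball_at_subset: "y - x \<in> centered_box t \<Longrightarrow> k + t \<le> n \<Longrightarrow> ball_at y k \<subseteq> ball_at x n"
  by (auto simp: ball_at_def centered_box_def)

lemma ball_at_subset_box: "x \<in> centered_box n \<Longrightarrow> n + k \<le> m \<Longrightarrow> ball_at x k \<subseteq> centered_box m"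
  by (auto simp: ball_at_def centered_box_def)

lemma infinite_escapes:
  assumes "in_infinite r X u"
  shows "escapes r x K X u"
proof -
  have "finite (ball_at x K)"
  proof -
    have "ball_at x K \<subseteq> (\<lambda>v. v + x) ` centered_box K" by (force simp: ball_at_def)
    then show ?thesis using finite_box finite_surj by blast
  qed
  then have "\<exists>w. conn r X u w \<and> w \<notin> ball_at x K"
    using assms finite_subset[of "{w. conn r X u w}"] unfolding in_infinite_def by blast
  then show ?thesis using assms by (auto simp: escapes_def in_infinite_def)
qed

lemma exits_mono: "exits r X N s u \<Longrightarrow> X \<subseteq> Y \<Longrightarrow> exits r Y N s u"
  unfolding exits_def by (blast intro: conn_mono)

lemma arm_mono: "arm r x k N s X \<Longrightarrow> X \<subseteq> Y \<Longrightarrow> arm r x k N s Y"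
  unfolding arm_def by (blast intro: exits_mono)

lemma arm_of_hits_infinite:
  assumes "hits_infinite r x k X" "ball_at x k \<subseteq> centered_box (2 * N)"
  shows "\<exists>s\<in>{0,1,2}. arm r x k N s X"
proof -
  obtain u where u: "u \<in> ball_at x k" "in_infinite r X u" using assms(1) by (auto simp: hits_infinite_def)
  have b0: "ball_at 0 (2 * N) = centered_box (2 * N)" by (simp add: ball_at_def)
  obtain w where "w \<notin> centered_box (2 * N)" "conn r X u w" "u \<in> X"
    using infinite_escapes[OF u(2), of 0 "2 * N"] unfolding escapes_def b0 by blast
  then obtain s where "s \<in> {0,1,2}" "exits r X N s u" using exits_of_conn[of r X u w N] u assms(2) by blast
  then show ?thesis using u assms(2) \<open>u \<in> X\<close> unfolding arm_def by blast
qed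

text \<open>Gluing joins a node inside the box to one outside it without leaving
  \<open>ball_at x L\<close>. The first exit from the box therefore happens in that ball, which
  restricts the possible sides.\<close>

lemma arm_near_boundary:
  assumes "hits_infinite r x k X" "hits_infinite r y k X" "glued r x m L X"
    and "ball_at x k \<subseteq> centered_box (2 * N)" "ball_at y k \<inter> centered_box (2 * N) = {}" "ball_at x k \<subseteq> ball_at x m" "ball_at y k \<subseteq> ball_at x m"
  shows "\<exists>s\<in>side N ` ball_at x L. arm r x k N s X"
proof -
  obtain u where u: "u \<in> ball_at x k" "in_infinite r X u" using assms(1) by (auto simp: hits_infinite_def)
  obtain v where v: "v \<in> ball_at y k" "in_infinite r X v" using assms(2) by (auto simp: hits_infinite_def)
  have uX: "u \<in> X \<inter> centered_box (2 * N)" using u assms(4) by (auto simp: in_infinite_def)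
  have "conn r (X \<inter> ball_at x L) u v"
    using assms(3,6,7) u v infinite_escapes unfolding glued_def by blast
  then obtain a b where ab: "conn r (X \<inter> ball_at x L \<inter> centered_box (2 * N)) u a" "a \<in> X \<inter> ball_at x L \<inter> centered_box (2 * N)"
      "b \<in> X \<inter> ball_at x L - centered_box (2 * N)" "r a b"
    by (rule conn_exit[of _ _ _ _ "centered_box (2 * N)"]) (use uX v assms(5) in blast)+
  have "conn r (X \<inter> centered_box (2 * N)) u a" by (rule conn_mono[OF ab(1)]) blast
  then have "exits r X N (side N b) u" using ab unfolding exits_def by blast
  then show ?thesis using ab uX u unfolding arm_def by blast
qed

text \<open>Each arm ends outside the box and hence outside \<open>ball_at x K\<close>, so its
  starting node escapes; gluing then joins the three starting nodes inside the box.\<close>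

lemma tripod_of_arms:
  assumes "\<And>s. s \<in> {0,1,2} \<Longrightarrow> arm r (a s) k N s X" "\<And>s. s \<in> {0,1,2} \<Longrightarrow> ball_at (a s) k \<subseteq> ball_at x n"
    and g: "glued r x n K X" and sub: "ball_at x K \<subseteq> centered_box (2 * N)"
  shows "tripod r X N"
proof -
  have "\<exists>u. u \<in> ball_at (a s) k \<inter> X \<inter> centered_box (2 * N) \<and> exits r X N s u" if "s \<in> {0,1,2}" for s
    using assms(1)[OF that] by (auto simp: arm_def)
  then obtain u where u: "\<And>s. s \<in> {0,1,2} \<Longrightarrow> u s \<in> ball_at (a s) k \<inter> X \<inter> centered_box (2 * N) \<and> exits r X N s (u s)" by metis
  have esc: "escapes r x K X (u s)" if "s \<in> {0,1,2}" for s
  proof -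
    note us = u[OF that]
    then obtain v w where "conn r (X \<inter> centered_box (2 * N)) (u s) v" "v \<in> X \<inter> centered_box (2 * N)" "w \<in> X - centered_box (2 * N)" "r v w"
      unfolding exits_def by blast
    then have "conn r X (u s) w" by (meson DiffD1 IntD1 conn_edge conn_mono conn_trans inf_le1)
    then show ?thesis using \<open>w \<in> X - centered_box (2 * N)\<close> sub us unfolding escapes_def by blast
  qed
  have c: "conn r (X \<inter> centered_box (2 * N)) (u 0) (u s)" if "s \<in> {0,1,2}" for s
  proof -
    have "u 0 \<in> ball_at x n" "u s \<in> ball_at x n" using u[of 0] u[OF that] assms(2)[of 0] assms(2)[OF that] by auto
    moreover have "escapes r x K X (u 0)" by (rule esc) simp
    ultimately have "conn r (X \<inter> ball_at x K) (u 0) (u s)"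
      using g esc[OF that] unfolding glued_def by blast
    then show ?thesis by (rule conn_mono) (use sub in blast)
  qed
  have "exits r X N s (u 0)" if "s \<in> {0,1,2}" for s
    using exits_trans c[OF that] u[OF that] by blast
  then show ?thesis using u[of 0] unfolding tripod_def by blast
qed

lemma glued_increasing:
  assumes "glued r x n K X" "K \<le> L"
  shows "glued r x n L X"
proof -
  have "conn r (X \<inter> ball_at x L) u v" if uv: "u \<in> ball_at x n" "v \<in> ball_at x n" "escapes r x L X u" "escapes r x L X v" for u v
  proof -
    have "escapes r x K X u" "escapes r x K X v" using that(3,4) ball_at_mono[OF assms(2), of x] by (auto simp: escapes_def)
    then have "conn r (X \<inter> ball_at x K) u v" using assms(1) uv unfolding glued_def by blast
    then show ?thesis by (rule conn_mono) (use ball_at_mono[OF assms(2), of x] in blast)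
  qed
  then show ?thesis unfolding glued_def by blast
qed

text \<open>Two nodes of infinite clusters are joined by a finite path, which lies in some ball,
  while a node of a finite cluster ceases to escape once the ball covers its cluster. Only finitely
  many pairs of nodes are concerned, so one radius serves all.\<close>

lemma eventually_glued:
  assumes uniq: "\<And>u v. in_infinite r X u \<Longrightarrow> in_infinite r X v \<Longrightarrow> conn r X u v"
  shows "\<exists>K::nat. glued r 0 n (int K) X"
proof -
  have "\<exists>K::nat. \<forall>L::nat. K \<le> L \<longrightarrow> (escapes r 0 (int L) X u \<and> escapes r 0 (int L) X v \<longrightarrow> conn r (X \<inter> ball_at 0 (int L)) u v)" for u v
  proof (cases "in_infinite r X u \<and> in_infinite r X v")
    case True
    then have "conn r X u v" "u \<in> X" using uniq by (auto simp: in_infinite_def)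
    then obtain p where p: "p \<noteq> []" "hd p = u" "last p = v" "set p \<subseteq> X" "successively r p" using conn_path by metis
    obtain K where "K \<ge> 0" "set p \<subseteq> centered_box K" using finite_subset_box[of "set p"] by auto
    then have "set p \<subseteq> X \<inter> ball_at 0 (int L)" if "nat K \<le> L" for L
    proof -
      have "K \<le> int L" using that by linarith
      then show ?thesis using p(4) box_mono[of K "int L"] \<open>set p \<subseteq> centered_box K\<close> by (auto simp: ball_at_def)
    qed
    then have "\<forall>L\<ge>nat K. conn r (X \<inter> ball_at 0 (int L)) u v" using path_conn[OF p(5,1)] p(2,3) by blast
    then show ?thesis by blast
  next
    case False
    have fin: "\<exists>K::nat. \<forall>L\<ge>K. \<not> escapes r 0 (int L) X t" if "\<not> in_infinite r X t" for t
    proof (cases "t \<in> X")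
      case True
      then have "finite {w. conn r X t w}" using that by (auto simp: in_infinite_def)
      then obtain K where K: "K \<ge> 0" "{w. conn r X t w} \<subseteq> centered_box K" using finite_subset_box by blast
      have "\<not> escapes r 0 (int L) X t" if "nat K \<le> L" for L
      proof -
        have "K \<le> int L" using that by linarith
        then show ?thesis using K box_mono[of K "int L"] by (auto simp: escapes_def ball_at_def)
      qed
      then show ?thesis by blast
    qed (auto simp: escapes_def)
    show ?thesis using False fin[of u] fin[of v] by blast
  qed
  then obtain K where K: "\<And>u v L. K u v \<le> L \<Longrightarrow> escapes r 0 (int L) X u \<and> escapes r 0 (int L) X v \<Longrightarrow> conn r (X \<inter> ball_at 0 (int L)) u v"
    by metis
  define L where "L = Max ((\<lambda>(u, v). K u v) ` (centered_box n \<times> centered_box n))"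
  have "K u v \<le> L" if "u \<in> centered_box n" "v \<in> centered_box n" for u v
    unfolding L_def using that finite_box by (intro Max_ge) auto
  then have "glued r 0 n (int L) X" using K unfolding glued_def ball_at_def by simp
  then show ?thesis by blast
qed

section \<open>Translating the events\<close>

lemma conn_translate:
  fixes u v x :: node
  assumes "\<And>u v z. r (u + z) (v + z) = r u v"
  shows "conn r ((\<lambda>v. v - x) ` X) u v \<longleftrightarrow> conn r X (u + x) (v + x)"
proof
  assume "conn r ((\<lambda>v. v - x) ` X) u v"
  then have "conn r ((\<lambda>v. v + x) ` (\<lambda>v. v - x) ` X) (u + x) (v + x)" by (rule conn_image) (simp add: assms)
  then show "conn r X (u + x) (v + x)" by (simp add: image_image)
next
  assume "conn r X (u + x) (v + x)"
  then have "conn r ((\<lambda>v. v - x) ` X) (u + x - x) (v + x - x)"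
    by (rule conn_image) (metis assms diff_add_cancel)
  then show "conn r ((\<lambda>v. v - x) ` X) u v" by simp
qed

lemma in_infinite_translate:
  fixes u x :: node
  assumes "\<And>u v z. r (u + z) (v + z) = r u v"
  shows "in_infinite r ((\<lambda>v. v - x) ` X) u \<longleftrightarrow> in_infinite r X (u + x)"
proof -
  have *: "{w. conn r X (u + x) w} = (\<lambda>w. w + x) ` {w. conn r X (u + x) (w + x)}"
  proof (intro set_eqI iffI)
    fix w assume "w \<in> {w. conn r X (u + x) w}"
    then show "w \<in> (\<lambda>w. w + x) ` {w. conn r X (u + x) (w + x)}" by (intro image_eqI[of _ _ "w - x"]) auto
  qed auto
  have "finite {w. conn r X (u + x) (w + x)} = finite {w. conn r X (u + x) w}"
    unfolding * by (rule finite_image_iff[symmetric]) (simp add: inj_on_def)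
  then show ?thesis
    unfolding in_infinite_def conn_translate[of r, OF assms] by (force simp: image_iff)
qed

lemma ball_at_translate: "u \<in> ball_at 0 n \<longleftrightarrow> u + x \<in> ball_at x n"
  by (simp add: ball_at_def)

lemma ex_translate:
  fixes x :: "'a::group_add"
  shows "(\<exists>u. P (u + x)) \<longleftrightarrow> (\<exists>u. P u)" "(\<forall>u. P (u + x)) \<longleftrightarrow> (\<forall>u. P u)"
  by (metis diff_add_cancel)+

lemma hits_infinite_translate:
  assumes "\<And>u v z. r (u + z) (v + z) = r u v"
  shows "hits_infinite r 0 k ((\<lambda>v. v - x) ` X) \<longleftrightarrow> hits_infinite r x k X"
  unfolding hits_infinite_def Bex_def in_infinite_translate[of r, OF assms] ball_at_translate[of _ _ x]
  by (rule ex_translate)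

lemma escapes_translate:
  assumes "\<And>u v z. r (u + z) (v + z) = r u v"
  shows "escapes r 0 K ((\<lambda>v. v - x) ` X) u \<longleftrightarrow> escapes r x K X (u + x)"
proof -
  have "u \<in> (\<lambda>v. v - x) ` X \<longleftrightarrow> u + x \<in> X" by (force simp: image_iff)
  then show ?thesis
    unfolding escapes_def conn_translate[of r, OF assms] ball_at_translate[of _ _ x]
    using ex_translate(1)[of "\<lambda>w. w \<notin> ball_at x K \<and> conn r X (u + x) w" x] by simp
qed

lemma glued_translate:
  assumes "\<And>u v z. r (u + z) (v + z) = r u v"
  shows "glued r 0 n K ((\<lambda>v. v - x) ` X) \<longleftrightarrow> glued r x n K X"
proof -
  have *: "(\<lambda>v. v - x) ` X \<inter> ball_at 0 K = (\<lambda>v. v - x) ` (X \<inter> ball_at x K)"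
    by (force simp: ball_at_def image_iff)
  show ?thesis
    unfolding glued_def Ball_def * escapes_translate[of r, OF assms] conn_translate[of r, OF assms] ball_at_translate[of _ _ x]
    by (subst ex_translate(2)[of _ x], subst ex_translate(2)[of _ x]) (rule refl)
qed

section \<open>Probability of tripods\<close>

locale percolation = prob_space M for M :: "config measure" +
  fixes r :: "node \<Rightarrow> node \<Rightarrow> bool"
  assumes sets_M [measurable_cong]: "sets M = sets config_space"
    and pa: "positively_associated M"
    and shift_invariant: "\<And>z. distr M config_space (shift z) = M"
    and r_translate: "\<And>u v z. r (u + z) (v + z) = r u v"
    and uniq: "AE \<omega> in M. \<forall>u v. in_infinite r (Collect \<omega>) u \<longrightarrow> in_infinite r (Collect \<omega>) v \<longrightarrow> conn r (Collect \<omega>) u v"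
begin

lemma space_M [simp]: "space M = UNIV"
  using sets_eq_imp_space_eq[OF sets_M] by simp

lemma meas_event: "Measurable.pred config_space P \<Longrightarrow> {\<omega>. P \<omega>} \<in> sets M"
  unfolding sets_M by (simp add: pred_def)

lemma prob_shift:
  assumes P: "Measurable.pred config_space P"
  shows "prob {\<omega>. P (shift z \<omega>)} = prob {\<omega>. P \<omega>}"
proof -
  have "prob {\<omega>. P \<omega>} = measure (distr M config_space (shift z)) {\<omega>. P \<omega>}" by (simp add: shift_invariant)
  also have "\<dots> = prob (shift z -` {\<omega>. P \<omega>} \<inter> space M)"
    using meas_event[OF P] sets_M by (intro measure_distr) auto
  finally show ?thesis by (simp add: vimage_def)
qed

text \<open>Positive association of the complementary decreasing events, obtained by
  inclusion-exclusion.\<close>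

lemma prob_union_increasing:
  assumes "A \<in> sets M" "B \<in> sets M" "increasing_event A" "increasing_event B"
  shows "(1 - prob A) * (1 - prob B) \<le> 1 - prob (A \<union> B)"
proof -
  have "prob A * prob B \<le> prob (A \<inter> B)" using pa assms by (auto simp: positively_associated_def)
  moreover have "prob (A \<union> B) = prob A + prob B - prob (A \<inter> B)"
    using assms by (simp add: measure_Un3 fmeasurable_eq_sets)
  ultimately show ?thesis by (simp add: algebra_simps)
qed

lemma increasing_Un: "increasing_event A \<Longrightarrow> increasing_event B \<Longrightarrow> increasing_event (A \<union> B)"
  and increasing_Int: "increasing_event A \<Longrightarrow> increasing_event B \<Longrightarrow> increasing_event (A \<inter> B)"
  unfolding increasing_event_def by blast+

lemma square_root_trick:
  fixes A :: "nat \<Rightarrow> config set"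
  assumes A: "\<And>s. A s \<in> sets M" "\<And>s. increasing_event (A s)" and S: "S \<subseteq> {0,1,2}"
    and u: "u \<le> prob (\<Union>s\<in>S. A s)" and c: "0 \<le> c" "c \<le> 1" "1 - u < (1 - c)^3"
  shows "\<exists>s\<in>S. c < prob (A s)"
proof (rule ccontr)
  assume "\<not> ?thesis"
  then have no: "prob (A s) \<le> c" if "s \<in> S" for s using that by force
  \<comment> \<open>Missing indices are filled up with the empty event, which is increasing and of
    probability 0, so that there are always three factors.\<close>
  define B where "B s = (if s \<in> S then A s else {})" for s
  have B: "B s \<in> sets M" "increasing_event (B s)" "prob (B s) \<le> c" for s
    using A no c by (auto simp: B_def increasing_event_def)
  have "(\<Union>s\<in>S. A s) = B 0 \<union> B 1 \<union> B 2" using S by (auto simp: B_def)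
  then have "1 - prob (B 0 \<union> B 1 \<union> B 2) \<le> 1 - u" using u by simp
  moreover have "(1 - prob (B 0 \<union> B 1)) * (1 - prob (B 2)) \<le> 1 - prob (B 0 \<union> B 1 \<union> B 2)"
    using B by (intro prob_union_increasing increasing_Un) auto
  moreover have "(1 - c) * (1 - c) \<le> 1 - prob (B 0 \<union> B 1)"
  proof -
    have "(1 - c) * (1 - c) \<le> (1 - prob (B 0)) * (1 - prob (B 1))"
      using B c by (intro mult_mono) auto
    also have "\<dots> \<le> 1 - prob (B 0 \<union> B 1)" using B by (intro prob_union_increasing)
    finally show ?thesis .
  qed
  then have "(1 - c) * (1 - c) * (1 - c) \<le> (1 - prob (B 0 \<union> B 1)) * (1 - prob (B 2))"
    using B c by (intro mult_mono) auto
  ultimately show False using c(3) by (simp add: power3_eq_cube)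
qed

abbreviation "hit x k \<equiv> {\<omega>. hits_infinite r x k (Collect \<omega>)}"
abbreviation "glue x n K \<equiv> {\<omega>. glued r x n K (Collect \<omega>)}"
abbreviation "arms x k N s \<equiv> {\<omega>. arm r x k N s (Collect \<omega>)}"
text \<open>Not assumed to have probability 1; for the filled cluster it is only positive.\<close>

abbreviation "percolates \<equiv> {\<omega>. \<exists>u. in_infinite r (Collect \<omega>) u}"

lemma meas_events [measurable]:
  "hit x k \<in> sets M" "glue x n K \<in> sets M" "arms x k N s \<in> sets M" "percolates \<in> sets M"
  "{\<omega>. tripod r (Collect \<omega>) N} \<in> sets M"
  by (rule meas_event; (simp only: mem_Collect_eq)?; measurable)+

lemma increasing_arms: "increasing_event (arms x k N s)"
  unfolding increasing_event_def
proof (intro allI impI, elim conjE)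
  fix \<xi> \<eta> :: config assume "\<xi> \<in> arms x k N s" "\<xi> \<le> \<eta>"
  then show "\<eta> \<in> arms x k N s"
    using arm_mono[of r x k N s "Collect \<xi>" "Collect \<eta>"] by (simp add: le_fun_def Collect_mono_iff)
qed

lemma prob_hit: "prob (hit x k) = prob (hit 0 k)"
proof -
  have "prob {\<omega>. hits_infinite r 0 k (Collect (shift x \<omega>))} = prob (hit 0 k)"
    by (rule prob_shift) (simp add: measurable_hits_infinite)
  then show ?thesis unfolding Collect_shift hits_infinite_translate[of r, OF r_translate] by simp
qed

lemma prob_glue: "prob (glue x n K) = prob (glue 0 n K)"
proof -
  have "prob {\<omega>. glued r 0 n K (Collect (shift x \<omega>))} = prob (glue 0 n K)"
    by (rule prob_shift) (simp add: measurable_glued)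
  then show ?thesis unfolding Collect_shift glued_translate[of r, OF r_translate] by simp
qed

lemma exists_hit:
  assumes "\<epsilon> > 0"
  shows "\<exists>k::nat. prob (hit 0 (int k)) > prob percolates - \<epsilon>"
proof -
  have mono: "incseq (\<lambda>k::nat. hit 0 (int k))"
  proof (rule incseq_SucI)
    fix k :: nat
    have "ball_at 0 (int k) \<subseteq> ball_at 0 (int (Suc k))" by (rule ball_at_mono) simp
    then show "hit 0 (int k) \<subseteq> hit 0 (int (Suc k))" unfolding hits_infinite_def by blast
  qed
  have "(\<Union>k::nat. hit 0 (int k)) = percolates"
  proof -
    have "\<exists>k::nat. u \<in> ball_at 0 (int k)" for u
      by (rule exI[of _ "nat (\<bar>fst u\<bar> + \<bar>snd u\<bar>)"]) (simp add: ball_at_def centered_box_def)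
    then show ?thesis unfolding hits_infinite_def by blast
  qed
  then have "(\<lambda>k::nat. prob (hit 0 (int k))) \<longlonglongrightarrow> prob percolates"
    using finite_Lim_measure_incseq[OF _ mono] by (simp add: image_subset_iff)
  then have "eventually (\<lambda>k::nat. prob (hit 0 (int k)) > prob percolates - \<epsilon>) sequentially"
    using assms by (intro order_tendstoD) auto
  then show ?thesis by (auto simp: eventually_sequentially)
qed

lemma exists_glue:
  assumes "\<epsilon> > 0"
  shows "\<exists>K\<ge>L. prob (glue 0 n K) > 1 - \<epsilon>"
proof -
  have mono: "incseq (\<lambda>k::nat. glue 0 n (int k))"
    unfolding incseq_def using glued_increasing by (auto simp: subset_iff)
  have "AE \<omega> in M. \<omega> \<in> (\<Union>k::nat. glue 0 n (int k))"
    using uniq eventually_glued by (auto elim!: AE_mp)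
  then have "prob (\<Union>k::nat. glue 0 n (int k)) = 1" by (intro prob_eq_1[THEN iffD2]) auto
  then have "(\<lambda>k::nat. prob (glue 0 n (int k))) \<longlonglongrightarrow> 1"
    using finite_Lim_measure_incseq[OF _ mono] by (simp add: image_subset_iff)
  then have "eventually (\<lambda>k::nat. prob (glue 0 n (int k)) > 1 - \<epsilon>) sequentially"
    using assms by (intro order_tendstoD) auto
  then obtain k0 where "\<And>k. k \<ge> k0 \<Longrightarrow> prob (glue 0 n (int k)) > 1 - \<epsilon>" by (auto simp: eventually_sequentially)
  from this[of "max k0 (nat L)"] show ?thesis by (intro exI[of _ "int (max k0 (nat L))"]) auto
qed

lemma prob_Int_ge: "A \<in> sets M \<Longrightarrow> B \<in> sets M \<Longrightarrow> prob A + prob B - 1 \<le> prob (A \<inter> B)"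
  using measure_Un3[of A M B] prob_le_1[of "A \<union> B"] by (simp add: fmeasurable_eq_sets)

lemma interior_label:
  assumes x: "x \<in> centered_box (2 * N - k)" and u: "u \<le> prob (hit 0 k)" and c: "0 \<le> c" "c \<le> 1" "1 - u < (1 - c)^3"
  shows "\<exists>s\<in>{0,1,2}. c < prob (arms x k N s)"
proof (rule square_root_trick[OF _ increasing_arms subset_refl _ c])
  have "ball_at x k \<subseteq> centered_box (2 * N)" using x by (intro ball_at_subset_box) auto
  then have "hit x k \<subseteq> (\<Union>s\<in>{0,1,2}. arms x k N s)"
    using arm_of_hits_infinite[of r x k _ N] unfolding UN_iff subset_iff mem_Collect_eq by blast
  then have "prob (hit x k) \<le> prob (\<Union>s\<in>{0,1,2}. arms x k N s)" by (rule finite_measure_mono) auto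
  with u show "u \<le> prob (\<Union>s\<in>{0,1,2}. arms x k N s)" unfolding prob_hit[of x] by simp
qed auto

text \<open>Near the boundary of the box, the infinite cluster also meets a ball outside the box nearby, so it leaves the
  box locally.\<close>

lemma boundary_label:
  assumes x: "x \<in> centered_box (2 * N - K)" "x \<notin> centered_box (2 * N - K - 1)" and K: "0 \<le> k" "k \<le> K"
    and hit: "prob percolates - \<delta> \<le> prob (hit 0 k)" and glue: "1 - \<delta> \<le> prob (glue 0 (K + 2 * k + 1) L)"
    and c: "0 \<le> c" "c \<le> 1" "1 - (prob percolates - 3 * \<delta>) < (1 - c)^3"
  shows "\<exists>s\<in>{0,1,2}. c < prob (arms x k N s) \<and> s \<in> side N ` ball_at x L"
proof -
  \<comment> \<open>From radius 2 * N - K this leads to radius 2 * N + k + 1, the first where a ball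
    of radius \<open>k\<close> misses the box.\<close>
  define t where "t = K + k + 1"
  have "\<exists>y. y - x \<in> centered_box t \<and> ball_at y k \<inter> centered_box (2 * N) = {}"
  proof -
    obtain a b where ab: "x = (a, b)" by fastforce
    then have "\<bar>a\<bar> = 2 * N - K \<or> \<bar>b\<bar> = 2 * N - K" using x by (auto simp: centered_box_def)
    then consider "\<bar>a\<bar> = 2 * N - K" | "\<bar>b\<bar> = 2 * N - K" by blast
    then show ?thesis
    proof cases
      case 1
      define a' where "a' = (if 0 \<le> a then a + t else a - t)"
      have a': "\<bar>a'\<bar> = 2 * N + k + 1" "\<bar>a' - a\<bar> \<le> t" using 1 K by (auto simp: t_def a'_def)
      have "ball_at (a', b) k \<inter> centered_box (2 * N) = {}"
      proof -
        have "\<not> \<bar>d\<bar> \<le> 2 * N" if "\<bar>d - a'\<bar> \<le> k" for d using that a'(1) by linarith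
        then show ?thesis by (auto simp: ball_at_def centered_box_def)
      qed
      moreover have "(a', b) - x \<in> centered_box t" using a'(2) ab K by (auto simp: centered_box_def t_def)
      ultimately show ?thesis by blast
    next
      case 2
      define b' where "b' = (if 0 \<le> b then b + t else b - t)"
      have b': "\<bar>b'\<bar> = 2 * N + k + 1" "\<bar>b' - b\<bar> \<le> t" using 2 K by (auto simp: t_def b'_def)
      have "ball_at (a, b') k \<inter> centered_box (2 * N) = {}"
      proof -
        have "\<not> \<bar>d\<bar> \<le> 2 * N" if "\<bar>d - b'\<bar> \<le> k" for d using that b'(1) by linarith
        then show ?thesis by (auto simp: ball_at_def centered_box_def)
      qed
      moreover have "(a, b') - x \<in> centered_box t" using b'(2) ab K by (auto simp: centered_box_def t_def)
      ultimately show ?thesis by blast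
    qed
  qed
  then obtain y where y: "y - x \<in> centered_box t" "ball_at y k \<inter> centered_box (2 * N) = {}" by blast
  \<comment> \<open>Equals t + k, so that the ball around \<open>y\<close> fits in as well.\<close>
  let ?m = "K + 2 * k + 1"
  have sub: "ball_at y k \<subseteq> ball_at x ?m" "ball_at x k \<subseteq> ball_at x ?m" "ball_at x k \<subseteq> centered_box (2 * N)"
  proof -
    show "ball_at y k \<subseteq> ball_at x ?m" by (rule ball_at_subset[OF y(1)]) (simp add: t_def)
    show "ball_at x k \<subseteq> ball_at x ?m" by (rule ball_at_mono) (use K in simp)
    show "ball_at x k \<subseteq> centered_box (2 * N)" by (rule ball_at_subset_box[OF x(1)]) (use K in simp)
  qed
  let ?S = "side N ` ball_at x L"
  have S: "?S \<subseteq> {0,1,2}" by (auto simp: side_def)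
  have "hit x k \<inter> hit y k \<inter> glue x ?m L \<subseteq> (\<Union>s\<in>?S. arms x k N s)"
  proof
    fix \<omega> assume "\<omega> \<in> hit x k \<inter> hit y k \<inter> glue x ?m L"
    then have "\<exists>s\<in>?S. arm r x k N s (Collect \<omega>)"
      by (intro arm_near_boundary[OF _ _ _ sub(3) y(2) sub(2,1)]) simp_all
    then show "\<omega> \<in> (\<Union>s\<in>?S. arms x k N s)" by (simp only: UN_iff mem_Collect_eq)
  qed
  then have "prob (hit x k \<inter> hit y k \<inter> glue x ?m L) \<le> prob (\<Union>s\<in>?S. arms x k N s)"
    by (rule finite_measure_mono) (intro sets.finite_UN meas_events finite_subset[OF S]; simp)
  \<comment> \<open>Both events lie in \<open>percolates\<close>, so inclusion-exclusion loses only
    \<open>prob percolates\<close> instead of 1. This keeps the estimate useful when that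
    probability is small: the intersection still has probability at least
    \<open>prob percolates - 2 * \<delta>\<close>.\<close>
  moreover have "prob (hit x k \<union> hit y k) \<le> prob percolates"
    by (rule finite_measure_mono[OF _ meas_events(4)]) (auto simp: hits_infinite_def)
  then have "prob (hit x k) + prob (hit y k) - prob percolates \<le> prob (hit x k \<inter> hit y k)"
    using measure_Un3[of "hit x k" M "hit y k"] by (simp add: fmeasurable_eq_sets)
  moreover have "prob (hit x k \<inter> hit y k) + prob (glue x ?m L) - 1 \<le> prob (hit x k \<inter> hit y k \<inter> glue x ?m L)"
    by (rule prob_Int_ge) auto
  ultimately have "prob percolates - 3 * \<delta> \<le> prob (\<Union>s\<in>?S. arms x k N s)"
    using hit glue unfolding prob_hit[of x] prob_hit[of y] prob_glue[of x] by linarith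
  have "\<exists>s\<in>?S. c < prob (arms x k N s)"
    by (rule square_root_trick[OF meas_events(3) increasing_arms S _ c]) fact
  then show ?thesis using S by blast
qed

text \<open>Label each \<open>x\<close> by a side to which the ball around \<open>x\<close> is likely to be connected. A unit square with all
  three labels lies well inside the box, and uniqueness of the infinite cluster joins its three arms.\<close>

theorem prob_tripod:
  assumes c: "0 \<le> c" "c \<le> 1" "1 - prob percolates < (1 - c)^3" and \<epsilon>: "\<epsilon> > 0"
  shows "\<exists>N0. \<forall>N\<ge>N0. c^3 - \<epsilon> \<le> prob {\<omega>. tripod r (Collect \<omega>) N}"
proof -
  \<comment> \<open>A quarter of the slack, so that the loss of \<open>3 * \<delta>\<close> in
    \<open>boundary_label\<close> is affordable.\<close>
  define \<delta> where "\<delta> = ((1 - c)^3 - (1 - prob percolates)) / 4"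
  have \<delta>: "\<delta> > 0" "1 - (prob percolates - 3 * \<delta>) < (1 - c)^3" "1 - (prob percolates - \<delta>) < (1 - c)^3"
    using c by (auto simp: \<delta>_def field_simps)
  obtain k' :: nat where k': "prob (hit 0 (int k')) > prob percolates - \<delta>" using exists_hit[OF \<delta>(1)] by blast
  define k where "k = int k'"
  have k: "0 \<le> k" "prob percolates - \<delta> \<le> prob (hit 0 k)" using k' by (auto simp: k_def)
  \<comment> \<open>The corners of a unit square are one step apart, hence k + 1. While
    \<open>K\<close> is for joining the arms of a square, \<open>L\<close> is for the layer near the
    boundary of the box.\<close>
  obtain K where K: "K \<ge> k + 1" "prob (glue 0 (k + 1) K) > 1 - \<epsilon>" using exists_glue[OF \<epsilon>] by blast
  obtain L where L: "L \<ge> 0" "prob (glue 0 (K + 2 * k + 1) L) > 1 - \<delta>" using exists_glue[OF \<delta>(1)] by blast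
  show ?thesis
  proof (intro exI allI impI)
    \<comment> \<open>Large enough for \<open>tri_geometry\<close> with radii L + 1 and K +
      1.\<close>
    fix N assume N: "N \<ge> L + K + 4"
    \<comment> \<open>Three zones: in the interior the label is a side to which an arm is likely; on
      the layer at radius 2 * N - K it is in addition a side occurring within distance
      \<open>L\<close>; farther out, where no arm is claimed, it is the side of \<open>x\<close>
      itself.\<close>
    have "\<exists>s\<in>{0,1,2}. (x \<in> centered_box (2 * N - K) \<longrightarrow> c < prob (arms x k N s)) \<and>
        (x \<notin> centered_box (2 * N - K - 1) \<longrightarrow> s \<in> side N ` ball_at x L) \<and> (x \<notin> centered_box (2 * N - K) \<longrightarrow> s = side N x)" for x
    proof -
      consider "x \<in> centered_box (2 * N - K - 1)" | "x \<in> centered_box (2 * N - K)" "x \<notin> centered_box (2 * N - K - 1)" | "x \<notin> centered_box (2 * N - K)" by blast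
      then show ?thesis
      proof cases
        case 1
        then have "x \<in> centered_box (2 * N - K)" "x \<in> centered_box (2 * N - k)" using K(1) by (auto simp: centered_box_def)
        then show ?thesis using interior_label[OF _ k(2) c(1,2) \<delta>(3)] 1 by blast
      next
        case 2
        then show ?thesis using boundary_label[OF 2 k(1) _ k(2) _ c(1,2) \<delta>(2), of L] K(1) L by force
      next
        case 3
        moreover have "x \<in> ball_at x L" using L by (simp add: ball_at_def centered_box_def)
        moreover have "side N x \<in> {0,1,2}" by (simp add: side_def)
        ultimately show ?thesis by blast
      qed
    qed
    then obtain l where l: "\<And>x. l x \<in> {0,1,2}" "\<And>x. x \<in> centered_box (2 * N - K) \<Longrightarrow> c < prob (arms x k N (l x))"
        "\<And>x. x \<notin> centered_box (2 * N - K - 1) \<Longrightarrow> l x \<in> side N ` ball_at x L" "\<And>x. x \<notin> centered_box (2 * N - K) \<Longrightarrow> l x = side N x"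
      by metis
    have bd: "l v = side N v" if "v \<in> centered_box (2 * N)" "v \<notin> centered_box (2 * N - 1)" for v
      using l(4)[of v] that(2) box_mono[of "2 * N - K" "2 * N - 1"] K k by auto
    have N0: "0 \<le> N" "N < 2 * N" using N K L k by auto
    obtain a b where ab: "{0,1,2} \<subseteq> l ` {(a,b), (a+1,b), (a,b+1), (a+1,b+1)}"
      using sperner_square[OF N0 l(1) bd] by blast
    define Q where "Q = {(a,b), (a+1,b), (a,b+1), (a+1,b+1)}"
    have Q1: "\<bar>fst u - fst v\<bar> \<le> 1 \<and> \<bar>snd u - snd v\<bar> \<le> 1" if "u \<in> Q" "v \<in> Q" for u v
      using that by (auto simp: Q_def)
    have xQ: "(a,b) \<in> Q" by (simp add: Q_def)
    have "\<exists>v. v \<in> Q \<and> l v = s" if s: "s \<in> {0,1,2}" for s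
    proof -
      have "s \<in> l ` Q" using ab s unfolding Q_def by (rule subsetD)
      then show ?thesis by (auto simp only: image_iff)
    qed
    then obtain g where g: "\<And>s. s \<in> {0,1,2} \<Longrightarrow> g s \<in> Q \<and> l (g s) = s" by metis
    let ?x = "(a,b)"
    \<comment> \<open>With one corner too far out, all corners lie on the layer or beyond, so every
      label is the side of some node within distance \<open>L\<close>. Three sides would meet away
      from the centre, against \<open>tri_geometry\<close>.\<close>
    have inside: "v \<in> centered_box (2 * N - K)" if "v \<in> Q" for v
    proof (rule ccontr)
      assume v: "v \<notin> centered_box (2 * N - K)"
      have out: "w \<notin> centered_box (2 * N - K - 1)" if "w \<in> Q" for w
        using v Q1[OF \<open>v \<in> Q\<close> that] by (auto simp: centered_box_def)
      have "\<exists>w. w \<in> ball_at ?x (L + 1) \<and> side N w = s" if s: "s \<in> {0,1,2}" for s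
      proof -
        obtain w where w: "w \<in> ball_at (g s) L" "side N w = s" using l(3)[of "g s"] out g[OF s] by auto
        have "ball_at (g s) L \<subseteq> ball_at ?x (L + 1)"
          using Q1[OF _ xQ, of "g s"] g[OF s] by (intro ball_at_subset[of _ _ 1]) (auto simp: centered_box_def)
        with w show ?thesis by blast
      qed
      then obtain w where w: "\<And>s. s \<in> {0,1,2} \<Longrightarrow> w s \<in> ball_at ?x (L + 1) \<and> side N (w s) = s" by metis
      have "?x \<notin> centered_box (2 * N - (K + 1))" using out[OF xQ] by (simp add: algebra_simps)
      then show False
        using w[of 0] w[of 1] w[of 2] N L K k
        by (intro tri_geometry[of "L + 1" N "K + 1" ?x "w 0" "w 1" "w 2"]) auto
    qed
    have x: "ball_at ?x K \<subseteq> centered_box (2 * N)" using inside[OF xQ] by (intro ball_at_subset_box) auto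
    have gs: "ball_at (g s) k \<subseteq> ball_at ?x (k + 1)" if "s \<in> {0,1,2}" for s
      using Q1[OF _ xQ, of "g s"] g[OF that] by (intro ball_at_subset[of _ _ 1]) (auto simp: centered_box_def)
    let ?A = "\<lambda>s. arms (g s) k N s"
    have A: "c < prob (?A s)" if "s \<in> {0,1,2}" for s using g[OF that] inside l(2) by metis
    have "?A 0 \<inter> ?A 1 \<inter> ?A 2 \<inter> glue ?x (k + 1) K \<subseteq> {\<omega>. tripod r (Collect \<omega>) N}"
    proof
      fix \<omega> assume \<omega>: "\<omega> \<in> ?A 0 \<inter> ?A 1 \<inter> ?A 2 \<inter> glue ?x (k + 1) K"
      then have "arm r (g s) k N s (Collect \<omega>)" if "s \<in> {0,1,2}" for s using that by auto
      then show "\<omega> \<in> {\<omega>. tripod r (Collect \<omega>) N}"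
        using tripod_of_arms[of r g k N "Collect \<omega>" ?x "k + 1" K] gs \<omega> x by blast
    qed
    then have "prob (?A 0 \<inter> ?A 1 \<inter> ?A 2 \<inter> glue ?x (k + 1) K) \<le> prob {\<omega>. tripod r (Collect \<omega>) N}"
      by (rule finite_measure_mono) auto
    moreover have "prob (?A 0 \<inter> ?A 1 \<inter> ?A 2) + prob (glue ?x (k + 1) K) - 1 \<le> prob (?A 0 \<inter> ?A 1 \<inter> ?A 2 \<inter> glue ?x (k + 1) K)"
      by (rule prob_Int_ge) auto
    moreover have "c^3 \<le> prob (?A 0 \<inter> ?A 1 \<inter> ?A 2)"
    proof -
      have "c * c \<le> prob (?A 0) * prob (?A 1)" using A[of 0] A[of 1] c by (intro mult_mono) auto
      also have "\<dots> \<le> prob (?A 0 \<inter> ?A 1)" using pa increasing_arms by (auto simp: positively_associated_def)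
      finally have "c * c * c \<le> prob (?A 0 \<inter> ?A 1) * prob (?A 2)" using A[of 2] c by (intro mult_mono) auto
      also have "\<dots> \<le> prob (?A 0 \<inter> ?A 1 \<inter> ?A 2)"
        using pa increasing_arms increasing_Int by (auto simp: positively_associated_def)
      finally show ?thesis by (simp add: power3_eq_cube)
    qed
    ultimately show "c^3 - \<epsilon> \<le> prob {\<omega>. tripod r (Collect \<omega>) N}"
      using K(2) unfolding prob_glue[of ?x] by linarith
  qed
qed

end

section \<open>The filled infinite cluster\<close>

lemma conn_component:
  assumes "conn r A x y" shows "conn r {z. conn r A x z} x y"
  using assms
proof (induction rule: conn_induct)
  case (step a b)
  then have "conn r {z. conn r A x z} a b" by (intro conn_edge) (auto intro: conn_trans conn_edge)
  with step show ?case by (blast intro: conn_trans)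
qed auto

lemma conn_cluster_mono: "conn r A x y \<Longrightarrow> {w. conn r A y w} \<subseteq> {w. conn r A x w}"
  by (rule Collect_mono) (blast intro: conn_trans)

lemma component_wrt_conn:
  assumes r: "symp r" and x: "x \<in> A"
  shows "component_wrt r A {y. conn r A x y}"
proof -
  let ?K = "{y. conn r A x y}"
  have "?K \<subseteq> A" using conn_in2 x by fastforce
  moreover have "connected_wrt r ?K"
    unfolding connected_wrt_iff
    using conn_component[of r A x] conn_sym[OF r, of ?K] conn_trans[of r ?K] by blast
  moreover have "E = ?K" if "?K \<subseteq> E" "E \<subseteq> A" "connected_wrt r E" for E
  proof -
    have "x \<in> E" using that(1) by auto
    then show ?thesis using that conn_mono[of r E x] unfolding connected_wrt_iff by blast
  qed
  ultimately show ?thesis unfolding component_wrt_def by blast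
qed

lemma component_wrt_eq:
  assumes r: "symp r" and C: "component_wrt r A C" "x \<in> C"
  shows "x \<in> A" "C = {y. conn r A x y}"
proof -
  show x: "x \<in> A" using C by (auto simp: component_wrt_def)
  have "C \<subseteq> {y. conn r A x y}"
    using C conn_mono[of r C x] unfolding component_wrt_def connected_wrt_iff by blast
  moreover have "{y. conn r A x y} \<subseteq> A" "connected_wrt r {y. conn r A x y}"
    using component_wrt_conn[OF r x] by (auto simp: component_wrt_def)
  ultimately show "C = {y. conn r A x y}" using C(1) unfolding component_wrt_def by blast
qed

lemma infinite_component_iff:
  assumes "symp r"
  shows "component_wrt r A C \<and> infinite C \<longleftrightarrow> (\<exists>x. in_infinite r A x \<and> C = {y. conn r A x y})"
proof
  assume *: "component_wrt r A C \<and> infinite C"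
  then obtain x where "x \<in> C" by (metis infinite_imp_nonempty ex_in_conv)
  then show "\<exists>x. in_infinite r A x \<and> C = {y. conn r A x y}"
    using component_wrt_eq[OF assms, of A C x] * unfolding in_infinite_def by blast
next
  assume "\<exists>x. in_infinite r A x \<and> C = {y. conn r A x y}"
  then show "component_wrt r A C \<and> infinite C"
    using component_wrt_conn[OF assms, of _ A] unfolding in_infinite_def by blast
qed

lemma infinite_one_star_cluster_iff:
  "infinite_one_star_cluster \<sigma> C \<longleftrightarrow>
     (\<exists>x. in_infinite star_adjacent (Collect \<sigma>) x \<and> C = {y. conn star_adjacent (Collect \<sigma>) x y})"
  unfolding infinite_one_star_cluster_def one_star_cluster_def by (rule infinite_component_iff[OF symp_star_adjacent])

lemma infinite_zero_cluster_iff: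
  "infinite_zero_cluster \<sigma> C \<longleftrightarrow>
     (\<exists>x. in_infinite adjacent (- Collect \<sigma>) x \<and> C = {y. conn adjacent (- Collect \<sigma>) x y})"
proof -
  have "{v. \<not> \<sigma> v} = - Collect \<sigma>" by auto
  then show ?thesis
    unfolding infinite_zero_cluster_def zero_cluster_def by (simp add: infinite_component_iff[OF symp_adjacent])
qed

definition unique_infinite :: "(node \<Rightarrow> node \<Rightarrow> bool) \<Rightarrow> node set \<Rightarrow> bool" where
  "unique_infinite r A \<longleftrightarrow> (\<forall>u v. in_infinite r A u \<longrightarrow> in_infinite r A v \<longrightarrow> conn r A u v)"

lemma unique_infinite_iff:
  assumes r: "symp r"
  shows "unique_infinite r A \<longleftrightarrow>
    (\<forall>C D. (\<exists>x. in_infinite r A x \<and> C = {y. conn r A x y}) \<and> (\<exists>x. in_infinite r A x \<and> D = {y. conn r A x y}) \<longrightarrow> C = D)"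
    (is "_ \<longleftrightarrow> ?R")
proof
  assume u: "unique_infinite r A"
  have "conn r A x z \<longleftrightarrow> conn r A y z" if "in_infinite r A x" "in_infinite r A y" for x y z
    using u that conn_trans[of r A] unfolding unique_infinite_def by blast
  then show ?R by blast
next
  assume R: ?R
  have "conn r A x y" if "in_infinite r A x" "in_infinite r A y" for x y
  proof -
    have "{z. conn r A x z} = {z. conn r A y z}" using R that by blast
    then show ?thesis by auto
  qed
  then show "unique_infinite r A" by (simp add: unique_infinite_def)
qed

lemma Uniq_one_star_cluster_iff:
  "(\<exists>\<^sub>\<le>\<^sub>1C. infinite_one_star_cluster \<sigma> C) \<longleftrightarrow> unique_infinite star_adjacent (Collect \<sigma>)"
  unfolding Uniq_def infinite_one_star_cluster_iff unique_infinite_iff[OF symp_star_adjacent] by blast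

lemma ex1_one_star_cluster_iff:
  "(\<exists>!C. infinite_one_star_cluster \<sigma> C) \<longleftrightarrow>
     (\<exists>x. in_infinite star_adjacent (Collect \<sigma>) x) \<and> unique_infinite star_adjacent (Collect \<sigma>)"
  unfolding ex1_iff_ex_Uniq Uniq_one_star_cluster_iff by (metis infinite_one_star_cluster_iff)

lemma ex1_zero_cluster_iff:
  "(\<exists>!C. infinite_zero_cluster \<sigma> C) \<longleftrightarrow>
     (\<exists>x. in_infinite adjacent (- Collect \<sigma>) x) \<and> unique_infinite adjacent (- Collect \<sigma>)"
  unfolding ex1_iff_ex_Uniq Uniq_def infinite_zero_cluster_iff unique_infinite_iff[OF symp_adjacent] by blast

text \<open>The union of all infinite 1*clusters: no cluster has to be chosen, and the set grows
  with the configuration.\<close>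

definition infinite_part :: "config \<Rightarrow> node set" where
  "infinite_part \<sigma> = {v. in_infinite star_adjacent (Collect \<sigma>) v}"

text \<open>Formulated for nodes of either spin, so that finite 1*clusters inside the holes are
  absorbed along with the 0clusters.\<close>

definition enclosed :: "node set \<Rightarrow> node \<Rightarrow> bool" where
  "enclosed J v \<longleftrightarrow> (\<exists>p. star_circuit p \<and> set p \<subseteq> J \<and> v \<notin> set p \<and> finite {w. conn adjacent (- set p) v w})"

text \<open>Agrees with the filled infinite cluster when the infinite boundary exists, but is increasing on all
  configurations, so that positive association passes to its law.\<close>

definition filled :: "config \<Rightarrow> config" where
  "filled \<sigma> v \<longleftrightarrow> v \<in> infinite_part \<sigma> \<or> enclosed (infinite_part \<sigma>) v"

lemma infinite_part_step:
  assumes "u \<in> infinite_part \<sigma>" "conn star_adjacent (Collect \<sigma>) u v"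
  shows "v \<in> infinite_part \<sigma>"
proof -
  have "{w. conn star_adjacent (Collect \<sigma>) u w} \<subseteq> {w. conn star_adjacent (Collect \<sigma>) v w}"
    using conn_trans[OF conn_sym[OF symp_star_adjacent assms(2)]] by blast
  then show ?thesis
    using assms conn_in2[OF assms(2)] unfolding infinite_part_def in_infinite_def
    by (auto dest: finite_subset)
qed

lemma infinite_part_subset: "infinite_part \<sigma> \<subseteq> Collect \<sigma>"
  by (auto simp: infinite_part_def in_infinite_def)

lemma filled_imp_infinite_part:
  assumes "filled \<sigma> v" shows "\<exists>u. u \<in> infinite_part \<sigma>"
proof (cases "v \<in> infinite_part \<sigma>")
  case False
  then obtain p where "p \<noteq> []" "set p \<subseteq> infinite_part \<sigma>"
    using assms unfolding filled_def enclosed_def star_circuit_def by blast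
  then show ?thesis using hd_in_set by blast
qed blast

lemma mono_filled: "\<sigma> \<le> \<eta> \<Longrightarrow> filled \<sigma> \<le> filled \<eta>"
proof -
  assume "\<sigma> \<le> \<eta>"
  then have sub: "Collect \<sigma> \<subseteq> Collect \<eta>" by (auto simp: le_fun_def)
  have "infinite_part \<sigma> \<subseteq> infinite_part \<eta>"
  proof
    fix v assume "v \<in> infinite_part \<sigma>"
    moreover have "{w. conn star_adjacent (Collect \<sigma>) v w} \<subseteq> {w. conn star_adjacent (Collect \<eta>) v w}"
      using conn_mono[OF _ sub] by blast
    ultimately show "v \<in> infinite_part \<eta>"
      using sub unfolding infinite_part_def in_infinite_def by (auto dest: finite_subset)
  qed
  then show ?thesis unfolding filled_def enclosed_def le_fun_def le_bool_def by blast
qed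

text \<open>A one that is *adjacent to the infinite part belongs to it. If instead \<open>a\<close>
  is enclosed by a *circuit, a step to \<open>b\<close> outside must pass diagonally by a node of
  the circuit, and that node is adjacent to \<open>b\<close>.\<close>

lemma filled_boundary_zero:
  assumes a: "filled \<sigma> a" and b: "\<not> filled \<sigma> b" and ab: "star_adjacent a b"
  shows "\<not> \<sigma> b"
proof
  assume sb: "\<sigma> b"
  have J: "b \<in> infinite_part \<sigma>" if "c \<in> infinite_part \<sigma>" "star_adjacent c b" for c
    using infinite_part_step[OF that(1)] that infinite_part_subset sb by (blast intro: conn_edge)
  then have "a \<notin> infinite_part \<sigma>" using ab b unfolding filled_def by blast
  then have "enclosed (infinite_part \<sigma>) a" using a by (auto simp: filled_def)
  then obtain p where p: "star_circuit p" "set p \<subseteq> infinite_part \<sigma>" "a \<notin> set p" "finite {w. conn adjacent (- set p) a w}"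
    by (auto simp: enclosed_def)
  have bp: "b \<notin> set p" using b p(2) by (auto simp: filled_def)
  have nb: "\<not> conn adjacent (- set p) a b"
  proof
    assume "conn adjacent (- set p) a b"
    then have "{w. conn adjacent (- set p) b w} \<subseteq> {w. conn adjacent (- set p) a w}" by (rule conn_cluster_mono)
    then have "enclosed (infinite_part \<sigma>) b" using p bp finite_subset unfolding enclosed_def by blast
    then show False using b by (simp add: filled_def)
  qed
  from ab show False
  proof (cases rule: star_adjacent_cases)
    case 1
    then show ?thesis using nb conn_edge[of a "- set p" b adjacent] p bp by blast
  next
    case (2 c)
    have "c \<in> set p"
    proof (rule ccontr)
      assume "c \<notin> set p"
      then have "conn adjacent (- set p) a b"
        using conn_trans[OF conn_edge[of a "- set p" c adjacent] conn_edge[of c "- set p" b adjacent]] 2 p bp by blast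
      with nb show False by blast
    qed
    then show ?thesis using J[of c] p(2) 2 adjacent_imp_star_adjacent b by (auto simp: filled_def)
  qed
qed

text \<open>A walk from \<open>v\<close> to the circuit first leaves the finite component of
  \<open>v\<close> at a node of the circuit, and all nodes before are enclosed as well.\<close>

lemma enclosed_reaches:
  assumes "enclosed J v" "J \<subseteq> S" "\<And>w. enclosed J w \<Longrightarrow> w \<in> S"
  obtains b where "b \<in> J" "conn adjacent S v b"
proof -
  obtain p where p: "star_circuit p" "set p \<subseteq> J" "v \<notin> set p" "finite {w. conn adjacent (- set p) v w}"
    using assms(1) by (auto simp: enclosed_def)
  let ?H = "{w. conn adjacent (- set p) v w}"
  have H: "w \<notin> set p" "enclosed J w" if "w \<in> ?H" for w
  proof -
    show wp: "w \<notin> set p" using that conn_in2[of adjacent "- set p" v w] p(3) by auto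
    have "{z. conn adjacent (- set p) w z} \<subseteq> ?H" using that by (intro conn_cluster_mono) simp
    then show "enclosed J w" using p wp finite_subset unfolding enclosed_def by blast
  qed
  have "hd p \<in> set p" using p by (simp add: star_circuit_def)
  then have "hd p \<notin> ?H" using H by blast
  then obtain a b where ab: "conn adjacent (UNIV \<inter> ?H) v a" "a \<in> UNIV \<inter> ?H" "b \<in> UNIV - ?H" "adjacent a b"
    by (rule conn_exit[OF conn_UNIV[of v "hd p"], rotated]) auto
  have "b \<in> set p"
  proof (rule ccontr)
    assume "b \<notin> set p"
    then have "conn adjacent (- set p) v b"
      using conn_trans[OF _ conn_edge[of a "- set p" b adjacent], of v] ab H(1)[of a] by blast
    then show False using ab by blast
  qed
  then have "b \<in> J" using p by blast
  moreover have "conn adjacent S v a" using ab(1) by (rule conn_mono) (use H assms(3) in blast)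
  moreover have "conn adjacent S a b" using ab H assms \<open>b \<in> J\<close> by (intro conn_edge) blast+
  ultimately show thesis using that conn_trans by metis
qed

text \<open>Uniqueness connects the infinite part, and every enclosed node reaches it by
  \<open>enclosed_reaches\<close>.\<close>

lemma filled_connected:
  assumes u: "unique_infinite star_adjacent (Collect \<sigma>)" and ab: "filled \<sigma> a" "filled \<sigma> b"
  shows "conn star_adjacent (Collect (filled \<sigma>)) a b"
proof -
  have JJ: "conn star_adjacent (Collect (filled \<sigma>)) x y" if "x \<in> infinite_part \<sigma>" "y \<in> infinite_part \<sigma>" for x y
  proof -
    have "conn star_adjacent (Collect \<sigma>) x y" using u that unfolding unique_infinite_def infinite_part_def by blast
    then have "conn star_adjacent {z. conn star_adjacent (Collect \<sigma>) x z} x y" by (rule conn_component)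
    then show ?thesis by (rule conn_mono) (use infinite_part_step[OF that(1)] in \<open>auto simp: filled_def\<close>)
  qed
  have toJ: "\<exists>y\<in>infinite_part \<sigma>. conn star_adjacent (Collect (filled \<sigma>)) x y" if "filled \<sigma> x" for x
  proof (cases "x \<in> infinite_part \<sigma>")
    case False
    then have e: "enclosed (infinite_part \<sigma>) x" using that by (simp add: filled_def)
    obtain y where "y \<in> infinite_part \<sigma>" "conn adjacent (Collect (filled \<sigma>)) x y"
      by (rule enclosed_reaches[OF e, of "Collect (filled \<sigma>)"]) (auto simp: filled_def)
    then show ?thesis using conn_mono_rel[of adjacent _ x _ star_adjacent] adjacent_imp_star_adjacent by meson
  qed blast
  show ?thesis using toJ[OF ab(1)] toJ[OF ab(2)] JJ conn_trans conn_sym[OF symp_star_adjacent] by meson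
qed

text \<open>A *circuit of ones does not meet the 0cluster, so a finite component of its complement
  would contain the whole infinite cluster.\<close>

lemma zero_cluster_disjoint_filled:
  assumes u: "in_infinite adjacent (- Collect \<sigma>) u" and w: "conn adjacent (- Collect \<sigma>) u w"
  shows "\<not> filled \<sigma> w"
proof
  assume f: "filled \<sigma> w"
  have "w \<in> - Collect \<sigma>" using conn_in2[OF w] u by (auto simp: in_infinite_def)
  then have "w \<notin> infinite_part \<sigma>" using infinite_part_subset by blast
  then obtain p where p: "set p \<subseteq> infinite_part \<sigma>" "finite {z. conn adjacent (- set p) w z}"
    using f by (auto simp: filled_def enclosed_def)
  have "{z. conn adjacent (- Collect \<sigma>) u z} \<subseteq> {z. conn adjacent (- set p) w z}"
  proof
    fix z assume "z \<in> {z. conn adjacent (- Collect \<sigma>) u z}"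
    then have wz: "conn adjacent (- Collect \<sigma>) w z" using conn_trans[OF conn_sym[OF symp_adjacent w]] by blast
    have "- Collect \<sigma> \<subseteq> - set p" using p(1) infinite_part_subset by blast
    then show "z \<in> {z. conn adjacent (- set p) w z}" using conn_mono[OF wz] by simp
  qed
  then show False using p(2) u finite_subset unfolding in_infinite_def by blast
qed

lemma conn_zero_unfilled:
  assumes "in_infinite adjacent (- Collect \<sigma>) u" "conn adjacent (- Collect \<sigma>) u w"
  shows "conn adjacent (- Collect (filled \<sigma>)) u w"
  using conn_component[OF assms(2)] by (rule conn_mono) (use zero_cluster_disjoint_filled[OF assms(1)] in blast)

lemma infinite_unfilled:
  assumes "in_infinite adjacent (- Collect \<sigma>) u"
  shows "in_infinite adjacent (- Collect (filled \<sigma>)) u"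
proof -
  have "{w. conn adjacent (- Collect \<sigma>) u w} \<subseteq> {w. conn adjacent (- Collect (filled \<sigma>)) u w}"
    using conn_zero_unfilled[OF assms] by blast
  then show ?thesis
    using assms zero_cluster_disjoint_filled[OF assms conn_refl] finite_subset unfolding in_infinite_def by auto
qed

lemma infinite_filled:
  assumes "in_infinite star_adjacent (Collect \<sigma>) u"
  shows "in_infinite star_adjacent (Collect (filled \<sigma>)) u"
proof -
  have J: "u \<in> infinite_part \<sigma>" using assms by (simp add: infinite_part_def)
  have "conn star_adjacent (Collect (filled \<sigma>)) u w" if "conn star_adjacent (Collect \<sigma>) u w" for w
    using conn_component[OF that] by (rule conn_mono) (use infinite_part_step[OF J] in \<open>auto simp: filled_def\<close>)
  then have "{w. conn star_adjacent (Collect \<sigma>) u w} \<subseteq> {w. conn star_adjacent (Collect (filled \<sigma>)) u w}" by blast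
  then show ?thesis using assms J finite_subset unfolding in_infinite_def by (auto simp: filled_def)
qed

text \<open>Every infinite component of the unfilled nodes has an infinite connected inner boundary, which consists of
  zeros and hence lies in an infinite 0cluster.\<close>

lemma unfilled_component_meets_zero_cluster:
  assumes star: "unique_infinite star_adjacent (Collect \<sigma>)" and ne: "filled \<sigma> f"
    and u: "in_infinite adjacent (- Collect (filled \<sigma>)) u"
  obtains x where "conn adjacent (- Collect (filled \<sigma>)) u x" "in_infinite adjacent (- Collect \<sigma>) x"
proof -
  let ?D = "- Collect (filled \<sigma>)"
  define C where "C = {w. conn adjacent ?D u w}"
  have CD: "C \<subseteq> ?D" using u conn_in2 by (fastforce simp: C_def in_infinite_def)
  have C1: "conn adjacent C a b" if "a \<in> C" "b \<in> C" for a b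
  proof -
    have "conn adjacent C u a" "conn adjacent C u b"
      using that conn_component[of adjacent ?D u] unfolding C_def by simp_all
    then show ?thesis using conn_trans conn_sym[OF symp_adjacent] by metis
  qed
  \<comment> \<open>The unfilled component of \<open>a\<close> is disjoint from \<open>C\<close>,
    and the first node met on leaving it is filled.\<close>
  have toF: "\<exists>g. filled \<sigma> g \<and> conn star_adjacent (- C) a g" if a: "a \<notin> C" for a
  proof (cases "filled \<sigma> a")
    case False
    let ?T = "{w. conn adjacent ?D a w}"
    have T: "?T \<subseteq> ?D" using False conn_in2 by fastforce
    have TC: "?T \<inter> C = {}"
    proof (rule ccontr)
      assume "?T \<inter> C \<noteq> {}"
      then obtain z where z: "conn adjacent ?D a z" "conn adjacent ?D u z" by (auto simp: C_def)
      have "a \<in> C" unfolding C_def using conn_trans[OF z(2) conn_sym[OF symp_adjacent z(1)]] by simp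
      with a show False by blast
    qed
    have TC': "UNIV \<inter> ?T \<subseteq> - C" using TC unfolding Int_UNIV_left disjoint_eq_subset_Compl .
    have "f \<notin> ?T" using ne T by blast
    then obtain x y where xy: "conn adjacent (UNIV \<inter> ?T) a x" "x \<in> UNIV \<inter> ?T" "y \<in> UNIV - ?T" "adjacent x y"
      by (rule conn_exit[OF conn_UNIV[of a f], rotated]) auto
    have "filled \<sigma> y"
    proof (rule ccontr)
      assume "\<not> filled \<sigma> y"
      then have "conn adjacent ?D a y"
        using conn_trans[OF _ conn_edge[of x ?D y adjacent], of a] xy T by blast
      with xy show False by blast
    qed
    moreover have ax: "conn star_adjacent (- C) a x"
      using conn_mono_rel[OF xy(1) adjacent_imp_star_adjacent] TC' by (rule conn_mono)
    moreover have "conn star_adjacent (- C) x y"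
      using xy TC CD \<open>filled \<sigma> y\<close> by (intro conn_edge) (auto simp: adjacent_imp_star_adjacent)
    ultimately show ?thesis using conn_trans[OF ax] by blast
  qed blast
  have C2: "conn star_adjacent (- C) a b" if ab: "a \<notin> C" "b \<notin> C" for a b
  proof -
    obtain g h where gh: "filled \<sigma> g" "conn star_adjacent (- C) a g" "filled \<sigma> h" "conn star_adjacent (- C) b h"
      using toF[OF ab(1)] toF[OF ab(2)] by blast
    have "conn star_adjacent (- C) g h"
      using filled_connected[OF star gh(1,3)] by (rule conn_mono) (use CD in blast)
    then show ?thesis using gh conn_trans conn_sym[OF symp_star_adjacent] by meson
  qed
  let ?X = "inner_boundary C"
  \<comment> \<open>Next to \<open>x\<close> there is always a filled node: either \<open>w\<close>
    itself, or the common neighbour of \<open>x\<close> and \<open>w\<close> when \<open>w\<close>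
    is an unfilled node across a diagonal, as otherwise \<open>w\<close> would belong to
    \<open>C\<close>.\<close>
  have XZ: "?X \<subseteq> - Collect \<sigma>"
  proof
    fix x assume "x \<in> ?X"
    then obtain w where xw: "x \<in> C" "w \<notin> C" "star_adjacent x w" by (auto simp: inner_boundary_def)
    have nx: "\<not> filled \<sigma> x" using xw CD by blast
    have stay: "c \<in> C" if "c' \<in> C" "\<not> filled \<sigma> c" "adjacent c' c" for c c'
      using that conn_trans[OF _ conn_edge[of c' ?D c adjacent], of u] CD unfolding C_def by blast
    show "x \<in> - Collect \<sigma>"
    proof (cases "filled \<sigma> w")
      case True
      then show ?thesis using filled_boundary_zero[OF True nx] sympD[OF symp_star_adjacent xw(3)] by simp
    next
      case False
      from xw(3) show ?thesis
      proof (cases rule: star_adjacent_cases)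
        case 1
        then show ?thesis using stay xw False by blast
      next
        case (2 c)
        then have "filled \<sigma> c" using stay[of x c] stay[of c w] xw False by blast
        then show ?thesis
          using filled_boundary_zero[of \<sigma> c x] nx 2 sympD[OF symp_adjacent] adjacent_imp_star_adjacent by blast
      qed
    qed
  qed
  have "infinite C" using u by (simp add: C_def in_infinite_def)
  \<comment> \<open>A finite complement would have a finite inner boundary; here it contains an
    infinite *connected set of filled nodes.\<close>
  moreover have "infinite (- C)"
  proof -
    obtain g where "g \<in> infinite_part \<sigma>" using filled_imp_infinite_part[OF ne] by blast
    then have "infinite {w. conn star_adjacent (Collect (filled \<sigma>)) g w}" "filled \<sigma> g"
      using infinite_filled[of \<sigma> g] by (auto simp: infinite_part_def in_infinite_def)
    moreover have "{w. conn star_adjacent (Collect (filled \<sigma>)) g w} \<subseteq> - C"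
      using CD conn_in2[of star_adjacent "Collect (filled \<sigma>)" g] \<open>filled \<sigma> g\<close> by blast
    ultimately show ?thesis using finite_subset by blast
  qed
  ultimately have inf: "infinite ?X" by (rule infinite_inner_boundary)
  then obtain x where x: "x \<in> ?X" by (metis infinite_imp_nonempty ex_in_conv)
  have "?X \<subseteq> {w. conn adjacent (- Collect \<sigma>) x w}"
    using conn_mono[OF conn_inner_boundary[OF C1 C2 x] XZ] by blast
  then have "in_infinite adjacent (- Collect \<sigma>) x"
    using inf x XZ finite_subset unfolding in_infinite_def by blast
  moreover have "conn adjacent ?D u x" using x by (auto simp: inner_boundary_def C_def)
  ultimately show thesis using that by blast
qed

lemma unique_infinite_unfilled:
  assumes star: "unique_infinite star_adjacent (Collect \<sigma>)" and zero: "unique_infinite adjacent (- Collect \<sigma>)"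
  shows "unique_infinite adjacent (- Collect (filled \<sigma>))"
proof (cases "\<exists>f. filled \<sigma> f")
  case True
  then obtain f where f: "filled \<sigma> f" by blast
  show ?thesis
    unfolding unique_infinite_def
  proof (intro allI impI)
    fix u v assume uv: "in_infinite adjacent (- Collect (filled \<sigma>)) u" "in_infinite adjacent (- Collect (filled \<sigma>)) v"
    obtain x where x: "conn adjacent (- Collect (filled \<sigma>)) u x" "in_infinite adjacent (- Collect \<sigma>) x"
      using unfilled_component_meets_zero_cluster[OF star f uv(1)] by blast
    obtain y where y: "conn adjacent (- Collect (filled \<sigma>)) v y" "in_infinite adjacent (- Collect \<sigma>) y"
      using unfilled_component_meets_zero_cluster[OF star f uv(2)] by blast
    have "conn adjacent (- Collect (filled \<sigma>)) x y"
      using conn_zero_unfilled[OF x(2)] zero x(2) y(2) unfolding unique_infinite_def by blast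
    then show "conn adjacent (- Collect (filled \<sigma>)) u v"
      using x y conn_trans conn_sym[OF symp_adjacent] by meson
  qed
next
  case False
  then have "- Collect (filled \<sigma>) = UNIV" by auto
  then show ?thesis by (simp add: unique_infinite_def conn_UNIV)
qed

section \<open>Agreement with the filled infinite 1*cluster\<close>

lemma boundary_exists_iff:
  "boundary_exists \<sigma> \<longleftrightarrow> (\<exists>x. in_infinite adjacent (- Collect \<sigma>) x) \<and> unique_infinite adjacent (- Collect \<sigma>) \<and>
     (\<exists>x. in_infinite star_adjacent (Collect \<sigma>) x) \<and> unique_infinite star_adjacent (Collect \<sigma>)"
  unfolding boundary_exists_def ex1_zero_cluster_iff ex1_one_star_cluster_iff by blast

text \<open>The flipped zeros are exactly the enclosed ones. A *path of the flipped configuration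
  that starts in the infinite part stays in the filled set: by \<open>filled_boundary_zero\<close>
  an original one next to that set belongs to it, and a flipped zero is enclosed.\<close>

lemma filled_infinite_one_star_cluster_eq:
  assumes "boundary_exists \<sigma>"
  shows "filled_infinite_one_star_cluster \<sigma> = Collect (filled \<sigma>)"
proof -
  let ?J = "infinite_part \<sigma>"
  obtain x where x: "in_infinite star_adjacent (Collect \<sigma>) x" and u: "unique_infinite star_adjacent (Collect \<sigma>)"
    using assms by (auto simp: boundary_exists_iff)
  have xJ: "x \<in> ?J" using x by (simp add: infinite_part_def)
  have J: "?J = {y. conn star_adjacent (Collect \<sigma>) x y}"
  proof (intro equalityI subsetI)
    fix v assume "v \<in> ?J"
    then show "v \<in> {y. conn star_adjacent (Collect \<sigma>) x y}"
      using u x unfolding unique_infinite_def infinite_part_def by blast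
  qed (use infinite_part_step[OF xJ] in blast)
  have "(THE I. infinite_one_star_cluster \<sigma> I) = ?J"
  proof (rule the1_equality)
    show "\<exists>!I. infinite_one_star_cluster \<sigma> I" using assms by (simp add: boundary_exists_def)
    show "infinite_one_star_cluster \<sigma> ?J" unfolding infinite_one_star_cluster_iff using x J by blast
  qed
  define h where "h = fill_holes \<sigma> ?J"
  have Jh: "?J \<subseteq> Collect h" using infinite_part_subset by (auto simp: h_def fill_holes_def)
  have Z: "{v. \<not> \<sigma> v} = - Collect \<sigma>" by auto
  have enc_h: "h v" if e: "enclosed ?J v" for v
  proof (cases "\<sigma> v")
    case False
    obtain p where p: "star_circuit p" "set p \<subseteq> ?J" "v \<notin> set p" "finite {w. conn adjacent (- set p) v w}"
      using e by (auto simp: enclosed_def)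
    let ?E = "{w. conn adjacent (- Collect \<sigma>) v w}"
    have "zero_cluster \<sigma> ?E" unfolding zero_cluster_def Z using False by (intro component_wrt_conn[OF symp_adjacent]) auto
    moreover have "?E \<subseteq> {w. conn adjacent (- set p) v w}"
      using conn_mono[of adjacent "- Collect \<sigma>" v _ "- set p"] p(2) infinite_part_subset by blast
    then have "star_encircled ?J ?E"
      using p component_wrt_conn[OF symp_adjacent, of v "- set p"] unfolding star_encircled_def by blast
    ultimately show ?thesis by (auto simp: h_def fill_holes_def)
  qed (simp add: h_def fill_holes_def)
  have hole_enc: "enclosed ?J v" if hv: "h v" "\<not> \<sigma> v" for v
  proof -
    obtain E where E: "star_encircled ?J E" "v \<in> E" using hv unfolding h_def fill_holes_def by blast
    then obtain p H where p: "star_circuit p" "set p \<subseteq> ?J" "component_wrt adjacent (- set p) H" "finite H" "E \<subseteq> H"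
      by (auto simp: star_encircled_def)
    then have "v \<in> - set p" "H = {w. conn adjacent (- set p) v w}"
      using component_wrt_eq[OF symp_adjacent p(3), of v] E by auto
    then show ?thesis using p by (auto simp: enclosed_def)
  qed
  have fh: "h v" if "filled \<sigma> v" for v using that enc_h Jh unfolding filled_def by blast
  have eq: "Collect (filled \<sigma>) = {y. conn star_adjacent (Collect h) x y}"
  proof (intro set_eqI iffI)
    fix y assume "y \<in> Collect (filled \<sigma>)"
    moreover have "filled \<sigma> x" using xJ by (simp add: filled_def)
    ultimately have "conn star_adjacent (Collect (filled \<sigma>)) x y" using filled_connected[OF u] by auto
    then show "y \<in> {y. conn star_adjacent (Collect h) x y}" using conn_mono[of _ _ _ _ "Collect h"] fh by blast
  next
    fix y assume "y \<in> {y. conn star_adjacent (Collect h) x y}"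
    then have "conn star_adjacent (Collect h) x y" by simp
    then have "filled \<sigma> y"
    proof (induction rule: conn_induct)
      case base
      then show ?case using xJ by (simp add: filled_def)
    next
      case (step a b)
      then show ?case
        using hole_enc[of b] filled_boundary_zero[of \<sigma> a b] by (auto simp: filled_def)
    qed
    then show "y \<in> Collect (filled \<sigma>)" by simp
  qed
  have "(THE F. one_star_cluster h F \<and> ?J \<subseteq> F) = {y. conn star_adjacent (Collect h) x y}"
  proof (rule the_equality)
    have "one_star_cluster h {y. conn star_adjacent (Collect h) x y}"
      unfolding one_star_cluster_def using xJ Jh by (intro component_wrt_conn[OF symp_star_adjacent]) auto
    moreover have "?J \<subseteq> Collect (filled \<sigma>)" by (auto simp: filled_def)
    ultimately show "one_star_cluster h {y. conn star_adjacent (Collect h) x y} \<and> ?J \<subseteq> {y. conn star_adjacent (Collect h) x y}"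
      using eq by simp
  next
    fix F assume "one_star_cluster h F \<and> ?J \<subseteq> F"
    then show "F = {y. conn star_adjacent (Collect h) x y}"
      using component_wrt_eq(2)[OF symp_star_adjacent, of "Collect h" F x] xJ by (auto simp: one_star_cluster_def)
  qed
  with eq show ?thesis
    unfolding filled_infinite_one_star_cluster_def Let_def \<open>(THE I. infinite_one_star_cluster \<sigma> I) = ?J\<close> h_def[symmetric]
    by simp
qed

section \<open>The infinite boundary as a random closed set\<close>

abbreviation hitting_sets :: "(real \<times> real) set set set" where
  "hitting_sets \<equiv> {{F. closed F \<and> F \<inter> K \<noteq> {}} | K. compact K}"

abbreviation squares :: "node set \<Rightarrow> (real \<times> real) set" where
  "squares F \<equiv> \<Union>v\<in>F. node_square v"

text \<open>For adjacent nodes this is the midpoint of the side of \<open>node_square u\<close> that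
  faces \<open>w\<close>.\<close>

definition edge_point :: "node \<Rightarrow> node \<Rightarrow> real \<times> real" where
  "edge_point u w = (of_int (fst u) + 3/4 * of_int (fst w - fst u), of_int (snd u) + 3/4 * of_int (snd w - snd u))"

lemma mem_node_square:
  "x \<in> node_square v \<longleftrightarrow> \<bar>fst x - of_int (fst v)\<bar> \<le> 3/4 \<and> \<bar>snd x - of_int (snd v)\<bar> \<le> 3/4"
  unfolding abs_diff_le_iff by (cases x) (auto simp: node_square_def embed_def cbox_Pair_eq)

lemma edge_point_simps:
  "edge_point (a, b) (a + 1, b) = (of_int a + 3/4, of_int b)" "edge_point (a + 1, b) (a, b) = (of_int a + 1/4, of_int b)"
  "edge_point (a, b) (a, b + 1) = (of_int a, of_int b + 3/4)" "edge_point (a, b + 1) (a, b) = (of_int a, of_int b + 1/4)"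
  by (simp_all add: edge_point_def)

lemma int_near:
  fixes k a :: int and x :: real
  shows "\<bar>x - of_int a\<bar> < 1/8 \<Longrightarrow> \<bar>x - of_int k\<bar> \<le> 3/4 \<Longrightarrow> k = a"
    and "\<bar>x - (of_int a + 3/4)\<bar> < 1/8 \<Longrightarrow> \<bar>x - of_int k\<bar> \<le> 3/4 \<Longrightarrow> k = a \<or> k = a + 1"
    and "\<bar>x - (of_int a + 1/4)\<bar> < 1/8 \<Longrightarrow> \<bar>x - of_int k\<bar> \<le> 3/4 \<Longrightarrow> k = a \<or> k = a + 1"
  by linarith+

text \<open>All other squares keep distance at least 1/4 from the point, so 1/8 is a safe
  margin.\<close>

lemma square_near_edge_point:
  assumes a: "adjacent u w" and x: "\<bar>fst x - fst (edge_point u w)\<bar> < 1/8" "\<bar>snd x - snd (edge_point u w)\<bar> < 1/8"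
    and v: "x \<in> node_square v"
  shows "v = u \<or> v = w"
proof -
  note v = v[unfolded mem_node_square]
  obtain c d where cd: "v = (c, d)" by fastforce
  from a show ?thesis
  proof (cases rule: adjacent_cases)
    case (1 a b)
    note x = x[unfolded 1 edge_point_simps fst_conv snd_conv]
    from int_near(2)[OF x(1) conjunct1[OF v]] int_near(1)[OF x(2) conjunct2[OF v]] show ?thesis using 1 cd by auto
  next
    case (2 a b)
    note x = x[unfolded 2 edge_point_simps fst_conv snd_conv]
    from int_near(3)[OF x(1) conjunct1[OF v]] int_near(1)[OF x(2) conjunct2[OF v]] show ?thesis using 2 cd by auto
  next
    case (3 a b)
    note x = x[unfolded 3 edge_point_simps fst_conv snd_conv]
    from int_near(1)[OF x(1) conjunct1[OF v]] int_near(2)[OF x(2) conjunct2[OF v]] show ?thesis using 3 cd by auto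
  next
    case (4 a b)
    note x = x[unfolded 4 edge_point_simps fst_conv snd_conv]
    from int_near(1)[OF x(1) conjunct1[OF v]] int_near(3)[OF x(2) conjunct2[OF v]] show ?thesis using 4 cd by auto
  qed
qed

lemma edge_point_in_square:
  assumes "adjacent u w" shows "edge_point u w \<in> node_square u"
  using assms by (cases rule: adjacent_cases) (simp_all add: edge_point_simps mem_node_square)

lemma near_edge_point_in_square:
  assumes "adjacent u w" "\<bar>fst x - fst (edge_point u w)\<bar> < 1/8" "\<bar>snd x - snd (edge_point u w)\<bar> < 1/8"
  shows "x \<in> node_square w"
  using assms(1)
proof (cases rule: adjacent_cases)
  case (1 a b)
  note assms(2,3)[unfolded 1 edge_point_simps fst_conv snd_conv]
  then show ?thesis unfolding 1 mem_node_square fst_conv snd_conv of_int_add of_int_1 by linarith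
next
  case (2 a b)
  note assms(2,3)[unfolded 2 edge_point_simps fst_conv snd_conv]
  then show ?thesis unfolding 2 mem_node_square fst_conv snd_conv of_int_add of_int_1 by linarith
next
  case (3 a b)
  note assms(2,3)[unfolded 3 edge_point_simps fst_conv snd_conv]
  then show ?thesis unfolding 3 mem_node_square fst_conv snd_conv of_int_add of_int_1 by linarith
next
  case (4 a b)
  note assms(2,3)[unfolded 4 edge_point_simps fst_conv snd_conv]
  then show ?thesis unfolding 4 mem_node_square fst_conv snd_conv of_int_add of_int_1 by linarith
qed

lemma beyond_edge_point:
  assumes "adjacent u w" "0 < d"
  shows "edge_point u w + (d * of_int (fst w - fst u), d * of_int (snd w - snd u)) \<notin> node_square u"
  using assms by (cases rule: adjacent_cases) (simp_all add: edge_point_simps mem_node_square)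

lemma dist_fst_snd_less: "dist x y < e \<Longrightarrow> \<bar>fst y - fst x\<bar> < e \<and> \<bar>snd y - snd x\<bar> < e"
  for x y :: "real \<times> real"
  using dist_fst_le[of x y] dist_snd_le[of x y] by (auto simp: dist_real_def)

text \<open>Near the point only the squares of \<open>u\<close> and \<open>w\<close> matter. It is
  interior to the square of \<open>w\<close>, which hides it if \<open>w\<close> is in
  \<open>F\<close>, and it lies on the edge of the square of \<open>u\<close>.\<close>

lemma edge_point_frontier_iff:
  assumes a: "adjacent u w"
  shows "edge_point u w \<in> frontier (squares F) \<longleftrightarrow> u \<in> F \<and> w \<notin> F"
proof
  assume "edge_point u w \<in> frontier (squares F)"
  then have "\<exists>x\<in>squares F. dist (edge_point u w) x < 1/8" "\<exists>x. x \<notin> squares F \<and> dist (edge_point u w) x < 1/8"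
    unfolding frontier_straddle by (metis zero_less_divide_1_iff zero_less_numeral)+
  then obtain x y where x: "x \<in> squares F" "dist (edge_point u w) x < 1/8" and y: "y \<notin> squares F" "dist (edge_point u w) y < 1/8"
    by blast
  have "w \<notin> F" using near_edge_point_in_square[OF a, of y] dist_fst_snd_less[OF y(2)] y(1) by blast
  moreover obtain v where "v \<in> F" "x \<in> node_square v" using x(1) by blast
  then have "u \<in> F \<or> w \<in> F" using square_near_edge_point[OF a, of x v] dist_fst_snd_less[OF x(2)] by blast
  ultimately show "u \<in> F \<and> w \<notin> F" by blast
next
  assume F: "u \<in> F \<and> w \<notin> F"
  show "edge_point u w \<in> frontier (squares F)"
    unfolding frontier_straddle
  proof (intro allI impI conjI)
    fix e :: real assume e: "0 < e"
    show "\<exists>x\<in>squares F. dist (edge_point u w) x < e"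
      using F e edge_point_in_square[OF a] by (intro bexI[of _ "edge_point u w"]) auto
    define d where "d = min (e / 2) (1/16)"
    define s where "s = (d * of_int (fst w - fst u), d * of_int (snd w - snd u) :: real)"
    have d: "0 < d" "d < e" "d < 1/8" using e by (auto simp: d_def)
    have "norm s = d" using a d by (cases rule: adjacent_cases) (auto simp: s_def norm_Pair)
    then have ds: "dist (edge_point u w) (edge_point u w + s) = d" by (simp add: dist_norm)
    have "edge_point u w + s \<notin> squares F"
    proof
      assume "edge_point u w + s \<in> squares F"
      then obtain v where v: "v \<in> F" "edge_point u w + s \<in> node_square v" by blast
      have "v = u \<or> v = w"
        using dist_fst_snd_less[of "edge_point u w" "edge_point u w + s" "1/8"] ds d v(2)
        by (intro square_near_edge_point[OF a]) auto
      then show False using beyond_edge_point[OF a d(1)] v F unfolding s_def by blast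
    qed
    then show "\<exists>x. x \<notin> squares F \<and> dist (edge_point u w) x < e" using ds d by (intro exI[of _ "edge_point u w + s"]) auto
  qed
qed

text \<open>If \<open>B\<close> is the boundary of the squares over \<open>F\<close>, these are the
  adjacent pairs with both or neither node in \<open>F\<close>. Each of the two points detects only
  a crossing with its first node inside.\<close>

definition uncut :: "(real \<times> real) set \<Rightarrow> node \<Rightarrow> node \<Rightarrow> bool" where
  "uncut B u w \<longleftrightarrow> adjacent u w \<and> edge_point u w \<notin> B \<and> edge_point w u \<notin> B"

text \<open>The point at distance 3/4 from \<open>v\<close> towards \<open>w\<close> lies on the infinite boundary iff \<open>v\<close> is inside and \<open>w\<close>
  outside the filled cluster; so the cluster is recovered from its boundary.\<close>

definition recover :: "(real \<times> real) set \<Rightarrow> config" where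
  "recover B u \<longleftrightarrow> (\<exists>v w. (uncut B)\<^sup>*\<^sup>* u v \<and> adjacent v w \<and> edge_point v w \<in> B)"

lemma recover_empty: "recover {} = (\<lambda>_. False)"
  by (simp add: recover_def fun_eq_iff)

text \<open>The node \<open>z\<close> rules out \<open>F = UNIV\<close>, whose boundary is empty
  like that of the empty set. From a node of \<open>F\<close>, a walk to \<open>z\<close> finds an
  edge leaving \<open>F\<close>, and the walk is uncut up to there.\<close>

lemma recover_frontier:
  assumes "z \<notin> F"
  shows "recover (frontier (squares F)) = (\<lambda>u. u \<in> F)"
proof
  fix u
  let ?B = "frontier (squares F)"
  have uncut: "uncut ?B a b \<longleftrightarrow> adjacent a b \<and> (a \<in> F \<longleftrightarrow> b \<in> F)" for a b
    using edge_point_frontier_iff[of a b F] edge_point_frontier_iff[of b a F] sympD[OF symp_adjacent, of a b]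
    unfolding uncut_def by blast
  show "recover ?B u = (u \<in> F)"
  proof
    assume "recover ?B u"
    then obtain v w where vw: "(uncut ?B)\<^sup>*\<^sup>* u v" "v \<in> F" using edge_point_frontier_iff unfolding recover_def by blast
    have "u \<in> F \<longleftrightarrow> v \<in> F" using vw(1) by (induction rule: rtranclp_induct) (auto simp: uncut)
    with vw show "u \<in> F" by simp
  next
    assume "u \<in> F"
    then obtain x y where xy: "conn adjacent (UNIV \<inter> F) u x" "x \<in> UNIV \<inter> F" "y \<in> UNIV - F" "adjacent x y"
      using conn_exit[OF conn_UNIV[of u z]] assms by metis
    have "(uncut ?B)\<^sup>*\<^sup>* u x"
      using xy(1)
    proof (induction rule: conn_induct)
      case (step a b)
      then have "uncut ?B a b" by (simp add: uncut)
      with step show ?case by simp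
    qed simp
    moreover have "edge_point x y \<in> ?B" using xy edge_point_frontier_iff by blast
    ultimately show "recover ?B u" using xy unfolding recover_def by blast
  qed
qed

lemma edge_point_translate: "edge_point (u + z) (w + z) = edge_point u w + embed z"
  by (auto simp: edge_point_def embed_def prod_eq_iff algebra_simps)

lemma recover_translate_imp:
  assumes "recover B u"
  shows "recover ((\<lambda>x. x + embed z) ` B) (u + z)"
proof -
  let ?B = "(\<lambda>x. x + embed z) ` B"
  have e: "edge_point (a + z) (b + z) \<in> ?B \<longleftrightarrow> edge_point a b \<in> B" for a b
    unfolding edge_point_translate by (auto simp: image_iff)
  obtain v w where vw: "(uncut B)\<^sup>*\<^sup>* u v" "adjacent v w" "edge_point v w \<in> B" using assms by (auto simp: recover_def)
  have "(uncut ?B)\<^sup>*\<^sup>* (u + z) (v + z)"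
    using vw(1)
  proof (induction rule: rtranclp_induct)
    case (step a b)
    then have "uncut ?B (a + z) (b + z)" by (simp add: uncut_def e adjacent_shift)
    with step show ?case by simp
  qed simp
  then show ?thesis using vw e adjacent_shift(1) unfolding recover_def by metis
qed

lemma embed_uminus: "embed (- z) = - embed z"
  by (simp add: embed_def prod_eq_iff)

lemma recover_translate: "recover ((\<lambda>x. x + embed z) ` B) = shift (- z) (recover B)"
proof
  fix u
  have "(\<lambda>x. x + embed (- z)) ` (\<lambda>x. x + embed z) ` B = B"
    by (simp add: image_image embed_uminus)
  then show "recover ((\<lambda>x. x + embed z) ` B) u = shift (- z) (recover B) u"
    using recover_translate_imp[of "(\<lambda>x. x + embed z) ` B" u "- z"] recover_translate_imp[of B "u - z" z]
    by (auto simp: shift_def)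
qed

section \<open>Measurability of the boundary and of the recovery map\<close>

lemma space_closed_set_space: "space closed_set_space = {F. closed F}"
  and sets_closed_set_space: "sets closed_set_space = sigma_sets {F. closed F} hitting_sets"
  unfolding closed_set_space_def by (subst space_measure_of sets_measure_of; auto)+

lemma hitting_event:
  assumes "compact K"
  shows "{F. closed F \<and> F \<inter> K \<noteq> {}} \<in> sets closed_set_space"
  unfolding sets_closed_set_space
proof (rule sigma_sets.Basic)
  show "{F. closed F \<and> F \<inter> K \<noteq> {}} \<in> hitting_sets"
    unfolding mem_Collect_eq using assms by (intro exI[of _ K] conjI refl)
qed

lemma measurable_closed_set_mem [measurable]: "Measurable.pred closed_set_space (\<lambda>B. x \<in> B)"
proof -
  have "{F. closed F \<and> F \<inter> {x} \<noteq> {}} \<in> sets closed_set_space"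
    by (rule hitting_event) simp
  moreover have "{F. closed F \<and> F \<inter> {x} \<noteq> {}} = {B \<in> space closed_set_space. x \<in> B}"
    unfolding space_closed_set_space by auto
  ultimately show ?thesis by (simp add: pred_def)
qed

lemma measurable_recover [measurable]: "recover \<in> measurable closed_set_space config_space"
proof (rule measurable_into_config_space)
  fix v
  have [measurable]: "Measurable.pred closed_set_space (\<lambda>B. uncut B u w)" for u w
    unfolding uncut_def by measurable
  show "Measurable.pred closed_set_space (\<lambda>B. recover B v)"
    unfolding recover_def by measurable
qed

lemma measurable_translate_closed [measurable]:
  "(\<lambda>F. (\<lambda>x. x + embed z) ` F) \<in> measurable closed_set_space closed_set_space"
  (is "?t \<in> _")
proof -
  have t: "?t \<in> measurable closed_set_space (sigma {F. closed F} hitting_sets)"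
  proof (rule measurable_measure_of)
    show "?t \<in> space closed_set_space \<rightarrow> {F. closed F}"
      using closed_translation[of _ "embed z"] by (auto simp: space_closed_set_space add.commute)
    fix A assume "A \<in> hitting_sets"
    then obtain K where K: "compact K" "A = {F. closed F \<and> F \<inter> K \<noteq> {}}" by blast
    let ?K = "(\<lambda>x. x - embed z) ` K"
    have K': "compact ?K" using K(1) by (intro compact_continuous_image continuous_intros)
    have hit: "?t F \<inter> K \<noteq> {} \<longleftrightarrow> F \<inter> ?K \<noteq> {}" for F by force
    have closed: "closed (?t F)" if "closed F" for F
      using closed_translation[OF that, of "embed z"] by (simp add: add.commute)
    have "?t -` A \<inter> space closed_set_space = {F. closed F \<and> F \<inter> ?K \<noteq> {}}"
    proof (rule set_eqI)
      fix F
      show "F \<in> ?t -` A \<inter> space closed_set_space \<longleftrightarrow> F \<in> {F. closed F \<and> F \<inter> ?K \<noteq> {}}"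
        unfolding K(2) space_closed_set_space Int_iff vimage_eq mem_Collect_eq hit using closed by iprover
    qed
    also have "\<dots> \<in> sets closed_set_space"
      by (rule hitting_event[OF K'])
    finally show "?t -` A \<inter> space closed_set_space \<in> sets closed_set_space" .
  qed auto
  then show ?thesis unfolding closed_set_space_def[symmetric] .
qed

text \<open>The circuits are lists of nodes, of which there are countably many.\<close>

lemma measurable_filled [measurable]: "filled \<in> measurable config_space config_space"
proof (rule measurable_into_config_space)
  fix v
  have [measurable]: "Measurable.pred config_space (\<lambda>\<sigma>. u \<in> infinite_part \<sigma>)" for u
    unfolding infinite_part_def by simp
  show "Measurable.pred config_space (\<lambda>\<sigma>. filled \<sigma> v)"
    unfolding filled_def enclosed_def subset_iff by measurable
qed

lemma measurable_unique_infinite [measurable (raw)]: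
  assumes [measurable]: "\<And>v. Measurable.pred M (\<lambda>\<omega>. v \<in> S \<omega>)"
  shows "Measurable.pred M (\<lambda>\<omega>. unique_infinite r (S \<omega>))"
  unfolding unique_infinite_def by measurable

lemma measurable_boundary_exists [measurable]: "Measurable.pred config_space boundary_exists"
  unfolding boundary_exists_iff[abs_def] by measurable

lemma frontier_local:
  assumes "0 < d" "\<And>y. dist x y < d \<Longrightarrow> y \<in> S \<longleftrightarrow> y \<in> T" "x \<in> frontier S"
  shows "x \<in> frontier T"
  unfolding frontier_straddle
proof (intro allI impI)
  fix e :: real assume "0 < e"
  then have "0 < min d e" using assms(1) by simp
  then have "(\<exists>y\<in>S. dist x y < min d e) \<and> (\<exists>y. y \<notin> S \<and> dist x y < min d e)"
    using assms(3) unfolding frontier_straddle by blast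
  then show "(\<exists>y\<in>T. dist x y < e) \<and> (\<exists>y. y \<notin> T \<and> dist x y < e)" using assms(2) by auto
qed

text \<open>Squares centred far from \<open>K\<close> do not affect the boundary there, which
  reduces a hitting event to finitely many nodes.\<close>

lemma frontier_squares_window:
  assumes "compact K"
  obtains n where "\<And>F. frontier (squares F) \<inter> K = frontier (squares (F \<inter> centered_box n)) \<inter> K"
proof -
  obtain R where R: "\<And>x. x \<in> K \<Longrightarrow> norm x \<le> R" using compact_imp_bounded[OF assms] unfolding bounded_iff by blast
  define n where "n = \<lceil>R\<rceil> + 3"
  have near: "y \<in> squares F \<longleftrightarrow> y \<in> squares (F \<inter> centered_box n)" if "x \<in> K" "dist x y < 1" for x y F
  proof -
    have "v \<in> centered_box n" if v: "y \<in> node_square v" for v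
    proof -
      have "\<bar>fst y - fst x\<bar> < 1" "\<bar>snd y - snd x\<bar> < 1" using dist_fst_snd_less[OF \<open>dist x y < 1\<close>] by auto
      moreover have "\<bar>fst x\<bar> \<le> R" "\<bar>snd x\<bar> \<le> R"
        using R[OF \<open>x \<in> K\<close>] norm_fst_le[of "fst x" "snd x"] norm_snd_le[of "snd x" "fst x"] by auto
      ultimately have "\<bar>real_of_int (fst v)\<bar> \<le> R + 2" "\<bar>real_of_int (snd v)\<bar> \<le> R + 2"
        using v unfolding mem_node_square by linarith+
      then have "\<bar>fst v\<bar> \<le> n" "\<bar>snd v\<bar> \<le> n" unfolding n_def by linarith+
      then show ?thesis by (simp add: centered_box_def)
    qed
    then show ?thesis by blast
  qed
  have "frontier (squares F) \<inter> K = frontier (squares (F \<inter> centered_box n)) \<inter> K" for F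
  proof (intro equalityI subsetI)
    fix x assume x: "x \<in> frontier (squares F) \<inter> K"
    then show "x \<in> frontier (squares (F \<inter> centered_box n)) \<inter> K"
      using frontier_local[of 1 x "squares F" "squares (F \<inter> centered_box n)"] near[of x _ F] by auto
  next
    fix x assume x: "x \<in> frontier (squares (F \<inter> centered_box n)) \<inter> K"
    then show "x \<in> frontier (squares F) \<inter> K"
      using frontier_local[of 1 x "squares (F \<inter> centered_box n)" "squares F"] near[of x _ F] by auto
  qed
  then show thesis using that by blast
qed

lemma infinite_boundary_eq:
  "boundary_exists \<sigma> \<Longrightarrow> infinite_boundary \<sigma> = frontier (squares (Collect (filled \<sigma>)))"
  by (simp add: infinite_boundary_def filled_infinite_one_star_cluster_eq)

lemma measurable_infinite_boundary: "infinite_boundary \<in> measurable config_space closed_set_space"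
proof -
  have "infinite_boundary \<in> measurable config_space (sigma {F. closed F} hitting_sets)"
  proof (rule measurable_measure_of)
    show "infinite_boundary \<in> space config_space \<rightarrow> {F. closed F}"
      by (auto simp: infinite_boundary_def frontier_closed)
    fix A assume "A \<in> hitting_sets"
    then obtain K where K: "compact K" "A = {F. closed F \<and> F \<inter> K \<noteq> {}}" by blast
    obtain n where n: "\<And>F. frontier (squares F) \<inter> K = frontier (squares (F \<inter> centered_box n)) \<inter> K"
      using frontier_squares_window[OF K(1)] by blast
    \<comment> \<open>The possible traces of the filled set on the window. Configurations without a
      boundary contribute nothing, since the dummy value hits no compact set.\<close>
    let ?T = "{T\<in>Pow (centered_box n). frontier (squares T) \<inter> K \<noteq> {}}"
    let ?E = "\<lambda>T. {\<sigma>\<in>space config_space. boundary_exists \<sigma> \<and> (\<forall>v\<in>centered_box n. filled \<sigma> v \<longleftrightarrow> v \<in> T)}"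
    have "\<sigma> \<in> infinite_boundary -` A \<longleftrightarrow> \<sigma> \<in> (\<Union>T\<in>?T. ?E T)" for \<sigma>
    proof (cases "boundary_exists \<sigma>")
      case True
      have "\<sigma> \<in> infinite_boundary -` A \<longleftrightarrow> frontier (squares (Collect (filled \<sigma>) \<inter> centered_box n)) \<inter> K \<noteq> {}"
        using n[of "Collect (filled \<sigma>)"] by (simp add: K(2) infinite_boundary_eq[OF True] frontier_closed)
      also have "\<dots> \<longleftrightarrow> (\<exists>T\<in>?T. Collect (filled \<sigma>) \<inter> centered_box n = T)" by blast
      also have "\<dots> \<longleftrightarrow> \<sigma> \<in> (\<Union>T\<in>?T. ?E T)"
      proof -
        have "Collect (filled \<sigma>) \<inter> centered_box n = T \<longleftrightarrow> (\<forall>v\<in>centered_box n. filled \<sigma> v \<longleftrightarrow> v \<in> T)" if "T \<in> ?T" for T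
          using that by blast
        then show ?thesis using True by simp
      qed
      finally show ?thesis .
    next
      case False
      then show ?thesis by (auto simp: K(2) infinite_boundary_def)
    qed
    then have "infinite_boundary -` A \<inter> space config_space = (\<Union>T\<in>?T. ?E T)"
      by (intro set_eqI) (simp only: space_config_space Int_UNIV_right)
    also have "\<dots> \<in> sets config_space"
    proof (rule sets.finite_UN)
      show "finite ?T" by (rule finite_subset[of _ "Pow (centered_box n)"]) (auto simp: finite_box)
      have "Measurable.pred config_space (\<lambda>\<sigma>. filled \<sigma> v)" for v
        using measurable_compose[OF measurable_filled measurable_config_eval] by simp
      note [measurable] = this
      fix T show "?E T \<in> sets config_space" by measurable
    qed
    finally show "infinite_boundary -` A \<inter> space config_space \<in> sets config_space" .
  qed auto
  then show ?thesis unfolding closed_set_space_def[symmetric] .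
qed

lemma recover_infinite_boundary:
  "recover (infinite_boundary \<sigma>) = (if boundary_exists \<sigma> then filled \<sigma> else (\<lambda>_. False))"
proof (cases "boundary_exists \<sigma>")
  case True
  then obtain x where "in_infinite adjacent (- Collect \<sigma>) x" by (auto simp: boundary_exists_iff)
  then have "x \<notin> Collect (filled \<sigma>)" using zero_cluster_disjoint_filled[OF _ conn_refl] by auto
  then show ?thesis using True by (simp add: infinite_boundary_eq recover_frontier)
qed (simp add: infinite_boundary_def recover_empty)

section \<open>The law of the filled cluster and the contradiction\<close>

locale coexistence = prob_space \<mu> for \<mu> :: "config measure" +
  assumes sets_eq [measurable_cong]: "sets \<mu> = sets config_space"
    and assoc: "positively_associated \<mu>"
    and zero: "AE \<sigma> in \<mu>. \<exists>!C. infinite_zero_cluster \<sigma> C"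
    and one: "AE \<sigma> in \<mu>. \<exists>\<^sub>\<le>\<^sub>1C. infinite_one_star_cluster \<sigma> C"
    and invariant: "translation_invariant (boundary_distribution \<mu>)"
    and positive: "measure \<mu> {\<sigma> \<in> space \<mu>. \<exists>C. infinite_one_star_cluster \<sigma> C} > 0"
begin

lemma space_eq [simp]: "space \<mu> = UNIV"
  using sets_eq_imp_space_eq[OF sets_eq] by simp

lemma event: "Measurable.pred config_space P \<Longrightarrow> {\<sigma>. P \<sigma>} \<in> events"
  unfolding sets_eq by (simp add: pred_def)

lemma AE_good:
  "AE \<sigma> in \<mu>. (\<exists>x. in_infinite adjacent (- Collect \<sigma>) x) \<and> unique_infinite adjacent (- Collect \<sigma>) \<and>
     unique_infinite star_adjacent (Collect \<sigma>)"
  using zero one unfolding ex1_zero_cluster_iff Uniq_one_star_cluster_iff by eventually_elim blast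

definition E :: "config set" where "E = {\<sigma>. boundary_exists \<sigma>}"

lemma E_event [measurable]: "E \<in> events"
  unfolding E_def by (rule event) (rule measurable_boundary_exists)

text \<open>Almost surely \<open>E\<close> amounts to the existence of an infinite 1*cluster, since
  its other conditions hold almost surely.\<close>

lemma prob_E: "prob E > 0"
proof -
  have P: "Measurable.pred config_space (\<lambda>\<sigma>. \<exists>u. in_infinite star_adjacent (Collect \<sigma>) u)" by simp
  have "{\<sigma> \<in> space \<mu>. \<exists>C. infinite_one_star_cluster \<sigma> C} = {\<sigma>. \<exists>u. in_infinite star_adjacent (Collect \<sigma>) u}"
    unfolding infinite_one_star_cluster_iff space_eq by blast
  moreover have "prob {\<sigma>. \<exists>u. in_infinite star_adjacent (Collect \<sigma>) u} = prob E"
    using AE_good by (intro finite_measure_eq_AE event[OF P] E_event) (auto simp: E_def boundary_exists_iff elim!: AE_mp)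
  ultimately show ?thesis using positive by simp
qed

lemma filled_event:
  assumes "A \<in> sets config_space"
  shows "{\<sigma>. filled \<sigma> \<in> A} \<in> events" "{\<sigma>. shift z (filled \<sigma>) \<in> A} \<in> events"
proof -
  have "Measurable.pred config_space (\<lambda>\<omega>. \<omega> \<in> A)" using assms by simp
  note m = measurable_compose[OF measurable_filled this] 
    measurable_compose[OF measurable_filled measurable_compose[OF measurable_shift this]]
  show "{\<sigma>. filled \<sigma> \<in> A} \<in> events" "{\<sigma>. shift z (filled \<sigma>) \<in> A} \<in> events"
    using event[OF m(1)] event[OF m(2)[of z]] by simp_all
qed

text \<open>\<open>recover\<close> turns the conditioned boundary law into the law of
  \<open>filled\<close> given \<open>E\<close>, and it intertwines translations of closed sets with
  shifts of configurations.\<close>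

lemma conditional_shift_invariant:
  assumes A: "A \<in> sets config_space"
  shows "prob (E \<inter> {\<sigma>. shift z (filled \<sigma>) \<in> A}) = prob (E \<inter> {\<sigma>. filled \<sigma> \<in> A})"
proof -
  define U where "U = uniform_measure \<mu> E"
  define P where "P = boundary_distribution \<mu>"
  define Q where "Q = distr P config_space recover"
  have sU [measurable_cong]: "sets U = sets config_space" by (simp add: U_def sets_eq)
  have ib [measurable]: "infinite_boundary \<in> measurable U closed_set_space"
    using measurable_infinite_boundary by (simp cong: measurable_cong_sets[OF sU refl])
  have P: "P = distr U closed_set_space infinite_boundary"
    by (simp add: P_def boundary_distribution_def U_def E_def)
  have sP [measurable_cong]: "sets P = sets closed_set_space" by (simp add: P)
  \<comment> \<open>The sign is chosen so that \<open>recover_translate\<close> yields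
    \<open>shift z\<close>.\<close>
  have inv: "distr P closed_set_space (\<lambda>F. (\<lambda>x. x + embed (- z)) ` F) = P"
    using invariant unfolding translation_invariant_def P_def by blast
  have "distr Q config_space (shift z) = distr P config_space (shift z \<circ> recover)"
    unfolding Q_def by (rule distr_distr) measurable
  also have "shift z \<circ> recover = recover \<circ> (\<lambda>F. (\<lambda>x. x + embed (- z)) ` F)"
    by (simp add: fun_eq_iff recover_translate)
  also have "distr P config_space (recover \<circ> (\<lambda>F. (\<lambda>x. x + embed (- z)) ` F)) =
      distr (distr P closed_set_space (\<lambda>F. (\<lambda>x. x + embed (- z)) ` F)) config_space recover"
    by (rule distr_distr[symmetric]) measurable
  also have "\<dots> = Q" unfolding inv Q_def ..
  finally have Q: "distr Q config_space (shift z) = Q" .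
  have QU: "Q = distr U config_space (\<lambda>\<sigma>. recover (infinite_boundary \<sigma>))"
    unfolding Q_def P by (subst distr_distr) (auto simp: comp_def)
  have ri [measurable]: "(\<lambda>\<sigma>. recover (infinite_boundary \<sigma>)) \<in> measurable U config_space" by measurable
  have *: "measure Q B = prob (E \<inter> {\<sigma>. filled \<sigma> \<in> B}) / prob E" if B: "B \<in> sets config_space" for B
  proof -
    have "measure Q B = measure U ((\<lambda>\<sigma>. recover (infinite_boundary \<sigma>)) -` B \<inter> space U)"
      unfolding QU by (rule measure_distr[OF ri B])
    also have "\<dots> = prob (E \<inter> ((\<lambda>\<sigma>. recover (infinite_boundary \<sigma>)) -` B)) / prob E"
    proof -
      have sp: "space U = UNIV" using sets_eq_imp_space_eq[OF sU] by simp
      have "(\<lambda>\<sigma>. recover (infinite_boundary \<sigma>)) -` B \<inter> space U \<in> events"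
        using measurable_sets[OF ri B] sU sets_eq by simp
      then show ?thesis
        unfolding U_def using prob_E by (subst measure_uniform_measure) (auto simp: sp[unfolded U_def] emeasure_eq_measure)
    qed
    also have "E \<inter> ((\<lambda>\<sigma>. recover (infinite_boundary \<sigma>)) -` B) = E \<inter> {\<sigma>. filled \<sigma> \<in> B}"
      by (auto simp: E_def recover_infinite_boundary)
    finally show ?thesis .
  qed
  have sA: "shift z -` A \<in> sets config_space" using measurable_sets[OF measurable_shift A, of z] by simp
  have spQ: "space Q = UNIV" by (simp add: Q_def)
  have "measure Q A = measure Q (shift z -` A)"
    using measure_distr[of "shift z" Q config_space A] A spQ unfolding Q by (simp add: Q_def)
  then have "prob (E \<inter> {\<sigma>. filled \<sigma> \<in> A}) = prob (E \<inter> {\<sigma>. filled \<sigma> \<in> shift z -` A})"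
    unfolding *[OF A] *[OF sA] using prob_E by simp
  then show ?thesis by (simp add: vimage_def)
qed

definition \<nu> :: "config measure" where "\<nu> = distr \<mu> config_space filled"

lemma measurable_filled_\<mu> [measurable]: "filled \<in> measurable \<mu> config_space"
  using measurable_filled by (simp cong: measurable_cong_sets[OF sets_eq refl])

lemma sets_\<nu> [measurable_cong, simp]: "sets \<nu> = sets config_space"
  by (simp add: \<nu>_def)

lemma space_\<nu> [simp]: "space \<nu> = UNIV"
  by (simp add: \<nu>_def)

lemma prob_space_\<nu>: "prob_space \<nu>"
  unfolding \<nu>_def by (rule prob_space_distr) measurable

lemma measure_\<nu>: "A \<in> sets config_space \<Longrightarrow> measure \<nu> A = prob {\<sigma>. filled \<sigma> \<in> A}"
  unfolding \<nu>_def by (subst measure_distr) (auto simp: vimage_def)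

text \<open>Off \<open>E\<close> the filled set is almost surely empty and thus fixed by shifts, so
  invariance given \<open>E\<close> extends to the unconditional law, for which positive association
  is available.\<close>

lemma shift_\<nu>: "distr \<nu> config_space (shift z) = \<nu>"
proof (rule measure_eqI)
  fix A assume "A \<in> sets (distr \<nu> config_space (shift z))"
  then have A: "A \<in> sets config_space" by simp
  have sA: "shift z -` A \<in> sets config_space" using measurable_sets[OF measurable_shift A, of z] by simp
  interpret nu: prob_space \<nu> by (rule prob_space_\<nu>)
  have "prob {\<sigma>. shift z (filled \<sigma>) \<in> A} = prob {\<sigma>. filled \<sigma> \<in> A}"
  proof -
    have "prob {\<sigma>. shift z (filled \<sigma>) \<in> A} = prob (E \<inter> {\<sigma>. shift z (filled \<sigma>) \<in> A}) + prob ({\<sigma>. shift z (filled \<sigma>) \<in> A} - E)"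
      by (subst finite_measure_Union[symmetric]) (auto intro!: arg_cong[of _ _ prob] filled_event[OF A])
    moreover have "prob {\<sigma>. filled \<sigma> \<in> A} = prob (E \<inter> {\<sigma>. filled \<sigma> \<in> A}) + prob ({\<sigma>. filled \<sigma> \<in> A} - E)"
      by (subst finite_measure_Union[symmetric]) (auto intro!: arg_cong[of _ _ prob] filled_event[OF A])
    moreover have "prob ({\<sigma>. shift z (filled \<sigma>) \<in> A} - E) = prob ({\<sigma>. filled \<sigma> \<in> A} - E)"
    proof (rule finite_measure_eq_AE)
      show "AE \<sigma> in \<mu>. \<sigma> \<in> {\<sigma>. shift z (filled \<sigma>) \<in> A} - E \<longleftrightarrow> \<sigma> \<in> {\<sigma>. filled \<sigma> \<in> A} - E"
        using AE_good
      proof eventually_elim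
        case (elim \<sigma>)
        show ?case
        proof (cases "\<sigma> \<in> E")
          case False
          then have "\<not> filled \<sigma> v" for v
            using elim filled_imp_infinite_part[of \<sigma> v] by (auto simp: E_def boundary_exists_iff infinite_part_def)
          then have "filled \<sigma> = (\<lambda>_. False)" by (simp add: fun_eq_iff)
          then show ?thesis by (simp add: shift_def)
        qed simp
      qed
    qed (auto intro!: filled_event[OF A])
    ultimately show ?thesis using conditional_shift_invariant[OF A] by simp
  qed
  then have "measure \<nu> (shift z -` A) = measure \<nu> A"
    using measure_\<nu>[OF A] measure_\<nu>[OF sA] by simp
  then show "emeasure (distr \<nu> config_space (shift z)) A = emeasure \<nu> A"
    using A by (subst emeasure_distr) (auto simp: nu.emeasure_eq_measure)
qed simp

lemma assoc_\<nu>: "positively_associated \<nu>"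
  unfolding positively_associated_def
proof (intro ballI impI, elim conjE)
  fix A B assume AB: "A \<in> sets \<nu>" "B \<in> sets \<nu>" "increasing_event A" "increasing_event B"
  have inc: "increasing_event {\<sigma>. filled \<sigma> \<in> C}" if "increasing_event C" for C
    using that mono_filled unfolding increasing_event_def by blast
  have AB': "A \<in> sets config_space" "B \<in> sets config_space" using AB by auto
  have "prob {\<sigma>. filled \<sigma> \<in> A} * prob {\<sigma>. filled \<sigma> \<in> B} \<le> prob ({\<sigma>. filled \<sigma> \<in> A} \<inter> {\<sigma>. filled \<sigma> \<in> B})"
    using assoc inc[OF AB(3)] inc[OF AB(4)] filled_event(1)[OF AB'(1)] filled_event(1)[OF AB'(2)]
    unfolding positively_associated_def by blast
  also have "{\<sigma>. filled \<sigma> \<in> A} \<inter> {\<sigma>. filled \<sigma> \<in> B} = {\<sigma>. filled \<sigma> \<in> A \<inter> B}" by blast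
  finally show "measure \<nu> A * measure \<nu> B \<le> measure \<nu> (A \<inter> B)"
    using AB' by (simp add: measure_\<nu>)
qed

definition complement :: "config \<Rightarrow> config" where "complement \<omega> = (\<lambda>v. \<not> \<omega> v)"

lemma Collect_complement: "Collect (complement \<omega>) = - Collect \<omega>"
  by (auto simp: complement_def)

lemma measurable_complement [measurable]: "complement \<in> measurable config_space config_space"
  unfolding complement_def by (rule measurable_into_config_space) measurable

definition \<nu>' :: "config measure" where "\<nu>' = distr \<nu> config_space complement"

lemma measurable_complement_\<nu> [measurable]: "complement \<in> measurable \<nu> config_space"
  using measurable_complement by (simp cong: measurable_cong_sets[OF sets_\<nu> refl])

lemma sets_\<nu>' [measurable_cong, simp]: "sets \<nu>' = sets config_space"
  by (simp add: \<nu>'_def)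

lemma prob_space_\<nu>': "prob_space \<nu>'"
  unfolding \<nu>'_def by (rule prob_space.prob_space_distr[OF prob_space_\<nu>]) measurable

lemma measure_\<nu>': "A \<in> sets config_space \<Longrightarrow> measure \<nu>' A = measure \<nu> {\<omega>. complement \<omega> \<in> A}"
  unfolding \<nu>'_def by (subst measure_distr) (auto simp: vimage_def)

lemma shift_\<nu>': "distr \<nu>' config_space (shift z) = \<nu>'"
proof -
  have "distr \<nu>' config_space (shift z) = distr \<nu> config_space (shift z \<circ> complement)"
    unfolding \<nu>'_def by (rule distr_distr) measurable
  also have "shift z \<circ> complement = complement \<circ> shift z"
    by (simp add: fun_eq_iff shift_def complement_def)
  also have "distr \<nu> config_space (complement \<circ> shift z) = distr (distr \<nu> config_space (shift z)) config_space complement"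
    by (rule distr_distr[symmetric]) measurable
  finally show ?thesis unfolding shift_\<nu> \<nu>'_def .
qed

text \<open>Complementing reverses the order, so preimages of increasing events are decreasing.
  Positive association applies to their complements, and inclusion-exclusion translates
  back.\<close>

lemma assoc_\<nu>': "positively_associated \<nu>'"
  unfolding positively_associated_def
proof (intro ballI impI, elim conjE)
  fix A B assume AB: "A \<in> sets \<nu>'" "B \<in> sets \<nu>'" "increasing_event A" "increasing_event B"
  interpret nu: prob_space \<nu> by (rule prob_space_\<nu>)
  let ?c = "\<lambda>A. {\<omega>. complement \<omega> \<in> A}"
  have ev: "?c C \<in> nu.events" if "C \<in> sets config_space" for C
    using measurable_sets[OF measurable_complement that] by (simp add: vimage_def)
  have AB': "A \<in> sets config_space" "B \<in> sets config_space" using AB by auto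
  note cc = ev[OF AB'(1)] ev[OF AB'(2)]
  have inc: "increasing_event (UNIV - ?c C)" if "increasing_event C" for C
  proof -
    have "complement \<eta> \<le> complement \<xi>" if "\<xi> \<le> \<eta>" for \<xi> \<eta> using that by (auto simp: complement_def le_fun_def)
    then show ?thesis using that unfolding increasing_event_def by blast
  qed
  have compl: "nu.prob (UNIV - C) = 1 - nu.prob C" if "C \<in> nu.events" for C
    using nu.prob_compl[OF that] by simp
  have "nu.prob (UNIV - ?c A) * nu.prob (UNIV - ?c B) \<le> nu.prob ((UNIV - ?c A) \<inter> (UNIV - ?c B))"
    using assoc_\<nu> inc[OF AB(3)] inc[OF AB(4)] sets.compl_sets[OF cc(1)] sets.compl_sets[OF cc(2)]
    unfolding positively_associated_def space_\<nu> by blast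
  also have "(UNIV - ?c A) \<inter> (UNIV - ?c B) = UNIV - (?c A \<union> ?c B)" by blast
  finally have "(1 - nu.prob (?c A)) * (1 - nu.prob (?c B)) \<le> 1 - nu.prob (?c A \<union> ?c B)"
    using cc by (simp add: compl)
  moreover have "nu.prob (?c A \<union> ?c B) = nu.prob (?c A) + nu.prob (?c B) - nu.prob (?c A \<inter> ?c B)"
    using cc by (simp add: measure_Un3 nu.fmeasurable_eq_sets)
  moreover have "?c A \<inter> ?c B = ?c (A \<inter> B)" by blast
  ultimately show "measure \<nu>' A * measure \<nu>' B \<le> measure \<nu>' (A \<inter> B)"
    using AB' by (simp add: measure_\<nu>' algebra_simps)
qed

lemma AE_\<nu>:
  assumes P: "Measurable.pred config_space P" and "AE \<sigma> in \<mu>. P (filled \<sigma>)"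
  shows "AE \<omega> in \<nu>. P \<omega>"
  unfolding \<nu>_def using assms by (subst AE_distr_iff) (auto simp: pred_def)

lemma AE_\<nu>':
  assumes P: "Measurable.pred config_space P" and "AE \<sigma> in \<mu>. P (complement (filled \<sigma>))"
  shows "AE \<omega> in \<nu>'. P \<omega>"
proof -
  have "Measurable.pred config_space (\<lambda>\<omega>. P (complement \<omega>))"
    using measurable_compose[OF measurable_complement P] .
  then have "AE \<omega> in \<nu>. P (complement \<omega>)" using assms by (intro AE_\<nu>)
  then show ?thesis unfolding \<nu>'_def using P by (subst AE_distr_iff) (auto simp: pred_def)
qed

lemma contradiction: False
proof -
  interpret one: percolation \<nu> star_adjacent
  proof (intro percolation.intro percolation_axioms.intro)
    show "AE \<omega> in \<nu>. \<forall>u v. in_infinite star_adjacent (Collect \<omega>) u \<longrightarrow>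
        in_infinite star_adjacent (Collect \<omega>) v \<longrightarrow> conn star_adjacent (Collect \<omega>) u v"
      unfolding unique_infinite_def[symmetric]
    proof (rule AE_\<nu>)
      show "AE \<sigma> in \<mu>. unique_infinite star_adjacent (Collect (filled \<sigma>))"
        using AE_good
        by eventually_elim (auto simp: unique_infinite_def[of _ "Collect (filled _)"] in_infinite_def[of _ "Collect (filled _)"] intro: filled_connected)
    qed measurable
  qed (simp_all add: prob_space_\<nu> assoc_\<nu> shift_\<nu> star_adjacent_shift)
  interpret zero: percolation \<nu>' adjacent
  proof (intro percolation.intro percolation_axioms.intro)
    show "AE \<omega> in \<nu>'. \<forall>u v. in_infinite adjacent (Collect \<omega>) u \<longrightarrow>
        in_infinite adjacent (Collect \<omega>) v \<longrightarrow> conn adjacent (Collect \<omega>) u v"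
      unfolding unique_infinite_def[symmetric]
    proof (rule AE_\<nu>')
      show "AE \<sigma> in \<mu>. unique_infinite adjacent (Collect (complement (filled \<sigma>)))"
        unfolding Collect_complement using AE_good
        by eventually_elim (auto intro: unique_infinite_unfilled)
    qed measurable
  qed (simp_all add: prob_space_\<nu>' assoc_\<nu>' shift_\<nu>' adjacent_shift)
  have "zero.prob zero.percolates = 1"
  proof -
    have "AE \<omega> in \<nu>'. \<exists>u. in_infinite adjacent (Collect \<omega>) u"
    proof (rule AE_\<nu>')
      show "AE \<sigma> in \<mu>. \<exists>u. in_infinite adjacent (Collect (complement (filled \<sigma>))) u"
        unfolding Collect_complement using AE_good by eventually_elim (blast intro: infinite_unfilled)
    qed measurable
    then show ?thesis by (intro zero.prob_eq_1[OF zero.meas_events(4), THEN iffD2]) simp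
  qed
  have "one.prob one.percolates > 0"
  proof -
    have P: "Measurable.pred config_space (\<lambda>\<omega>. \<exists>u. in_infinite star_adjacent (Collect \<omega>) u)" by measurable
    then have A: "one.percolates \<in> sets config_space" by (simp add: pred_def)
    have "E \<subseteq> {\<sigma>. filled \<sigma> \<in> one.percolates}"
      using infinite_filled unfolding E_def boundary_exists_iff subset_iff mem_Collect_eq by blast
    then have "prob E \<le> prob {\<sigma>. filled \<sigma> \<in> one.percolates}"
      using filled_event(1)[OF A] by (rule finite_measure_mono)
    then show ?thesis using prob_E by (simp only: measure_\<nu>[OF A])
  qed
  \<comment> \<open>By Bernoulli's inequality (1 - c)^3 \<ge> 1 - 3 c, and 3 c stays below the
    percolation probability 4 c.\<close>
  define c where "c = one.prob one.percolates / 4"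
  have c: "0 < c" "c \<le> 1" "1 - one.prob one.percolates < (1 - c)^3"
  proof -
    show "0 < c" "c \<le> 1"
      using \<open>one.prob one.percolates > 0\<close> one.prob_le_1[of one.percolates] unfolding c_def by linarith+
    then have "1 - 3 * c \<le> (1 - c)^3" using Bernoulli_inequality[of "- c" 3] by simp
    moreover have "1 - one.prob one.percolates < 1 - 3 * c"
      using \<open>one.prob one.percolates > 0\<close> by (simp add: c_def)
    ultimately show "1 - one.prob one.percolates < (1 - c)^3" by simp
  qed
  \<comment> \<open>Serves both as the error in \<open>one.prob_tripod\<close> and as the resulting
    lower bound c^3 - \<eta> = \<eta>.\<close>
  define \<eta> where "\<eta> = c^3 / 2"
  have \<eta>: "0 < \<eta>" "\<eta> \<le> 1" using c power_le_one[of c 3] by (auto simp: \<eta>_def)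
  obtain N1 where N1: "\<And>N. N \<ge> N1 \<Longrightarrow> \<eta> \<le> one.prob {\<omega>. tripod star_adjacent (Collect \<omega>) N}"
    using one.prob_tripod[of c \<eta>] c \<eta> by (auto simp: \<eta>_def)
  \<comment> \<open>Tripods of zeros then have probability at least 1 - 3 \<eta>/8 - \<eta>/8 = 1 -
    \<eta>/2, which together with \<eta> exceeds 1.\<close>
  have "0 < (\<eta> / 8)^3" using \<eta> by simp
  then obtain N2 where N2: "\<And>N. N \<ge> N2 \<Longrightarrow> (1 - \<eta> / 8)^3 - \<eta> / 8 \<le> zero.prob {\<omega>. tripod adjacent (Collect \<omega>) N}"
    using zero.prob_tripod[of "1 - \<eta> / 8" "\<eta> / 8"] \<eta> \<open>zero.prob zero.percolates = 1\<close> by auto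
  define N where "N = max 1 (max N1 N2)"
  let ?A = "{\<omega>. tripod star_adjacent (Collect \<omega>) N}" and ?B = "{\<omega>. tripod adjacent (- Collect \<omega>) N}"
  have "Measurable.pred config_space (\<lambda>\<omega>. tripod adjacent (Collect \<omega>) N)" by (rule measurable_tripod) simp
  then have T: "{\<omega>. tripod adjacent (Collect \<omega>) N} \<in> sets config_space" by (simp add: pred_def)
  have "zero.prob {\<omega>. tripod adjacent (Collect \<omega>) N} = one.prob ?B"
    using measure_\<nu>'[OF T] by (simp add: Collect_complement)
  then have "(1 - \<eta> / 8)^3 - \<eta> / 8 \<le> one.prob ?B" using N2[of N] by (simp add: N_def)
  moreover have "1 - 3 * (\<eta> / 8) \<le> (1 - \<eta> / 8)^3" using Bernoulli_inequality[of "- \<eta> / 8" 3] \<eta> by simp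
  moreover have "\<eta> \<le> one.prob ?A" using N1[of N] by (simp add: N_def)
  moreover have "one.prob ?A + one.prob ?B \<le> 1"
  proof -
    have ev: "?A \<in> one.events" "?B \<in> one.events"
      using one.meas_events(5) measurable_sets[OF measurable_complement T] by (auto simp: vimage_def Collect_complement)
    have "1 \<le> N" by (simp add: N_def)
    then have "?A \<inter> ?B = {}" using tripod_exclusive[of N "- Collect \<omega>" "Collect \<omega>" for \<omega>] by blast
    then have "one.prob ?A + one.prob ?B = one.prob (?A \<union> ?B)"
      using ev by (intro one.finite_measure_Union[symmetric])
    then show ?thesis using one.prob_le_1[of "?A \<union> ?B"] by simp
  qed
  ultimately show False using \<eta> by (simp add: field_simps)
qed

end

theorem theorem2:
  shows "\<not> (\<exists>\<mu> :: config measure.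
    prob_space \<mu> \<and> sets \<mu> = sets config_space \<and>
    positively_associated \<mu> \<and>
    (AE \<sigma> in \<mu>. \<exists>!C. infinite_zero_cluster \<sigma> C) \<and>
    (AE \<sigma> in \<mu>. \<exists>\<^sub>\<le>\<^sub>1C. infinite_one_star_cluster \<sigma> C) \<and>
    translation_invariant (boundary_distribution \<mu>) \<and>
    measure \<mu> {\<sigma> \<in> space \<mu>. \<exists>C. infinite_one_star_cluster \<sigma> C} > 0)"
proof
  assume "\<exists>\<mu> :: config measure.
    prob_space \<mu> \<and> sets \<mu> = sets config_space \<and>
    positively_associated \<mu> \<and>
    (AE \<sigma> in \<mu>. \<exists>!C. infinite_zero_cluster \<sigma> C) \<and>
    (AE \<sigma> in \<mu>. \<exists>\<^sub>\<le>\<^sub>1C. infinite_one_star_cluster \<sigma> C) \<and>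
    translation_invariant (boundary_distribution \<mu>) \<and>
    measure \<mu> {\<sigma> \<in> space \<mu>. \<exists>C. infinite_one_star_cluster \<sigma> C} > 0"
  then obtain \<mu> :: "config measure" where "coexistence \<mu>"
    unfolding coexistence_def coexistence_axioms_def by blast
  then show False by (rule coexistence.contradiction)
qed

end
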